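(* Let $G$ be one of the groups $\mathcal{R},\mathcal{G}_l,\mathcal{G}_r,\mathcal{G}_{lr}$ and let $A\in\mathfrak{m}\cdot M_{m,n}$. The following statements are equivalent, and if one of them holds then $A$ is finitely $G$-determined: 1. $\mathfrak{m}^{l+1}\cdot M_{m,n}\subset\widetilde T_A(GA)$ for some positive integer $l$. 2. $\dim_K\left(\mathfrak{m}\cdot M_{m,n}/\widetilde T_A(GA)\right)=:d<\infty$. 3. $\dim_K\left(M_{m,n}/\widetilde T^e_A(GA)\right)=:d_e<\infty$. 4. $\mathfrak{m}^{h}\cdot M_{m,n}\subset\widetilde T^e_A(GA)$ for some positive integer $h$. 5. $\mathfrak{m}^k\subset I_{mn}\left(\Theta_{(G,A)}\right)$ for some positive integer $k$, where $R^t\xrightarrow{\Theta_{(G,A)}}M_{m,n}\to M_{m,n}/\widetilde T^e_A(GA)\to 0$ is a presentation of $M_{m,n}/\widetilde T^e_A(GA)$; i.e. $V\left(I_{mn}(\Theta_{(G,A)})\right)\subset\{\mathfrak{m}\}$. 6. $\mathrm{Supp}\left(M_{m,n}/\widetilde T^e_A(GA)\right)\subset\{\mathfrak{m}\}$, i.e. $(M_{m,n})_P=(\widetilde T^e_A(GA))_P$ for all $P\in\mathrm{Spec}(R)\smallsetminus\{\mathfrak{m}\}$. Furthermore, if condition 1 (resp. 2, 3, 4, 5) holds, then $A$ is $G$ $(2c-\mathrm{ord}(A)+2)$-determined, where $c=l$ (resp. $d$, $d_e$, $h$, $k$).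
   Context: $K$ is a field of arbitrary characteristic, $R=K[[x_1,\ldots,x_s]]$ is the formal power series ring with maximal ideal $\mathfrak{m}$, and $M_{m,n}$ is the $R$-module of $m\times n$ matrices with entries in $R$. Groups and actions: $\mathcal{R}=\mathrm{Aut}(R)$ is the group of $K$-algebra automorphisms of $R$; $\mathcal{G}_l=GL(m,R)\rtimes\mathcal{R}$, $\mathcal{G}_r=GL(n,R)\rtimes\mathcal{R}$, $\mathcal{G}_{lr}=(GL(m,R)\times GL(n,R))\rtimes\mathcal{R}$. They act on $M_{m,n}$ by $\phi(A)=[\phi(a_{ij})]$, $U\cdot\phi(A)$, $\phi(A)\cdot V$, $U\cdot\phi(A)\cdot V$, respectively. $GA$ denotes the orbit of $A$; $A,B$ are $G$-equivalent if $B\in GA$. $A$ is $G$ $k$-determined if every $B\in M_{m,n}$ with $B-A\in\mathfrak{m}^{k+1}\cdot M_{m,n}$ is $G$-equivalent to $A$; $A$ is finitely $G$-determined if it is $G$ $k$-determined for some positive integer $k$. Order: for $0\neq f\in R$, $\mathrm{ord}(f)$ is the maximal integer $l$ with $f\in\mathfrak{m}^l$, and $\mathrm{ord}(0)=\infty$; $\mathrm{ord}(A)=\min_{i,j}\mathrm{ord}(a_{ij})$. Tangent images: let $E_{m,pq}$ (resp. $E_{n,hl}$) be the $m\times m$ (resp. $n\times n$) matrix with $1$ at place $(p,q)$ (resp. $(h,l)$) and $0$ elsewhere, and $\frac{\partial A}{\partial x_\nu}=[\frac{\partial a_{ij}}{\partial x_\nu}]$. Let $\langle E_{m,pq}A\rangle$,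 $\langle AE_{n,hl}\rangle$, $\langle\frac{\partial A}{\partial x_\nu}\rangle$ be the $R$-submodules of $M_{m,n}$ generated by all $E_{m,pq}A$, all $AE_{n,hl}$, all $\frac{\partial A}{\partial x_\nu}$, respectively. Then $\widetilde T_A(\mathcal{R}A)=\mathfrak{m}\langle\frac{\partial A}{\partial x_\nu}\rangle$, $\widetilde T_A(\mathcal{G}_lA)=\langle E_{m,pq}A\rangle+\mathfrak{m}\langle\frac{\partial A}{\partial x_\nu}\rangle$, $\widetilde T_A(\mathcal{G}_rA)=\langle AE_{n,hl}\rangle+\mathfrak{m}\langle\frac{\partial A}{\partial x_\nu}\rangle$, $\widetilde T_A(\mathcal{G}_{lr}A)=\langle E_{m,pq}A\rangle+\langle AE_{n,hl}\rangle+\mathfrak{m}\langle\frac{\partial A}{\partial x_\nu}\rangle$. The extended tangent images $\widetilde T^e_A(GA)$ are defined by the same formulas with $\mathfrak{m}\langle\frac{\partial A}{\partial x_\nu}\rangle$ replaced by $\langle\frac{\partial A}{\partial x_\nu}\rangle$. In condition 5, $M_{m,n}\cong R^{mn}$ and $I_{mn}(\Theta_{(G,A)})$ is the ideal of $R$ generated by all $mn\times mn$ minors of the presentation matrix (the $0$-th Fitting ideal). $V(I)$ denotes the set of primes containing $I$, and $\mathrm{Supp}$ the support of a module. *)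

theory Defs
  imports "HOL-Analysis.Analysis" "HOL-Library.Set_Algebras" "HOL-Library.Extended_Nat"
begin

section \<open>Formal power series in finitely many variables\<close>

text \<open>
  \<open>('k, 's) mfps\<close> is the ring \<open>K[[x\<^sub>1,\<dots>,x\<^sub>s]]\<close>; the variables are indexed by the finite type
  \<open>'s\<close>, so a function \<open>'s \<Rightarrow> nat\<close> is a multi-exponent.
\<close>

typedef ('k, 's) mfps = "UNIV :: (('s \<Rightarrow> nat) \<Rightarrow> 'k) set"
  morphisms mcoeff Abs_mfps ..

lemma mcoeff_Abs_mfps [simp]: "mcoeff (Abs_mfps f) = f"
  by (simp add: Abs_mfps_inverse)

lemma mfps_eqI: "(\<And>a. mcoeff f a = mcoeff g a) \<Longrightarrow> f = g"
  by (metis mcoeff_inverse ext)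

definition splittings :: "('s \<Rightarrow> nat) \<Rightarrow> (('s \<Rightarrow> nat) \<times> ('s \<Rightarrow> nat)) set" where
  "splittings a = {(b, c). \<forall>i. b i + c i = a i}"

lemma finite_splittings [simp]: "finite (splittings (a :: 's::finite \<Rightarrow> nat))"
proof -
  have "finite (Pi\<^sub>E UNIV (\<lambda>i::'s. {..a i}))"
    by (rule finite_PiE) auto
  moreover have "splittings a \<subseteq> Pi\<^sub>E UNIV (\<lambda>i. {..a i}) \<times> Pi\<^sub>E UNIV (\<lambda>i. {..a i})"
    by (auto simp: splittings_def PiE_def Pi_def) (metis le_add1, metis le_add2)
  ultimately show ?thesis
    by (meson finite_SigmaI finite_subset)
qed

instantiation mfps :: (comm_ring_1, finite) comm_ring_1
begin

definition zero_mfps :: "('a, 'b) mfps" where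
  "0 = Abs_mfps (\<lambda>_. 0)"

definition one_mfps :: "('a, 'b) mfps" where
  "1 = Abs_mfps (\<lambda>a. if a = (\<lambda>_. 0) then 1 else 0)"

definition plus_mfps :: "('a, 'b) mfps \<Rightarrow> ('a, 'b) mfps \<Rightarrow> ('a, 'b) mfps" where
  "f + g = Abs_mfps (\<lambda>a. mcoeff f a + mcoeff g a)"

definition minus_mfps :: "('a, 'b) mfps \<Rightarrow> ('a, 'b) mfps \<Rightarrow> ('a, 'b) mfps" where
  "f - g = Abs_mfps (\<lambda>a. mcoeff f a - mcoeff g a)"

definition uminus_mfps :: "('a, 'b) mfps \<Rightarrow> ('a, 'b) mfps" where
  "- f = Abs_mfps (\<lambda>a. - mcoeff f a)"

definition times_mfps :: "('a, 'b) mfps \<Rightarrow> ('a, 'b) mfps \<Rightarrow> ('a, 'b) mfps" where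
  "f * g = Abs_mfps (\<lambda>a. \<Sum>(b, c)\<in>splittings a. mcoeff f b * mcoeff g c)"

instance
proof
  fix f g h :: "('a, 'b) mfps"
  show "f * g * h = f * (g * h)"
  proof (rule mfps_eqI)
    fix a :: "'b \<Rightarrow> nat"
    have "mcoeff (f * g * h) a =
        (\<Sum>(p, q)\<in>Sigma (splittings a) (\<lambda>(b, c). splittings b).
           mcoeff f (fst q) * mcoeff g (snd q) * mcoeff h (snd p))"
      by (simp add: times_mfps_def sum_distrib_right split_def sum.Sigma)
    also have "\<dots> = (\<Sum>(p, q)\<in>Sigma (splittings a) (\<lambda>(b, c). splittings c).
           mcoeff f (fst p) * mcoeff g (fst q) * mcoeff h (snd q))"
      by (rule sum.reindex_bij_witness
            [where i = "\<lambda>((b, c), (u, v)). (((\<lambda>i. b i + u i), v), (b, u))"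
               and j = "\<lambda>((b, c), (u, v)). ((u, (\<lambda>i. v i + c i)), (v, c))"])
         (auto simp: splittings_def fun_eq_iff mult.assoc, (metis add.assoc)+)
    also have "\<dots> = mcoeff (f * (g * h)) a"
      by (simp add: times_mfps_def sum_distrib_left split_def sum.Sigma mult.assoc)
    finally show "mcoeff (f * g * h) a = mcoeff (f * (g * h)) a" .
  qed
  show "f * g = g * f"
  proof (rule mfps_eqI)
    fix a :: "'b \<Rightarrow> nat"
    show "mcoeff (f * g) a = mcoeff (g * f) a"
      unfolding times_mfps_def mcoeff_Abs_mfps
      by (rule sum.reindex_bij_witness[where i = prod.swap and j = prod.swap])
         (auto simp: splittings_def add.commute mult.commute)
  qed
  show "1 * f = f"
  proof (rule mfps_eqI)
    fix a :: "'b \<Rightarrow> nat"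
    have "mcoeff (1 * f) a = (\<Sum>p\<in>{((\<lambda>_. 0), a)}. mcoeff 1 (fst p) * mcoeff f (snd p))"
      unfolding times_mfps_def mcoeff_Abs_mfps split_def
      by (rule sum.mono_neutral_right[OF finite_splittings])
         (auto simp: splittings_def one_mfps_def)
    then show "mcoeff (1 * f) a = mcoeff f a"
      by (simp add: one_mfps_def)
  qed
  show "(f + g) * h = f * h + g * h"
    by (rule mfps_eqI)
       (simp add: times_mfps_def plus_mfps_def distrib_right sum.distrib split_def)
  show "f + g + h = f + (g + h)" "f + g = g + f" "0 + f = f" "- f + f = 0" "f - g = f + - g"
    by (rule mfps_eqI;
        simp add: plus_mfps_def zero_mfps_def uminus_mfps_def minus_mfps_def algebra_simps)+
  have "mcoeff (0 :: ('a, 'b) mfps) (\<lambda>_. 0) \<noteq> mcoeff 1 (\<lambda>_. 0)"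
    by (simp add: zero_mfps_def one_mfps_def)
  then show "(0 :: ('a, 'b) mfps) \<noteq> 1"
    by metis
qed

end

definition mconst :: "'k::comm_ring_1 \<Rightarrow> ('k, 's::finite) mfps" where
  "mconst c = Abs_mfps (\<lambda>a. if a = (\<lambda>_. 0) then c else 0)"

definition mderiv :: "'s \<Rightarrow> ('k::comm_ring_1, 's::finite) mfps \<Rightarrow> ('k, 's) mfps" where
  "mderiv v f = Abs_mfps (\<lambda>a. of_nat (Suc (a v)) * mcoeff f (a(v := Suc (a v))))"

text \<open>The group \<open>\<R> = Aut(R)\<close> of \<open>K\<close>-algebra automorphisms.\<close>

definition Aut_mfps :: "(('k::comm_ring_1, 's::finite) mfps \<Rightarrow> ('k, 's) mfps) set" where
  "Aut_mfps = {\<phi>. bij \<phi> \<and> (\<forall>f g. \<phi> (f + g) = \<phi> f + \<phi> g) \<and> (\<forall>f g. \<phi> (f * g) = \<phi> f * \<phi> g)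
     \<and> (\<forall>c. \<phi> (mconst c) = mconst c)}"


section \<open>Ideals, submodules, quotients, localization\<close>

text \<open>
  Ideals of a commutative ring are the subspaces of the module \<open>(*)\<close>.  For an ideal \<open>I\<close> and a
  submodule \<open>N\<close>, \<open>ideal_smult smul I N\<close> is \<open>I \<cdot> N\<close>; with \<open>smul = (*)\<close> it is the product of ideals.
\<close>

definition ideal_smult ::
  "('r::comm_ring_1 \<Rightarrow> 'b::ab_group_add \<Rightarrow> 'b) \<Rightarrow> 'r set \<Rightarrow> 'b set \<Rightarrow> 'b set" where
  "ideal_smult smul I N = module.span smul {smul a x |a x. a \<in> I \<and> x \<in> N}"

primrec ideal_power :: "'r::comm_ring_1 set \<Rightarrow> nat \<Rightarrow> 'r set" where
  "ideal_power I 0 = UNIV"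
| "ideal_power I (Suc k) = ideal_smult (*) I (ideal_power I k)"

definition prime_ideal :: "'r::comm_ring_1 set \<Rightarrow> bool" where
  "prime_ideal P \<longleftrightarrow>
     module.subspace (*) P \<and> P \<noteq> UNIV \<and> (\<forall>a b. a * b \<in> P \<longrightarrow> a \<in> P \<or> b \<in> P)"

definition V_ideal :: "'r::comm_ring_1 set \<Rightarrow> 'r set set" where
  "V_ideal I = {P. prime_ideal P \<and> I \<subseteq> P}"

text \<open>
  The elements of \<open>V/N\<close> are the cosets \<open>v +o N\<close>.  In the scalar multiple of a coset the summand \<open>N\<close>
  is needed because \<open>smul r ` (v +o N)\<close> is only a coset of \<open>r \<cdot> N\<close>.
\<close>

definition quotient_module :: "'b::ab_group_add set \<Rightarrow> 'b set \<Rightarrow> 'b set set" where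
  "quotient_module V N = (\<lambda>v. v +o N) ` V"

definition quotient_scale ::
  "('r \<Rightarrow> 'b::ab_group_add \<Rightarrow> 'b) \<Rightarrow> 'b set \<Rightarrow> 'r \<Rightarrow> 'b set \<Rightarrow> 'b set" where
  "quotient_scale smul N r X = smul r ` X + N"

text \<open>
  \<open>dim (V/N) = d\<close>: the cosets of some \<open>b\<^sub>0,\<dots>,b\<^bsub>d-1\<^esub>\<close> form a basis, i.e. every element of \<open>V/N\<close> is
  a linear combination of them with unique coefficients.  In particular, the dimension is finite.
\<close>

definition has_quotient_dim ::
  "('k::field \<Rightarrow> 'b::ab_group_add \<Rightarrow> 'b) \<Rightarrow> 'b set \<Rightarrow> 'b set \<Rightarrow> nat \<Rightarrow> bool" where
  "has_quotient_dim smul V N d \<longleftrightarrow>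
     (\<exists>b. (\<forall>i<d. b i \<in> V) \<and>
          (\<forall>X\<in>quotient_module V N.
             \<exists>!c. (\<forall>i\<ge>d. c i = 0) \<and> X = (\<Sum>i<d. smul (c i) (b i)) +o N))"

text \<open>
  Localization at a prime \<open>P\<close> of a module with carrier \<open>Q\<close> and scalar multiplication \<open>smul\<close>: the
  fractions \<open>x/u\<close> are the classes of pairs \<open>(x, u)\<close> with \<open>u \<notin> P\<close>.
\<close>

definition fraction_rel ::
  "('r::comm_ring_1 \<Rightarrow> 'b \<Rightarrow> 'b) \<Rightarrow> 'b set \<Rightarrow> 'r set \<Rightarrow> (('b \<times> 'r) \<times> ('b \<times> 'r)) set" where
  "fraction_rel smul Q P = {((x, u), (y, v)). x \<in> Q \<and> y \<in> Q \<and> u \<notin> P \<and> v \<notin> P \<and>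
     (\<exists>w. w \<notin> P \<and> smul w (smul v x) = smul w (smul u y))}"

definition fraction ::
  "('r::comm_ring_1 \<Rightarrow> 'b \<Rightarrow> 'b) \<Rightarrow> 'b set \<Rightarrow> 'r set \<Rightarrow> 'b \<Rightarrow> 'r \<Rightarrow> ('b \<times> 'r) set" where
  "fraction smul Q P x u = fraction_rel smul Q P `` {(x, u)}"

definition localization ::
  "('r::comm_ring_1 \<Rightarrow> 'b \<Rightarrow> 'b) \<Rightarrow> 'b set \<Rightarrow> 'r set \<Rightarrow> ('b \<times> 'r) set set" where
  "localization smul Q P = {fraction smul Q P x u |x u. x \<in> Q \<and> u \<notin> P}"

text \<open>For a submodule \<open>N\<close> of \<open>Q\<close>: \<open>N\<^sub>P\<close> as a submodule of \<open>Q\<^sub>P\<close>.\<close>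

definition sub_localization ::
  "('r::comm_ring_1 \<Rightarrow> 'b \<Rightarrow> 'b) \<Rightarrow> 'b set \<Rightarrow> 'b set \<Rightarrow> 'r set \<Rightarrow> ('b \<times> 'r) set set" where
  "sub_localization smul Q N P = {fraction smul Q P x u |x u. x \<in> N \<and> u \<notin> P}"

text \<open>
  The support of \<open>V/N\<close>: the primes at which its localization is not the zero module.  The coset
  \<open>N\<close> is the zero element of \<open>V/N\<close>.
\<close>

definition quotient_support ::
  "('r::comm_ring_1 \<Rightarrow> 'b::ab_group_add \<Rightarrow> 'b) \<Rightarrow> 'b set \<Rightarrow> 'b set \<Rightarrow> 'r set set" where
  "quotient_support smul V N = {P. prime_ideal P \<and>
     localization (quotient_scale smul N) (quotient_module V N) P \<noteq>
       {fraction (quotient_scale smul N) (quotient_module V N) P N 1}}"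


section \<open>Matrices over the power series ring\<close>

text \<open>The \<open>R\<close>-module structure on \<open>M\<^bsub>m,n\<^esub>\<close>; \<open>K\<close> acts through constants.\<close>

definition mat_scale :: "'r::comm_ring_1 \<Rightarrow> 'r^'n^'m \<Rightarrow> 'r^'n^'m" where
  "mat_scale r A = (\<chi> i j. r * A $ i $ j)"

definition mat_scale_K ::
  "'k::field \<Rightarrow> ('k, 's::finite) mfps^'n^'m \<Rightarrow> ('k, 's) mfps^'n^'m" where
  "mat_scale_K c = mat_scale (mconst c)"

lemma module_mult: "module ((*) :: 'r::comm_ring_1 \<Rightarrow> 'r \<Rightarrow> 'r)"
  by unfold_locales (simp_all add: algebra_simps)

lemma module_mat_scale: "module (mat_scale :: 'r::comm_ring_1 \<Rightarrow> 'r^'n^'m \<Rightarrow> _)"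
  by unfold_locales (simp_all add: mat_scale_def vec_eq_iff algebra_simps)

text \<open>\<open>\<mm>\<close>: the series with vanishing constant term.\<close>

definition max_ideal :: "('k::field, 's::finite) mfps set" where
  "max_ideal = {f. mcoeff f (\<lambda>_. 0) = 0}"

definition max_pow :: "nat \<Rightarrow> ('k::field, 's::finite) mfps set" where
  "max_pow k = ideal_power max_ideal k"

definition max_pow_mat :: "nat \<Rightarrow> (('k::field, 's::finite) mfps^'n::finite^'m::finite) set" where
  "max_pow_mat k = ideal_smult mat_scale (max_pow k) UNIV"

definition ord_mfps :: "('k::field, 's::finite) mfps \<Rightarrow> enat" where
  "ord_mfps f = (if f = 0 then \<infinity> else enat (GREATEST l. f \<in> max_pow l))"

definition ord_mat :: "('k::field, 's::finite) mfps^'n::finite^'m::finite \<Rightarrow> enat" where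
  "ord_mat A = Min (range (\<lambda>(i, j). ord_mfps (A $ i $ j)))"


section \<open>Groups, orbits, determinacy\<close>

datatype group_kind = Grp_R | Grp_l | Grp_r | Grp_lr

fun group_orbit ::
  "group_kind \<Rightarrow> ('k::field, 's::finite) mfps^'n::finite^'m::finite
     \<Rightarrow> (('k, 's) mfps^'n^'m) set" where
  "group_orbit Grp_R A = {map_matrix \<phi> A |\<phi>. \<phi> \<in> Aut_mfps}"
| "group_orbit Grp_l A = {U ** map_matrix \<phi> A |U \<phi>. invertible U \<and> \<phi> \<in> Aut_mfps}"
| "group_orbit Grp_r A = {map_matrix \<phi> A ** V |V \<phi>. invertible V \<and> \<phi> \<in> Aut_mfps}"
| "group_orbit Grp_lr A =
     {U ** map_matrix \<phi> A ** V |U V \<phi>. invertible U \<and> invertible V \<and> \<phi> \<in> Aut_mfps}"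

definition determined ::
  "group_kind \<Rightarrow> nat \<Rightarrow> ('k::field, 's::finite) mfps^'n::finite^'m::finite \<Rightarrow> bool" where
  "determined G k A \<longleftrightarrow> (\<forall>B. B - A \<in> max_pow_mat (k + 1) \<longrightarrow> B \<in> group_orbit G A)"

definition finitely_determined ::
  "group_kind \<Rightarrow> ('k::field, 's::finite) mfps^'n::finite^'m::finite \<Rightarrow> bool" where
  "finitely_determined G A \<longleftrightarrow> (\<exists>k>0. determined G k A)"


section \<open>Tangent images\<close>

definition mat_unit :: "'m \<Rightarrow> 'm \<Rightarrow> 'r::comm_ring_1^'m^'m" where
  "mat_unit p q = (\<chi> i j. if i = p \<and> j = q then 1 else 0)"

definition left_module :: "'r::comm_ring_1^'n::finite^'m::finite \<Rightarrow> ('r^'n^'m) set" where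
  "left_module A = module.span mat_scale {mat_unit p q ** A |p q. True}"

definition right_module :: "'r::comm_ring_1^'n::finite^'m::finite \<Rightarrow> ('r^'n^'m) set" where
  "right_module A = module.span mat_scale {A ** mat_unit h l |h l. True}"

definition deriv_module ::
  "('k::field, 's::finite) mfps^'n::finite^'m::finite \<Rightarrow> (('k, 's) mfps^'n^'m) set" where
  "deriv_module A = module.span mat_scale {map_matrix (mderiv v) A |v. True}"

fun linear_part ::
  "group_kind \<Rightarrow> 'r::comm_ring_1^'n::finite^'m::finite \<Rightarrow> ('r^'n^'m) set" where
  "linear_part Grp_R A = {0}"
| "linear_part Grp_l A = left_module A"
| "linear_part Grp_r A = right_module A"
| "linear_part Grp_lr A = left_module A + right_module A"

definition tangent_image ::
  "group_kind \<Rightarrow> ('k::field, 's::finite) mfps^'n::finite^'m::finite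
     \<Rightarrow> (('k, 's) mfps^'n^'m) set" where
  "tangent_image G A = linear_part G A + ideal_smult mat_scale max_ideal (deriv_module A)"

definition ext_tangent_image ::
  "group_kind \<Rightarrow> ('k::field, 's::finite) mfps^'n::finite^'m::finite
     \<Rightarrow> (('k, 's) mfps^'n^'m) set" where
  "ext_tangent_image G A = linear_part G A + deriv_module A"


section \<open>Presentations and minors\<close>

text \<open>
  A homomorphism \<open>\<Theta> : R\<^sup>t \<rightarrow> M\<^bsub>m,n\<^esub>\<close> is given by the images \<open>\<Theta> 0, \<dots>, \<Theta> (t - 1)\<close> of the standard
  basis; exactness of \<open>R\<^sup>t \<rightarrow> M\<^bsub>m,n\<^esub> \<rightarrow> M\<^bsub>m,n\<^esub>/N \<rightarrow> 0\<close> says that its image is \<open>N\<close>.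
\<close>

definition presents_quotient ::
  "nat \<Rightarrow> (nat \<Rightarrow> 'r::comm_ring_1^'n::finite^'m::finite) \<Rightarrow> ('r^'n^'m) set \<Rightarrow> bool" where
  "presents_quotient t \<Theta> N \<longleftrightarrow> range (\<lambda>r. \<Sum>j<t. mat_scale (r j) (\<Theta> j)) = N"

lemma ext_tangent_image_presentation_exists:
  "\<exists>t \<Theta>. presents_quotient t \<Theta> (ext_tangent_image G A)"
proof -
  interpret M: module "mat_scale :: ('a, 'b) mfps \<Rightarrow> ('a, 'b) mfps^'c^'d \<Rightarrow> _"
    by (rule module_mat_scale)
  have plus: "M.span X + M.span Y = M.span (X \<union> Y)" for X Y
    by (auto simp: M.span_Un set_plus_def)
  have fl: "finite {mat_unit p q ** A |p q. True}"
    by (rule finite_subset[OF _ finite_imageI[OF finite, of "\<lambda>(p, q). mat_unit p q ** A" UNIV]]) auto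
  have fr: "finite {A ** mat_unit p q |p q. True}"
    by (rule finite_subset[OF _ finite_imageI[OF finite, of "\<lambda>(p, q). A ** mat_unit p q" UNIV]]) auto
  have fd: "finite {map_matrix (mderiv v) A |v. True}"
    by (rule finite_subset[OF _ finite_imageI[OF finite, of "\<lambda>v. map_matrix (mderiv v) A" UNIV]]) auto
  have "\<exists>S. finite S \<and> linear_part G A = M.span S"
    using fl fr M.span_empty
    by (cases G) (auto simp: left_module_def right_module_def plus intro: exI[of _ "{}"])
  then obtain L where L: "finite L" "linear_part G A = M.span L"
    by blast
  define S where "S = L \<union> {map_matrix (mderiv v) A |v. True}"
  have S: "finite S" "ext_tangent_image G A = M.span S"
    using fd L by (simp_all add: S_def ext_tangent_image_def deriv_module_def plus)
  obtain t :: nat and \<Theta> where \<Theta>: "S = \<Theta> ` {i. i < t}" "inj_on \<Theta> {i. i < t}"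
    using finite_imp_nat_seg_image_inj_on[OF S(1)] by blast
  have "range (\<lambda>r. \<Sum>j<t. mat_scale (r j) (\<Theta> j)) = M.span S"
  proof (intro equalityI subsetI)
    fix x assume "x \<in> M.span S"
    then obtain u where "x = (\<Sum>v\<in>S. mat_scale (u v) v)"
      using M.span_finite[OF S(1)] by auto
    then show "x \<in> range (\<lambda>r. \<Sum>j<t. mat_scale (r j) (\<Theta> j))"
      using \<Theta> by (auto simp: sum.reindex lessThan_def intro!: image_eqI[of _ _ "u \<circ> \<Theta>"])
  next
    fix x assume "x \<in> range (\<lambda>r. \<Sum>j<t. mat_scale (r j) (\<Theta> j))"
    then show "x \<in> M.span S"
      using \<Theta>(1) by (auto intro!: M.span_sum M.span_scale intro: M.span_base)
  qed
  then show ?thesis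
    using S(2) by (auto simp: presents_quotient_def)
qed

text \<open>
  Under \<open>M\<^bsub>m,n\<^esub> \<cong> R\<^bsup>mn\<^esup>\<close>, \<open>\<Theta>\<close> is an \<open>mn \<times> t\<close> matrix with rows indexed by \<open>'m \<times> 'n\<close>.
  A maximal minor is specified by an injective choice \<open>\<sigma>\<close> of \<open>mn\<close> columns; reordering
  the columns only changes its sign, so the ideal below is \<open>I\<^bsub>mn\<^esub>(\<Theta>)\<close>.
\<close>

definition minors_ideal ::
  "nat \<Rightarrow> (nat \<Rightarrow> 'r::comm_ring_1^'n::finite^'m::finite) \<Rightarrow> 'r set" where
  "minors_ideal t \<Theta> = module.span (*)
     {det (\<chi> p q. \<Theta> (\<sigma> q) $ fst p $ snd p) |\<sigma> :: 'm \<times> 'n \<Rightarrow> nat. inj \<sigma> \<and> range \<sigma> \<subseteq> {..<t}}"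

end

theory Submission
  imports Defs
begin

text \<open>
  If \<open>\<mm>\<^bsup>l+1\<^esup> M\<close> lies in the tangent image \<open>T\<close>, then \<open>\<mm>\<^bsup>a+l+1\<^esup> M \<subseteq> \<mm>\<^sup>a T\<close>, so a perturbation of
  \<open>A\<close> of order \<open>a + l + 1\<close> has the form \<open>uA + Av + \<Sum> d\<^sub>\<nu> \<partial>A/\<partial>x\<^sub>\<nu>\<close> with \<open>u, v\<close> of order \<open>a\<close> and
  \<open>d\<^sub>\<nu>\<close> of order \<open>a + 1\<close>.  For \<open>a > 0\<close> the group element given by \<open>1 + u\<close>, \<open>1 + v\<close> and
  \<open>x\<^sub>\<nu> \<mapsto> x\<^sub>\<nu> + d\<^sub>\<nu>\<close> realizes it up to order \<open>2a + ord A\<close>, by Taylor expansion to second order, which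
  is available in every characteristic.  This is an improvement as soon as \<open>a + ord A \<ge> l + 2\<close>;
  iterating, the group elements converge in the \<open>\<mm>\<close>-adic topology, which gives the
  bound \<open>2l - ord A + 2\<close>.

  The conditions reduce to this one with the same constant: \<open>\<mm> T\<^sup>e \<subseteq> T\<close>; a quotient of dimension
  \<open>d\<close> is annihilated by \<open>\<mm>\<^sup>d\<close>, by Nakayama's lemma; and the maximal minors of a
  presentation annihilate the presented module.  Conversely, if \<open>\<mm>\<^sup>h M \<subseteq> T\<^sup>e\<close>, then multiplication
  by \<open>x\<^sub>\<nu>\<^sup>h\<close> maps \<open>M\<close> into the column space, so its determinant \<open>x\<^sub>\<nu>\<^bsup>hmn\<^esup>\<close> lies in the ideal of
  minors.  From the conditions on primes one gets back to powers of \<open>\<mm>\<close> because some prime ideal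
  avoids the powers of any variable outside the radical.
\<close>


section \<open>The maximal ideal and its powers\<close>

text \<open>The constant balances a linear term against a quadratic one. Write \<open>e\<close> for
  the order of \<open>A\<close>. An error of order \<open>q + l + 1\<close> is cancelled to first
  order by \<open>u\<close>, \<open>v\<close> of order \<open>q\<close> and \<open>d\<close> of
  order \<open>q + 1\<close>; what remains contains two small factors and has order
  \<open>2 * q + e\<close>. This is progress exactly when \<open>q + e \<ge> l + 2\<close>, so the
  iteration starts at \<open>q = l + 2 - e\<close>, with an error of order
  \<open>2 * l + 3 - e\<close>. That this \<open>q\<close> is positive, without which
  \<open>1 + u\<close> might fail to be invertible, follows from the hypothesis itself: the tangent
  image lies in \<mm>^e M, whence \<open>e \<le> l + 1\<close>.

  In positive characteristic vector fields cannot be exponentiated, so the group element is a bare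
  substitution, and its Taylor remainder is estimated without dividing by factorials. Every
  correction comes from the tangent image at \<open>A\<close> itself, so the hypothesis need not be
  carried along the iteration.

  All \<mm>-adic arguments rest on one description: a series lies in \<mm>^k iff it has no
  coefficient of total degree below k.\<close>

lemma mcoeff_simps [simp]:
  fixes f g :: "('k::comm_ring_1, 's::finite) mfps"
  shows "mcoeff (0 :: ('k, 's) mfps) a = 0"
    and "mcoeff (1 :: ('k, 's) mfps) a = (if a = (\<lambda>_. 0) then 1 else 0)"
    and "mcoeff (f + g) a = mcoeff f a + mcoeff g a"
    and "mcoeff (f - g) a = mcoeff f a - mcoeff g a"
    and "mcoeff (- f) a = - mcoeff f a"
    and "mcoeff (mconst c :: ('k, 's) mfps) a = (if a = (\<lambda>_. 0) then c else 0)"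
  by (simp_all add: zero_mfps_def one_mfps_def plus_mfps_def minus_mfps_def uminus_mfps_def
      mconst_def)

lemma mcoeff_mult:
  fixes f g :: "('k::comm_ring_1, 's::finite) mfps"
  shows "mcoeff (f * g) a = (\<Sum>(b, c)\<in>splittings a. mcoeff f b * mcoeff g c)"
  by (simp add: times_mfps_def)

lemma mcoeff_sum [simp]:
  fixes f :: "'i \<Rightarrow> ('k::comm_ring_1, 's::finite) mfps"
  shows "mcoeff (\<Sum>i\<in>I. f i) a = (\<Sum>i\<in>I. mcoeff (f i) a)"
  by (induction I rule: infinite_finite_induct) auto

section \<open>Total degree, monomials and multiplication of coefficients\<close>

definition mdeg :: "('s::finite \<Rightarrow> nat) \<Rightarrow> nat" where
  "mdeg a = (\<Sum>i\<in>UNIV. a i)"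

lemma mdeg_zero [simp]: "mdeg (\<lambda>_. 0) = 0"
  by (simp add: mdeg_def)

lemma mdeg_eq_0_iff: "mdeg a = 0 \<longleftrightarrow> a = (\<lambda>_. 0)"
  by (auto simp: mdeg_def fun_eq_iff)

lemma mdeg_splittings: "(b, c) \<in> splittings a \<Longrightarrow> mdeg b + mdeg c = mdeg a"
  unfolding mdeg_def splittings_def by (simp flip: sum.distrib)

lemma le_mdeg: "a i \<le> mdeg a"
  unfolding mdeg_def by (rule member_le_sum) auto

lemma mdeg_upd: "mdeg (a(i := b)) + a i = mdeg a + b"
  by (simp add: mdeg_def sum.remove[of UNIV i])

lemma finite_mdeg_less: "finite {a :: 's::finite \<Rightarrow> nat. mdeg a < k}"
proof (rule finite_subset)
  show "{a :: 's \<Rightarrow> nat. mdeg a < k} \<subseteq> Pi\<^sub>E UNIV (\<lambda>_. {..<k})"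
    using le_mdeg le_less_trans by (fastforce simp: PiE_def)
qed (rule finite_PiE; simp)

definition mmonom :: "('s \<Rightarrow> nat) \<Rightarrow> ('k::comm_ring_1, 's::finite) mfps" where
  "mmonom b = Abs_mfps (\<lambda>a. if a = b then 1 else 0)"

definition mvar :: "'s \<Rightarrow> ('k::comm_ring_1, 's::finite) mfps" where
  "mvar i = mmonom ((\<lambda>_. 0)(i := 1))"

lemma mcoeff_monom [simp]: "mcoeff (mmonom b) a = (if a = b then 1 else 0)"
  by (simp add: mmonom_def)

lemma mcoeff_monom_mult:
  fixes f :: "('k::comm_ring_1, 's::finite) mfps"
  shows "mcoeff (mmonom b * f) a = (if \<forall>i. b i \<le> a i then mcoeff f (\<lambda>i. a i - b i) else 0)"
proof -
  have "mcoeff (mmonom b * f) a =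
      (\<Sum>p\<in>(if \<forall>i. b i \<le> a i then {(b, \<lambda>i. a i - b i)} else {}).
        mcoeff (mmonom b :: ('k, 's) mfps) (fst p) * mcoeff f (snd p))"
    unfolding mcoeff_mult split_def
  proof (rule sum.mono_neutral_right[OF finite_splittings])
    show "(if \<forall>i. b i \<le> a i then {(b, \<lambda>i. a i - b i)} else {}) \<subseteq> splittings a"
      by (auto simp: splittings_def)
    have "\<forall>i. b i \<le> a i" "c = (\<lambda>i. a i - b i)" if "(b, c) \<in> splittings a" for c
      using that by (auto simp: splittings_def fun_eq_iff) (metis le_add1, metis add_diff_cancel_left')
    then show "\<forall>p\<in>splittings a - (if \<forall>i. b i \<le> a i then {(b, \<lambda>i. a i - b i)} else {}).
        mcoeff (mmonom b :: ('k, 's) mfps) (fst p) * mcoeff f (snd p) = 0"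
      by auto
  qed
  then show ?thesis
    by simp
qed

lemma monom_mult: "mmonom a * mmonom b = mmonom (\<lambda>i. a i + b i)"
proof (rule mfps_eqI)
  fix c
  have "(\<forall>i. a i \<le> c i) \<and> (\<lambda>i. c i - a i) = b \<longleftrightarrow> c = (\<lambda>i. a i + b i)"
    by (auto simp: fun_eq_iff) (metis le_add_diff_inverse)
  then show "mcoeff (mmonom a * mmonom b) c = mcoeff (mmonom (\<lambda>i. a i + b i)) c"
    unfolding mcoeff_monom_mult by auto
qed

lemma mcoeff_var_mult:
  "mcoeff (mvar i * f) a = (if a i = 0 then 0 else mcoeff f (a(i := a i - 1)))"
proof -
  have "(\<forall>j. ((\<lambda>_. 0)(i := 1)) j \<le> a j) \<longleftrightarrow> a i \<noteq> 0"
    by auto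
  moreover have "(\<lambda>j. a j - ((\<lambda>_. 0)(i := 1)) j) = a(i := a i - 1)"
    by auto
  ultimately show ?thesis
    unfolding mvar_def mcoeff_monom_mult by (simp only: if_not_P if_P) simp
qed

lemma mcoeff_mconst_mult [simp]:
  fixes f :: "('k::comm_ring_1, 's::finite) mfps"
  shows "mcoeff (mconst c * f) a = c * mcoeff f a"
proof -
  have "mcoeff (mconst c * f) a =
      (\<Sum>p\<in>{((\<lambda>_. 0), a)}. mcoeff (mconst c :: ('k, 's) mfps) (fst p) * mcoeff f (snd p))"
    unfolding mcoeff_mult split_def
    by (rule sum.mono_neutral_right[OF finite_splittings]) (auto simp: splittings_def)
  then show ?thesis
    by simp
qed

lemma mconst_simps [simp]:
  "mconst 0 = 0" "mconst 1 = 1"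
  by (rule mfps_eqI; simp)+

lemma mconst_add: "mconst (c + d) = mconst c + mconst d"
  by (rule mfps_eqI) simp

lemma mconst_mult: "mconst (c * d) = mconst c * mconst d"
  by (rule mfps_eqI) simp

lemma mcoeff_mult_zero:
  fixes f g :: "('k::comm_ring_1, 's::finite) mfps"
  shows "mcoeff (f * g) (\<lambda>_. 0) = mcoeff f (\<lambda>_. 0) * mcoeff g (\<lambda>_. 0)"
proof -
  have "splittings (\<lambda>_ :: 's. 0) = {(\<lambda>_. 0, \<lambda>_. 0)}"
    by (auto simp: splittings_def)
  then show ?thesis
    by (simp add: mcoeff_mult)
qed

section \<open>Powers of the maximal ideal in terms of coefficients\<close>

context
begin

text \<open>The candidate for \<mm>^k, described by coefficients. It stays private because
  \<open>mem_max_pow_iff\<close> replaces it as soon as the two are identified.\<close>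

private definition low :: "nat \<Rightarrow> ('k::field, 's::finite) mfps set" where
  "low k = {f. \<forall>a. mdeg a < k \<longrightarrow> mcoeff f a = 0}"

private lemma low_mult:
  fixes f g :: "('k::field, 's::finite) mfps"
  assumes "f \<in> low j" "g \<in> low k"
  shows "f * g \<in> low (j + k)"
  unfolding low_def
proof (intro CollectI allI impI)
  fix a :: "'s \<Rightarrow> nat" assume a: "mdeg a < j + k"
  have "mcoeff f b * mcoeff g c = 0" if "(b, c) \<in> splittings a" for b c :: "'s \<Rightarrow> nat"
  proof -
    have "mdeg b < j \<or> mdeg c < k"
      using mdeg_splittings[OF that] a by linarith
    then show ?thesis
      using assms by (auto simp: low_def)
  qed
  then show "mcoeff (f * g) a = 0"
    by (auto simp: mcoeff_mult intro!: sum.neutral)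
qed

text \<open>Every nonconstant monomial is charged to one of the variables dividing it.\<close>

private lemma low_Suc_decomp:
  fixes f :: "('k::field, 's::finite) mfps"
  assumes "f \<in> low (Suc k)"
  shows "\<exists>g. (\<forall>i. g i \<in> low k) \<and> f = (\<Sum>i\<in>UNIV. mvar i * g i)"
proof -
  define pick where "pick a = (SOME i. a i \<noteq> 0)" for a :: "'s \<Rightarrow> nat"
  have pick: "a (pick a) \<noteq> 0" if "a \<noteq> (\<lambda>_. 0)" for a
    unfolding pick_def by (rule someI_ex) (use that in auto)
  define g :: "'s \<Rightarrow> ('k, 's) mfps" where
    "g i = Abs_mfps (\<lambda>a. if pick (a(i := Suc (a i))) = i then mcoeff f (a(i := Suc (a i))) else 0)" for i
  have "g i \<in> low k" for i
    unfolding low_def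
  proof (intro CollectI allI impI)
    fix a :: "'s \<Rightarrow> nat" assume "mdeg a < k"
    then have "mdeg (a(i := Suc (a i))) < Suc k"
      using mdeg_upd[of a i "Suc (a i)"] by simp
    then show "mcoeff (g i) a = 0"
      using assms by (simp add: g_def low_def)
  qed
  moreover have "f = (\<Sum>i\<in>UNIV. mvar i * g i)"
  proof (rule mfps_eqI)
    fix a :: "'s \<Rightarrow> nat"
    have "mcoeff (mvar i * g i) a = (if i = pick a then mcoeff f a else 0)" for i
    proof (cases "a i = 0")
      case True
      have "mcoeff f a = 0" if "i = pick a"
      proof -
        have "a = (\<lambda>_. 0)"
          using True pick[of a] that by metis
        then show ?thesis
          using assms by (simp add: low_def)
      qed
      then show ?thesis
        using True by (simp add: mcoeff_var_mult)
    next
      case False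
      then show ?thesis
        by (auto simp: mcoeff_var_mult g_def)
    qed
    then show "mcoeff f a = mcoeff (\<Sum>i\<in>UNIV. mvar i * g i) a"
      by simp
  qed
  ultimately show ?thesis
    by blast
qed

private lemma subspace_low: "module.subspace (*) (low k)"
  using low_mult[of _ 0 _ k]
  by (auto intro!: module.subspaceI[OF module_mult] simp: low_def)

private lemma low_1: "low (Suc 0) = max_ideal"
  by (auto simp: low_def max_ideal_def mdeg_eq_0_iff)

text \<open>Lowest degrees add up under multiplication, which bounds the ideal power from above;
  peeling one variable off every monomial writes a series of order \<open>Suc k\<close> as a sum of
  products from \<mm> and \<mm>^k.\<close>

private lemma max_pow_eq_low: "(max_pow k :: ('k::field, 's::finite) mfps set) = low k"
  unfolding max_pow_def
proof (induction k)
  case 0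
  then show ?case
    by (simp add: low_def)
next
  case (Suc k)
  show ?case
  proof
    have "{a * x |a x. a \<in> max_ideal \<and> x \<in> low k} \<subseteq> (low (Suc k) :: ('k, 's) mfps set)"
      using low_mult[of _ "Suc 0" _ k] by (auto simp: low_1)
    then show "ideal_power max_ideal (Suc k) \<subseteq> (low (Suc k) :: ('k, 's) mfps set)"
      unfolding ideal_power.simps ideal_smult_def Suc.IH
      by (rule module.span_minimal[OF module_mult _ subspace_low])
    show "(low (Suc k) :: ('k, 's) mfps set) \<subseteq> ideal_power max_ideal (Suc k)"
    proof
      fix f :: "('k, 's) mfps" assume "f \<in> low (Suc k)"
      then obtain g where g: "\<And>i. g i \<in> low k" "f = (\<Sum>i\<in>UNIV. mvar i * g i)"
        using low_Suc_decomp by blast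
      have "mvar i \<in> (max_ideal :: ('k, 's) mfps set)" for i
        by (auto simp: max_ideal_def mvar_def fun_eq_iff)
      with g(1) show "f \<in> ideal_power max_ideal (Suc k)"
        unfolding g(2) ideal_power.simps ideal_smult_def Suc.IH
        by (intro module.span_sum[OF module_mult] module.span_base[OF module_mult]) blast
    qed
  qed
qed

lemma mem_max_pow_iff: "f \<in> max_pow k \<longleftrightarrow> (\<forall>a. mdeg a < k \<longrightarrow> mcoeff f a = 0)"
  by (simp add: max_pow_eq_low low_def)

lemma max_pow_Suc_decomp:
  assumes "f \<in> max_pow (Suc k)"
  shows "\<exists>g. (\<forall>i. g i \<in> max_pow k) \<and> f = (\<Sum>i\<in>UNIV. mvar i * g i)"
  using low_Suc_decomp assms by (simp add: max_pow_eq_low)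

lemma max_pow_mult: "f \<in> max_pow j \<Longrightarrow> g \<in> max_pow k \<Longrightarrow> f * g \<in> max_pow (j + k)"
  by (simp add: max_pow_eq_low low_mult)

lemma max_pow_Suc_0: "max_pow (Suc 0) = max_ideal"
  by (simp add: max_pow_eq_low low_1)

end

lemma max_pow_0 [simp]: "max_pow 0 = UNIV"
  by (simp add: max_pow_def)

lemma max_pow_antimono: "j \<le> k \<Longrightarrow> max_pow k \<subseteq> max_pow j"
  by (auto simp: mem_max_pow_iff)

lemma max_powD: "f \<in> max_pow k \<Longrightarrow> j \<le> k \<Longrightarrow> f \<in> max_pow j"
  using max_pow_antimono by blast

lemma max_pow_zero [simp]: "0 \<in> max_pow k"
  by (simp add: mem_max_pow_iff)

lemma max_pow_add: "f \<in> max_pow k \<Longrightarrow> g \<in> max_pow k \<Longrightarrow> f + g \<in> max_pow k"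
  by (simp add: mem_max_pow_iff)

lemma max_pow_diff: "f \<in> max_pow k \<Longrightarrow> g \<in> max_pow k \<Longrightarrow> f - g \<in> max_pow k"
  by (simp add: mem_max_pow_iff)

lemma max_pow_sum: "(\<And>i. i \<in> I \<Longrightarrow> f i \<in> max_pow k) \<Longrightarrow> sum f I \<in> max_pow k"
  by (simp add: mem_max_pow_iff)

lemma max_pow_mult_left: "f \<in> max_pow k \<Longrightarrow> g * f \<in> max_pow k"
  using max_pow_mult[of g 0 f k] by simp

lemma max_pow_mult_right: "f \<in> max_pow k \<Longrightarrow> f * g \<in> max_pow k"
  using max_pow_mult[of f k g 0] by simp

lemma max_pow_multI: "f \<in> max_pow i \<Longrightarrow> g \<in> max_pow j \<Longrightarrow> k \<le> i + j \<Longrightarrow> f * g \<in> max_pow k"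
  using max_pow_mult max_powD by blast

lemma monom_in_max_pow: "mmonom b \<in> max_pow (mdeg b)"
  by (auto simp: mem_max_pow_iff)

lemma mdeg_single: "mdeg ((\<lambda>_. 0)(i := k)) = k"
  using mdeg_upd[of "\<lambda>_. 0" i k] by simp

lemma var_in_max_pow [simp]: "mvar i \<in> max_pow (Suc 0)"
  using monom_in_max_pow[of "(\<lambda>_. 0)(i := 1)"] by (simp add: mvar_def mdeg_single)

section \<open>Separatedness, completeness and units\<close>

lemma max_pow_Inter: "(\<And>k. f \<in> max_pow k) \<Longrightarrow> f = 0"
  by (rule mfps_eqI) (metis lessI mcoeff_simps(1) mem_max_pow_iff)

lemma max_pow_Inter_eq: "(\<And>k. f - g \<in> max_pow k) \<Longrightarrow> f = g"
  using max_pow_Inter[of "f - g"] by simp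

lemma minus_mconst_in_max_pow: "f - mconst (mcoeff f (\<lambda>_. 0)) \<in> max_pow (Suc 0)"
  by (auto simp: mem_max_pow_iff mdeg_eq_0_iff)

text \<open>A coefficient of total degree \<open>n\<close> no longer changes from
  \<open>f (Suc n)\<close> on, so the limit takes each coefficient from that member of the
  sequence.\<close>

lemma max_pow_complete:
  fixes f :: "nat \<Rightarrow> ('k::field, 's::finite) mfps"
  assumes "\<And>n. f (Suc n) - f n \<in> max_pow n"
  shows "\<exists>g. \<forall>n. g - f n \<in> max_pow n"
proof (intro exI allI)
  have stable: "mcoeff (f n) a = mcoeff (f (Suc (mdeg a))) a" if "Suc (mdeg a) \<le> n" for n a
    using that
  proof (induction n rule: dec_induct)
    case (step n)
    then show ?case
      using assms[of n] by (simp add: mem_max_pow_iff)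
  qed simp
  fix n
  show "Abs_mfps (\<lambda>a. mcoeff (f (Suc (mdeg a))) a) - f n \<in> max_pow n"
    using stable[of _ n] by (auto simp: mem_max_pow_iff)
qed

text \<open>Geometric series: after division by the constant term the series is \<open>1 - p\<close>
  with \<open>p\<close> in \<mm>, and the partial sums of the powers of \<open>p\<close>
  converge.\<close>

lemma mfps_unit:
  fixes f :: "('k::field, 's::finite) mfps"
  assumes "mcoeff f (\<lambda>_. 0) \<noteq> 0"
  shows "\<exists>g. f * g = 1"
proof -
  define c where "c = mcoeff f (\<lambda>_. 0)"
  define p where "p = 1 - mconst (1 / c) * f"
  have p: "p \<in> max_pow (Suc 0)"
    using assms by (auto simp: p_def c_def mem_max_pow_iff mdeg_eq_0_iff)
  have pow: "p ^ n \<in> max_pow n" for n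
  proof (induction n)
    case (Suc n)
    then show ?case
      using max_pow_mult[OF p] by auto
  qed simp
  obtain g where g: "\<And>n. g - (\<Sum>i<n. p ^ i) \<in> max_pow n"
    using max_pow_complete[of "\<lambda>n. \<Sum>i<n. p ^ i"] pow by auto
  have "(1 - p) * g = 1"
  proof (rule max_pow_Inter_eq)
    fix n
    have "(1 - p) * g - 1 = (1 - p) * (g - (\<Sum>i<n. p ^ i)) - p ^ n"
      using one_diff_power_eq[of p n] by (simp add: algebra_simps)
    then show "(1 - p) * g - 1 \<in> max_pow n"
      by (simp add: max_pow_diff max_pow_mult_left g pow)
  qed
  then have "f * (mconst (1 / c) * g) = 1"
    by (simp add: p_def algebra_simps)
  then show ?thesis
    by blast
qed

lemma max_pow_Suc_0_iff: "f \<in> max_pow (Suc 0) \<longleftrightarrow> mcoeff f (\<lambda>_. 0) = 0"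
  by (auto simp: mem_max_pow_iff mdeg_eq_0_iff)

lemma mfps_unit_iff:
  fixes f :: "('k::field, 's::finite) mfps"
  shows "(\<exists>g. f * g = 1) \<longleftrightarrow> f \<notin> max_pow (Suc 0)"
proof
  assume "\<exists>g. f * g = 1"
  then show "f \<notin> max_pow (Suc 0)"
    by (metis max_pow_Suc_0_iff mcoeff_mult_zero mcoeff_simps(2) mult_zero_left zero_neq_one)
qed (use mfps_unit max_pow_Suc_0_iff in blast)


section \<open>Endomorphisms tangent to the identity\<close>

text \<open>The conditions of \<open>Aut_mfps\<close> without bijectivity: these survive limits
  directly, while bijectivity is recovered from \<open>tangent_to_id_Aut\<close>.\<close>

definition alg_endo :: "(('k::comm_ring_1, 's::finite) mfps \<Rightarrow> ('k, 's) mfps) \<Rightarrow> bool" where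
  "alg_endo \<phi> \<longleftrightarrow> (\<forall>f g. \<phi> (f + g) = \<phi> f + \<phi> g) \<and> (\<forall>f g. \<phi> (f * g) = \<phi> f * \<phi> g)
     \<and> (\<forall>c. \<phi> (mconst c) = mconst c)"

lemma alg_endoD:
  assumes "alg_endo \<phi>"
  shows alg_endo_add: "\<phi> (f + g) = \<phi> f + \<phi> g"
    and alg_endo_mult: "\<phi> (f * g) = \<phi> f * \<phi> g"
    and alg_endo_mconst: "\<phi> (mconst c) = mconst c"
  using assms by (auto simp: alg_endo_def)

lemma alg_endo_diff: "alg_endo \<phi> \<Longrightarrow> \<phi> (f - g) = \<phi> f - \<phi> g"
  using alg_endo_add[of \<phi> "f - g" g] by (simp add: algebra_simps)

lemma alg_endo_zero: "alg_endo \<phi> \<Longrightarrow> \<phi> 0 = 0"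
  using alg_endo_mconst[of \<phi> 0] by simp

lemma alg_endo_one: "alg_endo \<phi> \<Longrightarrow> \<phi> 1 = 1"
  using alg_endo_mconst[of \<phi> 1] by simp

lemma alg_endo_sum: "alg_endo \<phi> \<Longrightarrow> \<phi> (sum f I) = (\<Sum>i\<in>I. \<phi> (f i))"
  by (induction I rule: infinite_finite_induct) (auto simp: alg_endo_add alg_endo_zero)

lemma alg_endo_comp: "alg_endo \<phi> \<Longrightarrow> alg_endo \<psi> \<Longrightarrow> alg_endo (\<phi> \<circ> \<psi>)"
  by (simp add: alg_endo_def)

text \<open>Such a map induces the identity on the associated graded ring. The property is stable
  under composition and limits and forces bijectivity, so the iteration can be carried out without
  tracking inverses.\<close>

definition tangent_to_id :: "(('k::field, 's::finite) mfps \<Rightarrow> ('k, 's) mfps) \<Rightarrow> bool" where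
  "tangent_to_id \<phi> \<longleftrightarrow> alg_endo \<phi> \<and> (\<forall>j. \<forall>f\<in>max_pow j. \<phi> f - f \<in> max_pow (Suc j))"

lemma tangent_to_id_alg_endo: "tangent_to_id \<phi> \<Longrightarrow> alg_endo \<phi>"
  by (simp add: tangent_to_id_def)

lemma tangent_to_idD: "tangent_to_id \<phi> \<Longrightarrow> f \<in> max_pow j \<Longrightarrow> \<phi> f - f \<in> max_pow (Suc j)"
  by (simp add: tangent_to_id_def)

lemma tangent_to_id_max_pow:
  assumes "tangent_to_id \<phi>" "f \<in> max_pow j"
  shows "\<phi> f \<in> max_pow j"
  using max_pow_add[OF max_powD[OF tangent_to_idD[OF assms]] assms(2)] by simp

text \<open>\<open>\<phi>\<close> does not change the lowest-degree part of a series, so the order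
  of \<open>f\<close> can be raised step by step up to that of \<open>\<phi> f\<close>.\<close>

lemma tangent_to_id_max_pow_iff:
  assumes "tangent_to_id \<phi>"
  shows "\<phi> f \<in> max_pow j \<longleftrightarrow> f \<in> max_pow j"
proof
  assume f: "\<phi> f \<in> max_pow j"
  have "f \<in> max_pow i" if "i \<le> j" for i
    using that
  proof (induction i)
    case (Suc i)
    then have "f \<in> max_pow i"
      by simp
    from max_pow_diff[OF max_powD[OF f Suc.prems] tangent_to_idD[OF assms this]]
    show ?case
      by simp
  qed simp
  then show "f \<in> max_pow j"
    by simp
qed (rule tangent_to_id_max_pow[OF assms])

lemma tangent_to_id_id: "tangent_to_id id"
  by (simp add: tangent_to_id_def alg_endo_def)

lemma tangent_to_id_comp:
  fixes \<phi> \<psi> :: "('k::field, 's::finite) mfps \<Rightarrow> ('k, 's) mfps"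
  assumes "tangent_to_id \<phi>" "tangent_to_id \<psi>"
  shows "tangent_to_id (\<phi> \<circ> \<psi>)"
  unfolding tangent_to_id_def
proof (intro conjI allI ballI)
  show "alg_endo (\<phi> \<circ> \<psi>)"
    by (intro alg_endo_comp tangent_to_id_alg_endo assms)
  fix j and f :: "('k, 's) mfps" assume f: "f \<in> max_pow j"
  show "(\<phi> \<circ> \<psi>) f - f \<in> max_pow (Suc j)"
    using max_pow_add[OF tangent_to_idD[OF assms(1) tangent_to_id_max_pow[OF assms(2) f]]
        tangent_to_idD[OF assms(2) f]] by simp
qed

text \<open>Injectivity holds because \<open>\<phi>\<close> preserves orders; surjectivity is
  obtained by successive approximation.\<close>

lemma tangent_to_id_Aut:
  assumes "tangent_to_id \<phi>"
  shows "\<phi> \<in> Aut_mfps"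
proof -
  note endo = tangent_to_id_alg_endo[OF assms]
  have "inj \<phi>"
  proof (rule injI)
    fix f g assume eq: "\<phi> f = \<phi> g"
    show "f = g"
    proof (rule max_pow_Inter_eq)
      fix k
      show "f - g \<in> max_pow k"
        using tangent_to_id_max_pow_iff[OF assms, of "f - g" k] eq by (simp add: alg_endo_diff[OF endo])
    qed
  qed
  moreover have "surj \<phi>"
  proof (unfold surj_def, intro allI)
    fix g
    \<comment> \<open>The residue \<open>g - \<phi> f\<close> serves as its own correction, since
      \<open>\<phi>\<close> moves it only by terms of higher order.\<close>
    define F where "F = rec_nat 0 (\<lambda>_ f. f + (g - \<phi> f))"
    have F: "F (Suc n) = F n + (g - \<phi> (F n))" for n
      by (simp add: F_def)
    have approx: "g - \<phi> (F n) \<in> max_pow n" for n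
    proof (induction n)
      case (Suc n)
      have "(0 - (\<phi> (g - \<phi> (F n)) - (g - \<phi> (F n)))) \<in> max_pow (Suc n)"
        by (intro max_pow_diff max_pow_zero tangent_to_idD[OF assms Suc])
      moreover have "0 - (\<phi> (g - \<phi> (F n)) - (g - \<phi> (F n))) = g - \<phi> (F (Suc n))"
        by (simp only: F alg_endo_add[OF endo] alg_endo_diff[OF endo]) (simp add: algebra_simps)
      ultimately show ?case
        by (simp only:)
    qed simp
    then obtain f where f: "\<And>n. f - F n \<in> max_pow n"
      using max_pow_complete[of F] by (auto simp: F)
    have "g = \<phi> f"
    proof (rule max_pow_Inter_eq)
      fix n
      have "(g - \<phi> (F n)) - \<phi> (f - F n) \<in> max_pow n"
        by (intro max_pow_diff approx tangent_to_id_max_pow[OF assms] f)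
      then show "g - \<phi> f \<in> max_pow n"
        by (simp add: alg_endo_diff[OF endo])
    qed
    then show "\<exists>f. g = \<phi> f"
      by auto
  qed
  ultimately show ?thesis
    using endo by (auto simp: Aut_mfps_def alg_endo_def bij_def)
qed

text \<open>The approximations \<open>S n\<close> need to be homomorphisms only modulo \<mm>^n. This
  tolerance is essential for truncated substitutions, which are not multiplicative.\<close>

lemma alg_endo_limit:
  assumes S: "\<And>n f g. S n (f + g) - (S n f + S n g) \<in> max_pow n"
    "\<And>n f g. S n (f * g) - S n f * S n g \<in> max_pow n"
    "\<And>n c. S n (mconst c) - mconst c \<in> max_pow n"
    and lim: "\<And>n f. \<phi> f - S n f \<in> max_pow n"
  shows "alg_endo \<phi>"
  unfolding alg_endo_def
proof (intro conjI allI)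
  fix f g
  show "\<phi> (f + g) = \<phi> f + \<phi> g"
  proof (rule max_pow_Inter_eq)
    fix n
    have "(\<phi> (f + g) - S n (f + g)) + (S n (f + g) - (S n f + S n g))
        - ((\<phi> f - S n f) + (\<phi> g - S n g)) \<in> max_pow n"
      by (intro max_pow_add max_pow_diff lim S)
    then show "\<phi> (f + g) - (\<phi> f + \<phi> g) \<in> max_pow n"
      by (simp add: algebra_simps)
  qed
  show "\<phi> (f * g) = \<phi> f * \<phi> g"
  proof (rule max_pow_Inter_eq)
    fix n
    have "(\<phi> (f * g) - S n (f * g)) + (S n (f * g) - S n f * S n g)
        - ((\<phi> f - S n f) * \<phi> g + S n f * (\<phi> g - S n g)) \<in> max_pow n"
      by (intro max_pow_add max_pow_diff max_pow_mult_left max_pow_mult_right lim S)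
    then show "\<phi> (f * g) - \<phi> f * \<phi> g \<in> max_pow n"
      by (simp add: algebra_simps)
  qed
next
  fix c
  show "\<phi> (mconst c) = mconst c"
  proof (rule max_pow_Inter_eq)
    fix n
    have "(\<phi> (mconst c) - S n (mconst c)) + (S n (mconst c) - mconst c) \<in> max_pow n"
      by (intro max_pow_add lim S)
    then show "\<phi> (mconst c) - mconst c \<in> max_pow n"
      by simp
  qed
qed

lemma tangent_to_id_limit:
  assumes \<phi>: "\<And>n. tangent_to_id (\<phi> n)"
    and cauchy: "\<And>n f. \<phi> (Suc n) f - \<phi> n f \<in> max_pow n"
  shows "\<exists>\<psi>. tangent_to_id \<psi> \<and> (\<forall>n f. \<psi> f - \<phi> n f \<in> max_pow n)"
proof -
  have "\<exists>g. \<forall>n. g - \<phi> n f \<in> max_pow n" for f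
    by (rule max_pow_complete) (rule cauchy)
  then obtain \<psi> where \<psi>: "\<And>n f. \<psi> f - \<phi> n f \<in> max_pow n"
    by metis
  note endo = tangent_to_id_alg_endo[OF \<phi>]
  have "alg_endo \<psi>"
    by (rule alg_endo_limit[of \<phi>, OF _ _ _ \<psi>])
       (simp_all add: alg_endo_add[OF endo] alg_endo_mult[OF endo] alg_endo_mconst[OF endo])
  moreover have "\<psi> f - f \<in> max_pow (Suc j)" if "f \<in> max_pow j" for f j
    using max_pow_add[OF \<psi>[of f "Suc j"] tangent_to_idD[OF \<phi> that, of "Suc j"]] by simp
  ultimately show ?thesis
    using \<psi> by (auto simp: tangent_to_id_def)
qed


section \<open>Substitution\<close>

lemma mconst_sum: "mconst (sum f I) = (\<Sum>i\<in>I. mconst (f i))"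
  by (induction I rule: infinite_finite_induct) (auto simp: mconst_add)

lemma max_pow_power: "f \<in> max_pow (Suc 0) \<Longrightarrow> f ^ n \<in> max_pow n"
  by (induction n) (use max_pow_mult[of _ "Suc 0"] in auto)

lemma max_pow_prod:
  assumes "finite I" "\<And>i. i \<in> I \<Longrightarrow> f i \<in> max_pow (k i)"
  shows "prod f I \<in> max_pow (sum k I)"
  using assms by (induction I rule: finite_induct) (auto intro: max_pow_mult)

text \<open>The image of \<open>f\<close> is the limit of the sums of
  \<open>mconst (mcoeff f b) * Y b\<close> over the exponents of degree below \<open>n\<close>; they
  converge because \<open>Y b\<close> has order at least \<open>mdeg b\<close>.\<close>

lemma exists_substitution:
  fixes y :: "'s::finite \<Rightarrow> ('k::field, 's) mfps"
  assumes y: "\<And>i. y i \<in> max_pow (Suc 0)"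
  shows "\<exists>\<phi>. alg_endo \<phi> \<and> (\<forall>i. \<phi> (mvar i) = y i)"
proof -
  define Y where "Y b = (\<Prod>i\<in>UNIV. y i ^ b i)" for b :: "'s \<Rightarrow> nat"
  have Y_add: "Y (\<lambda>i. b i + c i) = Y b * Y c" for b c
    by (simp add: Y_def power_add prod.distrib)
  have Y_mem: "Y b \<in> max_pow (mdeg b)" for b
    unfolding Y_def mdeg_def by (intro max_pow_prod max_pow_power y) auto
  have Y_zero: "Y (\<lambda>_. 0) = 1"
    by (simp add: Y_def)
  have Y_single: "Y ((\<lambda>_. 0)(i := 1)) = y i" for i
  proof -
    have "Y ((\<lambda>_. 0)(i := 1)) = (\<Prod>j\<in>UNIV. if j = i then y i else 1)"
      unfolding Y_def by (rule prod.cong) auto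
    then show ?thesis
      by simp
  qed
  define B where "B n = {b :: 's \<Rightarrow> nat. mdeg b < n}" for n
  have finB: "finite (B n)" for n
    by (simp add: B_def finite_mdeg_less)
  define S where "S n f = (\<Sum>b\<in>B n. mconst (mcoeff f b) * Y b)" for n and f :: "('k, 's) mfps"
  have "S (Suc n) f - S n f \<in> max_pow n" for n f
  proof -
    have "S (Suc n) f - S n f = (\<Sum>b\<in>B (Suc n) - B n. mconst (mcoeff f b) * Y b)"
      unfolding S_def by (rule sum_diff[symmetric]) (use finB in \<open>auto simp: B_def\<close>)
    also have "\<dots> \<in> max_pow n"
    proof (intro max_pow_sum max_pow_mult_left)
      fix b assume "b \<in> B (Suc n) - B n"
      then have "mdeg b = n"
        by (auto simp: B_def)
      then show "Y b \<in> max_pow n"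
        using Y_mem[of b] by simp
    qed
    finally show ?thesis .
  qed
  then have "\<exists>g. \<forall>n. g - S n f \<in> max_pow n" for f
    by (rule max_pow_complete)
  then obtain \<phi> where lim: "\<And>n f. \<phi> f - S n f \<in> max_pow n"
    by metis
  have "alg_endo \<phi>"
  proof (rule alg_endo_limit[of S, OF _ _ _ lim])
    fix n and f g :: "('k, 's) mfps"
    have "S n (f + g) = S n f + S n g"
      by (simp add: S_def mconst_add algebra_simps sum.distrib)
    then show "S n (f + g) - (S n f + S n g) \<in> max_pow n"
      by simp
    define h where "h p = mconst (mcoeff f (fst p) * mcoeff g (snd p)) * Y (\<lambda>i. fst p i + snd p i)"
      for p
    have "S n (f * g) = (\<Sum>a\<in>B n. \<Sum>p\<in>splittings a. h p)"
      unfolding S_def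
    proof (rule sum.cong[OF refl])
      fix a :: "'s \<Rightarrow> nat"
      have "(\<lambda>i. fst p i + snd p i) = a" if "p \<in> splittings a" for p
        using that by (auto simp: splittings_def)
      then show "mconst (mcoeff (f * g) a) * Y a = (\<Sum>p\<in>splittings a. h p)"
        by (simp add: mcoeff_mult mconst_sum sum_distrib_right h_def split_def)
    qed
    also have "\<dots> = (\<Sum>(a, p)\<in>Sigma (B n) splittings. h p)"
      by (simp add: sum.Sigma finB)
    also have "\<dots> = (\<Sum>p | mdeg (\<lambda>i. fst p i + snd p i) < n. h p)"
      by (rule sum.reindex_bij_witness[where i = "\<lambda>p. (\<lambda>i. fst p i + snd p i, p)" and j = snd])
         (auto simp: B_def splittings_def)
    finally have lhs: "S n (f * g) = (\<Sum>p | mdeg (\<lambda>i. fst p i + snd p i) < n. h p)" .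
    have "S n f * S n g = (\<Sum>p\<in>B n \<times> B n. h p)"
      by (simp add: S_def sum_product sum.cartesian_product h_def mconst_mult Y_add split_def
          algebra_simps)
    \<comment> \<open>The product of two truncations contains all terms of total degree below
      \<open>n\<close> and some further ones; the latter make up the difference and have order at
      least \<open>n\<close>.\<close>
    then have "S n f * S n g - S n (f * g) =
        (\<Sum>p\<in>B n \<times> B n - {p. mdeg (\<lambda>i. fst p i + snd p i) < n}. h p)"
      unfolding lhs
    proof (subst sum_diff)
      show "{p. mdeg (\<lambda>i. fst p i + snd p i) < n} \<subseteq> B n \<times> B n"
        by (auto simp: B_def mdeg_def sum.distrib)
    qed (auto simp: finB)
    also have "\<dots> \<in> max_pow n"
    proof (rule max_pow_sum)
      fix p assume "p \<in> B n \<times> B n - {p. mdeg (\<lambda>i. fst p i + snd p i) < n}"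
      then show "h p \<in> max_pow n"
        unfolding h_def by (auto intro!: max_pow_mult_left max_powD[OF Y_mem])
    qed
    finally have "S n f * S n g - S n (f * g) \<in> max_pow n" .
    from max_pow_diff[OF max_pow_zero this] show "S n (f * g) - S n f * S n g \<in> max_pow n"
      by simp
  next
    fix n and c :: 'k
    show "S n (mconst c) - mconst c \<in> max_pow n"
    proof (cases n)
      case (Suc m)
      have "S n (mconst c) = (\<Sum>b\<in>B n. if b = (\<lambda>_. 0) then mconst c else 0)"
        unfolding S_def by (rule sum.cong) (auto simp: Y_zero)
      then have "S n (mconst c) = mconst c"
        using Suc finB by (simp add: sum.delta) (simp add: B_def)
      then show ?thesis
        by simp
    qed simp
  qed
  moreover have "\<phi> (mvar i) = y i" for i
  proof (rule max_pow_Inter_eq)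
    fix n
    \<comment> \<open>At \<open>n + 2\<close> the truncation contains the degree-one monomial even
      for \<open>n = 0\<close>.\<close>
    have "S (n + 2) (mvar i) = (\<Sum>b\<in>B (n + 2). if b = (\<lambda>_. 0)(i := 1) then y i else 0)"
      unfolding S_def by (rule sum.cong) (auto simp: mvar_def Y_single[simplified])
    also have "\<dots> = y i"
      using finB mdeg_single[of i 1] by (simp add: sum.delta) (simp add: B_def)
    finally show "\<phi> (mvar i) - y i \<in> max_pow n"
      using max_powD[OF lim[of "mvar i" "n + 2"], of n] by simp
  qed
  ultimately show ?thesis
    by blast
qed


section \<open>Taylor expansion to second order\<close>

lemma mderiv_add: "mderiv v (f + g) = mderiv v f + mderiv v g"
  by (rule mfps_eqI) (simp add: mderiv_def algebra_simps)

lemma mderiv_mconst [simp]: "mderiv v (mconst c) = 0"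
  by (rule mfps_eqI) (auto simp: mderiv_def fun_eq_iff)

text \<open>The instance of the Leibniz rule that the Taylor expansion uses, because there a series
  is taken apart by splitting off one variable at a time.\<close>

lemma mderiv_var_mult: "mderiv v (mvar i * f) = (if v = i then f else 0) + mvar i * mderiv v f"
proof (rule mfps_eqI)
  fix a
  show "mcoeff (mderiv v (mvar i * f)) a =
      mcoeff ((if v = i then f else 0) + mvar i * mderiv v f) a"
  proof (cases "v = i")
    case True
    then show ?thesis
      by (cases "a i") (auto simp: mderiv_def mcoeff_var_mult distrib_right fun_upd_idem)
  next
    case False
    then show ?thesis
      by (auto simp: mderiv_def mcoeff_var_mult fun_upd_twist)
  qed
qed

lemma mderiv_max_pow: "f \<in> max_pow j \<Longrightarrow> mderiv v f \<in> max_pow (j - 1)"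
proof -
  assume f: "f \<in> max_pow j"
  have "mdeg (a(v := Suc (a v))) = Suc (mdeg a)" for a
    using mdeg_upd[of a v "Suc (a v)"] by simp
  with f show ?thesis
    by (auto simp: mem_max_pow_iff mderiv_def)
qed

text \<open>Truncated subtraction merges two cases: for \<open>j = 0\<close> the constant term is
  split off and \<open>g\<close> is unrestricted, for \<open>j > 0\<close> the constant is 0 and
  \<open>g\<close> has order one less.\<close>

lemma max_pow_decomp_var:
  assumes "f \<in> max_pow j"
  shows "\<exists>c g. (\<forall>i. g i \<in> max_pow (j - 1)) \<and> f = mconst c + (\<Sum>i\<in>UNIV. mvar i * g i)"
proof (cases j)
  case 0
  obtain g where "f - mconst (mcoeff f (\<lambda>_. 0)) = (\<Sum>i\<in>UNIV. mvar i * g i)"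
    using max_pow_Suc_decomp[OF minus_mconst_in_max_pow] by blast
  then have "f = mconst (mcoeff f (\<lambda>_. 0)) + (\<Sum>i\<in>UNIV. mvar i * g i)"
    by (simp add: algebra_simps)
  then show ?thesis
    using 0 by auto
next
  case (Suc k)
  then obtain g where "\<forall>i. g i \<in> max_pow k" "f = (\<Sum>i\<in>UNIV. mvar i * g i)"
    using max_pow_Suc_decomp assms by blast
  then show ?thesis
    using Suc by (intro exI[of _ 0] exI[of _ g]) auto
qed

text \<open>Splitting off variables from a series never terminates, so there is no induction on
  degree. Order estimates are instead proved up to precision \<open>p\<close>, by induction on
  \<open>p\<close>; the instance \<open>p = j\<close> is the full estimate.\<close>

lemma max_pow_limit: "(\<And>p. f \<in> max_pow (min j p)) \<Longrightarrow> f \<in> max_pow j"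
  by (metis min.idem)

text \<open>The iteration uses \<open>e = Suc q\<close>, for which the two estimates below raise the
  order by \<open>q\<close> and by \<open>2 * q\<close>.\<close>

locale substitution =
  fixes \<phi> :: "('k::field, 's::finite) mfps \<Rightarrow> ('k, 's) mfps" and d :: "'s \<Rightarrow> ('k, 's) mfps" and e :: nat
  assumes endo: "alg_endo \<phi>"
    and on_var: "\<And>i. \<phi> (mvar i) = mvar i + d i"
    and d: "\<And>i. d i \<in> max_pow e"
    and e: "e \<ge> 1"
begin

text \<open>On a product \<open>mvar i * g\<close> the difference is
  \<open>mvar i * (\<phi> g - g) + d i * \<phi> g\<close>: the first term regains the order lost by
  splitting off the variable, the second has order \<open>e\<close> plus that of
  \<open>g\<close>.\<close>

lemma first_order:
  assumes "f \<in> max_pow j"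
  shows "\<phi> f - f \<in> max_pow (j + e - 1)"
proof (rule max_pow_limit)
  fix p
  show "\<phi> f - f \<in> max_pow (min (j + e - 1) p)"
    using assms
  proof (induction p arbitrary: f j)
    case (Suc p)
    obtain c g where g: "\<And>i. g i \<in> max_pow (j - 1)" and f: "f = mconst c + (\<Sum>i\<in>UNIV. mvar i * g i)"
      using max_pow_decomp_var[OF Suc.prems] by blast
    have "\<phi> f - f = (\<Sum>i\<in>UNIV. mvar i * (\<phi> (g i) - g i) + (d i * g i + d i * (\<phi> (g i) - g i)))"
      by (simp add: f alg_endo_add[OF endo] alg_endo_sum[OF endo] alg_endo_mult[OF endo]
          alg_endo_mconst[OF endo] on_var algebra_simps flip: sum_subtractf)
    also have "\<dots> \<in> max_pow (min (j + e - 1) (Suc p))"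
      by (intro max_pow_sum max_pow_add
          max_pow_multI[OF var_in_max_pow Suc.IH[OF g]] max_pow_multI[OF d g] max_pow_multI[OF d Suc.IH[OF g]])
         (use e in linarith)+
    finally show ?case .
  qed simp
qed

text \<open>The remainder \<open>D\<close> satisfies
  \<open>D (mvar i * g) = mvar i * D g + d i * (\<phi> g - g)\<close>. The new term carries
  \<open>d i\<close> and, by \<open>first_order\<close>, a second gain; no second derivative
  appears, hence no division by 2.\<close>

lemma second_order:
  assumes "f \<in> max_pow j"
  shows "\<phi> f - f - (\<Sum>v\<in>UNIV. d v * mderiv v f) \<in> max_pow (j + 2 * e - 2)"
proof (rule max_pow_limit)
  fix p
  define D where "D f = \<phi> f - f - (\<Sum>v\<in>UNIV. d v * mderiv v f)" for f
  have D_add: "D (f + g) = D f + D g" for f g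
    by (simp add: D_def alg_endo_add[OF endo] mderiv_add algebra_simps sum.distrib)
  have D_mconst: "D (mconst c) = 0" for c
    by (simp add: D_def alg_endo_mconst[OF endo])
  have D_sum: "D (sum h I) = (\<Sum>i\<in>I. D (h i))" for h and I :: "'s set"
    using D_mconst[of 0] by (induction I rule: infinite_finite_induct) (auto simp: D_add)
  have D_var: "D (mvar i * g) = mvar i * D g + d i * (\<phi> g - g)" for i g
  proof -
    have "(\<Sum>v\<in>UNIV. d v * mderiv v (mvar i * g)) = d i * g + mvar i * (\<Sum>v\<in>UNIV. d v * mderiv v g)"
      by (simp add: mderiv_var_mult distrib_left sum.distrib sum_distrib_left mult.left_commute
          if_distrib[of "(*) _"] cong: if_cong)
    then show ?thesis
      by (simp add: D_def alg_endo_mult[OF endo] on_var algebra_simps)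
  qed
  have "D f \<in> max_pow (min (j + 2 * e - 2) p)"
    using assms
  proof (induction p arbitrary: f j)
    case (Suc p)
    obtain c g where g: "\<And>i. g i \<in> max_pow (j - 1)" and f: "f = mconst c + (\<Sum>i\<in>UNIV. mvar i * g i)"
      using max_pow_decomp_var[OF Suc.prems] by blast
    have "D f = (\<Sum>i\<in>UNIV. mvar i * D (g i) + d i * (\<phi> (g i) - g i))"
      by (simp add: f D_add D_mconst D_sum D_var)
    also have "\<dots> \<in> max_pow (min (j + 2 * e - 2) (Suc p))"
      by (intro max_pow_sum max_pow_add
          max_pow_multI[OF var_in_max_pow Suc.IH[OF g]] max_pow_multI[OF d first_order[OF g]])
         (use e in linarith)+
    finally show ?case .
  qed simp
  then show "\<phi> f - f - (\<Sum>v\<in>UNIV. d v * mderiv v f) \<in> max_pow (min (j + 2 * e - 2) p)"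
    by (simp add: D_def)
qed

end

text \<open>For \<open>e \<ge> 2\<close> the substitution has the identity as its linear part, so
  the first-order estimate gains at least one order.\<close>

lemma exists_tangent_to_id:
  fixes d :: "'s::finite \<Rightarrow> ('k::field, 's) mfps"
  assumes d: "\<And>i. d i \<in> max_pow e" and e2: "e \<ge> 2"
  shows "\<exists>\<phi>. tangent_to_id \<phi> \<and> (\<forall>j. \<forall>f\<in>max_pow j. \<phi> f - f \<in> max_pow (j + e - 1) \<and>
     \<phi> f - f - (\<Sum>v\<in>UNIV. d v * mderiv v f) \<in> max_pow (j + 2 * e - 2))"
proof -
  have "mvar i + d i \<in> max_pow (Suc 0)" for i
    using max_pow_add[OF var_in_max_pow max_powD[OF d]] e2 by simp
  then obtain \<phi> where \<phi>: "alg_endo \<phi>" "\<And>i. \<phi> (mvar i) = mvar i + d i"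
    using exists_substitution[of "\<lambda>i. mvar i + d i"] by blast
  interpret substitution \<phi> d e
    using \<phi> d e2 by unfold_locales auto
  have "tangent_to_id \<phi>"
    unfolding tangent_to_id_def using \<phi>(1) e2 by (auto intro!: max_powD[OF first_order])
  then show ?thesis
    using first_order second_order by blast
qed


section \<open>Matrices over the power series ring\<close>

interpretation mat_scale: module "mat_scale :: 'r::comm_ring_1 \<Rightarrow> 'r^'n^'m \<Rightarrow> 'r^'n^'m"
  by (rule module_mat_scale)

lemma mat_scale_nth [simp]: "mat_scale r A $ i $ j = r * A $ i $ j"
  by (simp add: mat_scale_def)

lemma matrix_mult_linear:
  fixes A A' :: "'r::comm_ring_1^'n^'m" and B B' :: "'r^'p^'n"
  shows matrix_mult_add_left: "(A + A') ** B = A ** B + A' ** B"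
    and matrix_mult_add_right: "A ** (B + B') = A ** B + A ** B'"
    and matrix_mult_diff_left: "(A - A') ** B = A ** B - A' ** B"
    and matrix_mult_diff_right: "A ** (B - B') = A ** B - A ** B'"
    and matrix_mult_zero_left: "0 ** B = (0 :: 'r^'p^'m)"
    and matrix_mult_zero_right: "A ** 0 = (0 :: 'r^'p^'m)"
    and matrix_mult_scale_left: "mat_scale r A ** B = mat_scale r (A ** B)"
    and matrix_mult_scale_right: "A ** mat_scale r B = mat_scale r (A ** B)"
  by (simp_all add: matrix_matrix_mult_def vec_eq_iff algebra_simps sum.distrib sum_subtractf
      sum_distrib_left)

text \<open>The rectangular counterpart of \<open>mat_unit\<close>: these matrices are the standard
  basis of the free module of all matrices.\<close>

definition entry_unit :: "'m \<Rightarrow> 'n \<Rightarrow> 'r::comm_ring_1^'n^'m" where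
  "entry_unit p q = (\<chi> i j. if i = p \<and> j = q then 1 else 0)"

lemma matrix_entry_decomp:
  fixes A :: "'r::comm_ring_1^'n::finite^'m::finite"
  shows "A = (\<Sum>p\<in>UNIV. \<Sum>q\<in>UNIV. mat_scale (A $ p $ q) (entry_unit p q))"
proof -
  have "(\<Sum>p\<in>UNIV. \<Sum>q\<in>UNIV. mat_scale (A $ p $ q) (entry_unit p q)) $ i $ j = A $ i $ j" for i j
  proof -
    have "(\<Sum>p\<in>UNIV. \<Sum>q\<in>UNIV. mat_scale (A $ p $ q) (entry_unit p q)) $ i $ j =
        (\<Sum>p\<in>UNIV. if p = i then \<Sum>q\<in>UNIV. if q = j then A $ i $ j else 0 else 0)"
      unfolding sum_component by (rule sum.cong) (auto simp: entry_unit_def if_distrib[of "(*) _"]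
          cong: if_cong)
    then show ?thesis
      by simp
  qed
  then show ?thesis
    by (simp add: vec_eq_iff)
qed

lemma mem_max_pow_mat_iff: "A \<in> max_pow_mat k \<longleftrightarrow> (\<forall>i j. A $ i $ j \<in> max_pow k)"
proof
  have "max_pow_mat k \<subseteq> {A :: ('k::field, 's::finite) mfps^'n::finite^'m::finite.
      \<forall>i j. A $ i $ j \<in> max_pow k}"
    unfolding max_pow_mat_def ideal_smult_def
    by (rule mat_scale.span_minimal)
       ((auto intro: max_pow_mult_right)[1],
        (intro mat_scale.subspaceI; simp add: max_pow_add max_pow_mult_left))
  then show "A \<in> max_pow_mat k \<Longrightarrow> \<forall>i j. A $ i $ j \<in> max_pow k"
    by blast
next
  assume "\<forall>i j. A $ i $ j \<in> max_pow k"
  then have "(\<Sum>p\<in>UNIV. \<Sum>q\<in>UNIV. mat_scale (A $ p $ q) (entry_unit p q)) \<in> max_pow_mat k"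
    unfolding max_pow_mat_def ideal_smult_def
    by (intro mat_scale.span_sum mat_scale.span_base) auto
  then show "A \<in> max_pow_mat k"
    by (simp flip: matrix_entry_decomp)
qed

lemma subspace_max_pow_mat: "mat_scale.subspace (max_pow_mat k)"
  unfolding max_pow_mat_def ideal_smult_def by simp

lemma max_pow_mat_0 [simp]: "max_pow_mat 0 = UNIV"
  by (auto simp: mem_max_pow_mat_iff)

lemma max_pow_matD: "X \<in> max_pow_mat k \<Longrightarrow> j \<le> k \<Longrightarrow> X \<in> max_pow_mat j"
  by (auto simp: mem_max_pow_mat_iff intro: max_powD[of _ k])

lemma max_pow_mat_zero [simp]: "0 \<in> max_pow_mat k"
  by (simp add: mem_max_pow_mat_iff)

lemma max_pow_mat_add: "X \<in> max_pow_mat k \<Longrightarrow> Y \<in> max_pow_mat k \<Longrightarrow> X + Y \<in> max_pow_mat k"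
  by (simp add: mem_max_pow_mat_iff max_pow_add)

lemma max_pow_mat_diff: "X \<in> max_pow_mat k \<Longrightarrow> Y \<in> max_pow_mat k \<Longrightarrow> X - Y \<in> max_pow_mat k"
  by (simp add: mem_max_pow_mat_iff max_pow_diff)

lemma max_pow_mat_sum: "(\<And>i. i \<in> I \<Longrightarrow> X i \<in> max_pow_mat k) \<Longrightarrow> sum X I \<in> max_pow_mat k"
  by (simp add: mem_max_pow_mat_iff max_pow_sum)

lemma max_pow_mat_scale:
  "r \<in> max_pow i \<Longrightarrow> X \<in> max_pow_mat j \<Longrightarrow> k \<le> i + j \<Longrightarrow> mat_scale r X \<in> max_pow_mat k"
  by (auto simp: mem_max_pow_mat_iff intro: max_pow_multI[of r i _ j])

lemma max_pow_mat_mult: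
  "X \<in> max_pow_mat i \<Longrightarrow> Y \<in> max_pow_mat j \<Longrightarrow> k \<le> i + j \<Longrightarrow> X ** Y \<in> max_pow_mat k"
  unfolding mem_max_pow_mat_iff matrix_matrix_mult_def
  by (auto intro!: max_pow_sum intro: max_pow_multI[of _ i _ j])

lemma max_pow_mat_mult_left: "X \<in> max_pow_mat k \<Longrightarrow> Y ** X \<in> max_pow_mat k"
  by (rule max_pow_mat_mult[of _ 0]) auto

lemma max_pow_mat_mult_right: "X \<in> max_pow_mat k \<Longrightarrow> X ** Y \<in> max_pow_mat k"
  by (rule max_pow_mat_mult[of _ k _ 0]) auto

lemma max_pow_mat_Inter_eq: "(\<And>k. X - Y \<in> max_pow_mat k) \<Longrightarrow> X = Y"
  by (auto simp: mem_max_pow_mat_iff vec_eq_iff intro: max_pow_Inter_eq)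

lemma max_pow_mat_Suc_decomp:
  assumes "X \<in> max_pow_mat (Suc k)"
  shows "\<exists>Y. (\<forall>v. Y v \<in> max_pow_mat k) \<and> X = (\<Sum>v\<in>UNIV. mat_scale (mvar v) (Y v))"
proof -
  have "\<forall>i j. \<exists>g. (\<forall>v. g v \<in> max_pow k) \<and> X $ i $ j = (\<Sum>v\<in>UNIV. mvar v * g v)"
    using assms max_pow_Suc_decomp unfolding mem_max_pow_mat_iff by blast
  then obtain g where g: "\<And>i j v. g i j v \<in> max_pow k"
    "\<And>i j. X $ i $ j = (\<Sum>v\<in>UNIV. mvar v * g i j v)"
    by metis
  then show ?thesis
    by (intro exI[of _ "\<lambda>v. \<chi> i j. g i j v"]) (auto simp: mem_max_pow_mat_iff vec_eq_iff)
qed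

lemma max_pow_mat_complete:
  fixes X :: "nat \<Rightarrow> ('k::field, 's::finite) mfps^'n::finite^'m::finite"
  assumes "\<And>n. X (Suc n) - X n \<in> max_pow_mat n"
  shows "\<exists>Y. \<forall>n. Y - X n \<in> max_pow_mat n"
proof -
  have "\<forall>i j. \<exists>g. \<forall>n. g - X n $ i $ j \<in> max_pow n"
    using assms by (auto simp: mem_max_pow_mat_iff intro!: max_pow_complete)
  then obtain g where "\<And>i j n. g i j - X n $ i $ j \<in> max_pow n"
    by metis
  then show ?thesis
    by (intro exI[of _ "\<chi> i j. g i j"]) (auto simp: mem_max_pow_mat_iff)
qed

lemma map_matrix_alg_endo:
  assumes "alg_endo \<phi>"
  shows map_matrix_mult: "map_matrix \<phi> (X ** Y) = map_matrix \<phi> X ** map_matrix \<phi> Y"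
    and map_matrix_diff: "map_matrix \<phi> (Z - W) = map_matrix \<phi> Z - map_matrix \<phi> W"
    and map_matrix_one: "map_matrix \<phi> (mat 1) = mat 1"
  by (simp_all add: vec_eq_iff matrix_matrix_mult_def mat_def alg_endo_sum[OF assms]
      alg_endo_mult[OF assms] alg_endo_diff[OF assms] alg_endo_zero[OF assms] alg_endo_one[OF assms])

lemma map_matrix_max_pow_iff:
  "tangent_to_id \<phi> \<Longrightarrow> map_matrix \<phi> X \<in> max_pow_mat k \<longleftrightarrow> X \<in> max_pow_mat k"
  by (simp add: mem_max_pow_mat_iff tangent_to_id_max_pow_iff)


section \<open>Determinants and invertibility\<close>

text \<open>Cofactors are written as determinants of \<open>D\<close> with row \<open>p\<close>
  replaced by a unit vector. By linearity in that row, an entry of \<open>D ** C\<close> is the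
  determinant of \<open>D\<close> with row \<open>p\<close> replaced by row \<open>r\<close>, which
  vanishes for \<open>r \<noteq> p\<close>.\<close>

lemma matrix_mult_adjugate:
  fixes D :: "'r::comm_ring_1^'n::finite^'n"
  shows "\<exists>C. D ** C = mat_scale (det D) (mat 1)"
proof -
  define C where "C = (\<chi> q p. det (\<chi> i. if i = p then axis q 1 else D $ i))"
  have "(D ** C) $ r $ p = mat_scale (det D) (mat 1) $ r $ p" for r p
  proof -
    have row: "D $ r = (\<Sum>q\<in>UNIV. D $ r $ q *s axis q 1)"
      by (simp add: vec_eq_iff axis_def if_distrib cong: if_cong)
    have "(D ** C) $ r $ p = (\<Sum>q\<in>UNIV. det (\<chi> i. if i = p then D $ r $ q *s axis q 1 else D $ i))"
      by (simp add: C_def matrix_matrix_mult_def det_row_mul)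
    also have "\<dots> = det (\<chi> i. if i = p then \<Sum>q\<in>UNIV. D $ r $ q *s axis q 1 else D $ i)"
      using det_linear_row_sum[of UNIV p "\<lambda>_ q. D $ r $ q *s axis q 1" "($) D"] by simp
    also have "\<dots> = det (\<chi> i. if i = p then D $ r else D $ i)"
      by (simp flip: row cong: if_cong)
    also have "\<dots> = (if r = p then det D else 0)"
    proof (cases "r = p")
      case True
      then have "(\<chi> i. if i = p then D $ r else D $ i) = D"
        by (simp add: vec_eq_iff)
      then show ?thesis
        using True by simp
    next
      case False
      then show ?thesis
        by (auto intro!: det_identical_rows[of r p] simp: row_def)
    qed
    finally show ?thesis
      by (simp add: mat_def)
  qed
  then show ?thesis
    by (auto simp: vec_eq_iff)
qed

text \<open>The adjugate yields right inverses only. Applied to \<open>U\<close> and then to its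
  right inverse \<open>W\<close>, whose determinant is again a unit, it shows that \<open>U\<close>
  is also the right inverse of \<open>W\<close>.\<close>

lemma invertible_if_unit_det:
  fixes U :: "'r::comm_ring_1^'n::finite^'n"
  assumes "det U * g = 1"
  shows "invertible U"
proof -
  have right_inverse: "\<exists>W. X ** W = mat 1" if "det X * h = 1" for X :: "'r^'n^'n" and h
  proof -
    obtain C where "X ** C = mat_scale (det X) (mat 1)"
      using matrix_mult_adjugate by blast
    then have "X ** mat_scale h C = mat 1"
      using that by (simp add: matrix_mult_scale_right mult.commute)
    then show ?thesis
      by blast
  qed
  obtain W where W: "U ** W = mat 1"
    using right_inverse assms by blast
  then have "det W * det U = 1"
    by (metis det_I det_mul mult.commute)
  then obtain W' where W': "W ** W' = mat 1"
    using right_inverse by blast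
  have "U = W'"
    using W W' by (metis matrix_mul_assoc matrix_mul_lid matrix_mul_rid)
  then show ?thesis
    using W W' by (auto simp: invertible_def)
qed

lemma mcoeff_prod_zero: "mcoeff (\<Prod>i\<in>I. f i) (\<lambda>_. 0) = (\<Prod>i\<in>I. mcoeff (f i) (\<lambda>_. 0))"
  by (induction I rule: infinite_finite_induct) (auto simp: mcoeff_mult_zero)

lemma mcoeff_of_int_zero: "mcoeff (of_int z) (\<lambda>_. 0) = of_int z"
proof -
  have "mcoeff (of_nat n) (\<lambda>_. 0) = of_nat n" for n
    by (induction n) auto
  then show ?thesis
    by (cases z) auto
qed

text \<open>Taking the constant term is a ring homomorphism and therefore commutes with the
  determinant.\<close>

lemma mcoeff_det_zero:
  "mcoeff (det U) (\<lambda>_. 0) = det (map_matrix (\<lambda>f. mcoeff f (\<lambda>_. 0)) U)"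
  by (simp add: det_def mcoeff_mult_zero mcoeff_prod_zero mcoeff_of_int_zero)

lemma invertible_if_one_mod_max_ideal:
  fixes U :: "('k::field, 's::finite) mfps^'n::finite^'n"
  assumes "U - mat 1 \<in> max_pow_mat (Suc 0)"
  shows "invertible U"
proof -
  have "mcoeff (U $ i $ j) (\<lambda>_. 0) = (if i = j then 1 else 0)" for i j
    using assms by (auto simp: mem_max_pow_mat_iff max_pow_Suc_0_iff mat_def split: if_splits)
  then have "map_matrix (\<lambda>f. mcoeff f (\<lambda>_. 0)) U = mat 1"
    by (simp add: vec_eq_iff mat_def)
  then have "mcoeff (det U) (\<lambda>_. 0) \<noteq> 0"
    by (simp add: mcoeff_det_zero)
  then show ?thesis
    using mfps_unit invertible_if_unit_det by blast
qed


section \<open>Tangent images\<close>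

text \<open>With these flags an inactive side means \<open>mat 1\<close> in the group and
  \<open>0\<close> in the tangent space, so that the four groups are treated by one argument with
  factors on both sides.\<close>

fun left_active :: "group_kind \<Rightarrow> bool" where
  "left_active Grp_R = False"
| "left_active Grp_l = True"
| "left_active Grp_r = False"
| "left_active Grp_lr = True"

fun right_active :: "group_kind \<Rightarrow> bool" where
  "right_active Grp_R = False"
| "right_active Grp_l = False"
| "right_active Grp_r = True"
| "right_active Grp_lr = True"

lemma group_orbitI:
  assumes "\<phi> \<in> Aut_mfps" "invertible U" "invertible V"
    and "\<not> left_active G \<Longrightarrow> U = mat 1" "\<not> right_active G \<Longrightarrow> V = mat 1"
  shows "U ** map_matrix \<phi> A ** V \<in> group_orbit G A"
  using assms by (cases G) auto

lemma subspace_set_plus: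
  fixes S T :: "('r::comm_ring_1^'n^'m) set"
  assumes "mat_scale.subspace S" "mat_scale.subspace T"
  shows "mat_scale.subspace (S + T)"
proof -
  have "S + T = mat_scale.span (S \<union> T)"
    unfolding mat_scale.span_Un using assms by (auto simp: set_plus_def mat_scale.span_eq_iff[THEN iffD2])
  then show ?thesis
    by simp
qed

lemma subspace_linear_part: "mat_scale.subspace (linear_part G A)"
  by (cases G) (simp_all add: left_module_def right_module_def subspace_set_plus)

text \<open>The matrices \<open>u ** A\<close> form a submodule that contains the generators
  \<open>mat_unit p q ** A\<close>, and symmetrically on the right.\<close>

lemma linear_part_cases:
  assumes "X \<in> linear_part G A"
  shows "\<exists>u v. X = u ** A + A ** v \<and> (\<not> left_active G \<longrightarrow> u = 0) \<and> (\<not> right_active G \<longrightarrow> v = 0)"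
proof -
  have "left_module A \<subseteq> range (\<lambda>u. u ** A)"
    unfolding left_module_def
  proof (rule mat_scale.span_minimal)
    show "mat_scale.subspace (range (\<lambda>u. u ** A))"
      by (rule mat_scale.subspaceI)
         (auto simp flip: matrix_mult_add_left matrix_mult_scale_left
           intro: range_eqI[of _ _ 0] simp: matrix_mult_zero_left)
  qed auto
  moreover have "right_module A \<subseteq> range (\<lambda>v. A ** v)"
    unfolding right_module_def
  proof (rule mat_scale.span_minimal)
    show "mat_scale.subspace (range (\<lambda>v. A ** v))"
      by (rule mat_scale.subspaceI)
         (auto simp flip: matrix_mult_add_right matrix_mult_scale_right
           intro: range_eqI[of _ _ 0] simp: matrix_mult_zero_right)
  qed auto
  ultimately show ?thesis
    using assms
    by (cases G; fastforce simp: set_plus_def matrix_mult_zero_left matrix_mult_zero_right)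
qed

lemma subspace_deriv_module: "mat_scale.subspace (deriv_module A)"
  by (simp add: deriv_module_def)

lemma deriv_module_cases:
  assumes "X \<in> deriv_module A"
  shows "\<exists>d. X = (\<Sum>v\<in>UNIV. mat_scale (d v) (map_matrix (mderiv v) A))"
proof -
  have "deriv_module A \<subseteq> range (\<lambda>d. \<Sum>v\<in>UNIV. mat_scale (d v) (map_matrix (mderiv v) A))"
    unfolding deriv_module_def
  proof (rule mat_scale.span_minimal)
    show "mat_scale.subspace (range (\<lambda>d. \<Sum>v\<in>UNIV. mat_scale (d v) (map_matrix (mderiv v) A)))"
    proof (rule mat_scale.subspaceI)
      show "0 \<in> range (\<lambda>d. \<Sum>v\<in>UNIV. mat_scale (d v) (map_matrix (mderiv v) A))"
        by (rule range_eqI[of _ _ "\<lambda>_. 0"]) simp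
    next
      fix x y
      assume "x \<in> range (\<lambda>d. \<Sum>v\<in>UNIV. mat_scale (d v) (map_matrix (mderiv v) A))"
        "y \<in> range (\<lambda>d. \<Sum>v\<in>UNIV. mat_scale (d v) (map_matrix (mderiv v) A))"
      then obtain d d' where "x = (\<Sum>v\<in>UNIV. mat_scale (d v) (map_matrix (mderiv v) A))"
        "y = (\<Sum>v\<in>UNIV. mat_scale (d' v) (map_matrix (mderiv v) A))"
        by blast
      then show "x + y \<in> range (\<lambda>d. \<Sum>v\<in>UNIV. mat_scale (d v) (map_matrix (mderiv v) A))"
        by (intro range_eqI[of _ _ "\<lambda>v. d v + d' v"])
           (simp add: mat_scale.scale_left_distrib sum.distrib)
    next
      fix c x
      assume "x \<in> range (\<lambda>d. \<Sum>v\<in>UNIV. mat_scale (d v) (map_matrix (mderiv v) A))"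
      then obtain d where "x = (\<Sum>v\<in>UNIV. mat_scale (d v) (map_matrix (mderiv v) A))"
        by blast
      then show "mat_scale c x \<in> range (\<lambda>d. \<Sum>v\<in>UNIV. mat_scale (d v) (map_matrix (mderiv v) A))"
        by (intro range_eqI[of _ _ "\<lambda>v. c * d v"]) (simp add: mat_scale.scale_sum_right)
    qed
    show "{map_matrix (mderiv v) A |v. True}
        \<subseteq> range (\<lambda>d. \<Sum>v\<in>UNIV. mat_scale (d v) (map_matrix (mderiv v) A))"
    proof clarify
      fix v :: 'b
      have "map_matrix (mderiv v) A =
          (\<Sum>w\<in>UNIV. mat_scale (if w = v then 1 else 0) (map_matrix (mderiv w) A))"
        by (simp add: if_distrib[of "\<lambda>c. mat_scale c _"] cong: if_cong)
      then show "map_matrix (mderiv v) A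
          \<in> range (\<lambda>d. \<Sum>v\<in>UNIV. mat_scale (d v) (map_matrix (mderiv v) A))"
        by (rule range_eqI[of _ _ "\<lambda>w. if w = v then 1 else 0"])
    qed
  qed
  with assms show ?thesis
    by blast
qed

lemma subspace_tangent_image: "mat_scale.subspace (tangent_image G A)"
  unfolding tangent_image_def ideal_smult_def
  by (intro subspace_set_plus subspace_linear_part mat_scale.subspace_span)

lemma subspace_ext_tangent_image: "mat_scale.subspace (ext_tangent_image G A)"
  unfolding ext_tangent_image_def
  by (intro subspace_set_plus subspace_linear_part subspace_deriv_module)

lemma max_ideal_deriv_module_subset: "ideal_smult mat_scale max_ideal (deriv_module A) \<subseteq> deriv_module A"
  unfolding ideal_smult_def
  by (rule mat_scale.span_minimal[OF _ subspace_deriv_module])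
     (auto intro: mat_scale.subspace_scale[OF subspace_deriv_module])

lemma tangent_image_subset_ext: "tangent_image G A \<subseteq> ext_tangent_image G A"
  unfolding tangent_image_def ext_tangent_image_def
  by (intro set_plus_mono2 order_refl max_ideal_deriv_module_subset)

text \<open>The linear part, being a submodule, absorbs the factor \<open>r\<close>; the derivative
  part is where that factor supplies the missing \<mm>.\<close>

lemma max_ideal_scale_ext_tangent_image:
  assumes "r \<in> max_pow (Suc 0)" "X \<in> ext_tangent_image G A"
  shows "mat_scale r X \<in> tangent_image G A"
proof -
  obtain L D where X: "X = L + D" and L: "L \<in> linear_part G A" and D: "D \<in> deriv_module A"
    using assms(2) by (auto simp: ext_tangent_image_def elim: set_plus_elim)
  have "mat_scale r D \<in> ideal_smult mat_scale max_ideal (deriv_module A)"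
    using D assms(1) unfolding ideal_smult_def max_pow_Suc_0 by (auto intro: mat_scale.span_base)
  then show ?thesis
    unfolding X mat_scale.scale_right_distrib tangent_image_def
    by (rule set_plus_intro[OF mat_scale.subspace_scale[OF subspace_linear_part L]])
qed

text \<open>Passing from the extended to the ordinary tangent image costs one variable. This is why
  \<open>h\<close> enters the determinacy bound in the same way as \<open>l\<close>.\<close>

lemma max_pow_mat_subset_tangent_image:
  assumes "max_pow_mat h \<subseteq> ext_tangent_image G A"
  shows "max_pow_mat (Suc h) \<subseteq> tangent_image G A"
proof
  fix X :: "('a, 'b) mfps^'c^'d" assume "X \<in> max_pow_mat (Suc h)"
  then obtain Y where "\<And>v. Y v \<in> max_pow_mat h" "X = (\<Sum>v\<in>UNIV. mat_scale (mvar v) (Y v))"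
    using max_pow_mat_Suc_decomp by blast
  then show "X \<in> tangent_image G A"
    using assms by (auto intro!: mat_scale.subspace_sum[OF subspace_tangent_image]
        max_ideal_scale_ext_tangent_image)
qed

text \<open>The part of the tangent image coming from \<open>u, v\<close> of order \<open>a\<close> and a vector field of order
  \<open>a + 1\<close>; such data integrate to group elements only for \<open>a > 0\<close>.\<close>

definition tangent_level ::
  "group_kind \<Rightarrow> ('k::field, 's::finite) mfps^'n::finite^'m::finite \<Rightarrow> nat
     \<Rightarrow> (('k, 's) mfps^'n^'m) set" where
  "tangent_level G A a = {u ** A + A ** v + (\<Sum>w\<in>UNIV. mat_scale (d w) (map_matrix (mderiv w) A)) |u v d.
     u \<in> max_pow_mat a \<and> v \<in> max_pow_mat a \<and> (\<forall>w. d w \<in> max_pow (Suc a)) \<and>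
     (\<not> left_active G \<longrightarrow> u = 0) \<and> (\<not> right_active G \<longrightarrow> v = 0)}"

lemma tangent_level_add:
  assumes "X \<in> tangent_level G A a" "Y \<in> tangent_level G A a"
  shows "X + Y \<in> tangent_level G A a"
proof -
  obtain u v d where X: "X = u ** A + A ** v + (\<Sum>w\<in>UNIV. mat_scale (d w) (map_matrix (mderiv w) A))"
    "u \<in> max_pow_mat a" "v \<in> max_pow_mat a" "\<forall>w. d w \<in> max_pow (Suc a)"
    "\<not> left_active G \<longrightarrow> u = 0" "\<not> right_active G \<longrightarrow> v = 0"
    using assms(1) unfolding tangent_level_def by blast
  obtain u' v' d' where Y: "Y = u' ** A + A ** v' + (\<Sum>w\<in>UNIV. mat_scale (d' w) (map_matrix (mderiv w) A))"
    "u' \<in> max_pow_mat a" "v' \<in> max_pow_mat a" "\<forall>w. d' w \<in> max_pow (Suc a)"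
    "\<not> left_active G \<longrightarrow> u' = 0" "\<not> right_active G \<longrightarrow> v' = 0"
    using assms(2) unfolding tangent_level_def by blast
  show ?thesis
    unfolding tangent_level_def
    by (rule CollectI, rule exI[of _ "u + u'"], rule exI[of _ "v + v'"],
        rule exI[of _ "\<lambda>w. d w + d' w"])
       (use X Y in \<open>auto simp: matrix_mult_add_left matrix_mult_add_right mat_scale.scale_left_distrib
          sum.distrib intro!: max_pow_mat_add max_pow_add\<close>)
qed

lemma tangent_level_zero: "0 \<in> tangent_level G A a"
  unfolding tangent_level_def
  by (rule CollectI, rule exI[of _ 0], rule exI[of _ 0], rule exI[of _ "\<lambda>_. 0"])
     (simp add: matrix_mult_zero_left matrix_mult_zero_right)

lemma tangent_level_sum: "(\<And>i. i \<in> I \<Longrightarrow> X i \<in> tangent_level G A a) \<Longrightarrow> sum X I \<in> tangent_level G A a"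
  by (induction I rule: infinite_finite_induct) (auto simp: tangent_level_zero tangent_level_add)

lemma tangent_level_scale:
  assumes "r \<in> max_pow b" "X \<in> tangent_level G A a"
  shows "mat_scale r X \<in> tangent_level G A (b + a)"
proof -
  obtain u v d where X: "X = u ** A + A ** v + (\<Sum>w\<in>UNIV. mat_scale (d w) (map_matrix (mderiv w) A))"
    "u \<in> max_pow_mat a" "v \<in> max_pow_mat a" "\<forall>w. d w \<in> max_pow (Suc a)"
    "\<not> left_active G \<longrightarrow> u = 0" "\<not> right_active G \<longrightarrow> v = 0"
    using assms(2) unfolding tangent_level_def by blast
  have "r * d w \<in> max_pow (Suc (b + a))" for w
    using max_pow_mult[OF assms(1)] X(4) by fastforce
  then show ?thesis
    unfolding tangent_level_def
    by (intro CollectI exI[of _ "mat_scale r u"] exI[of _ "mat_scale r v"] exI[of _ "\<lambda>w. r * d w"])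
       (use X assms(1) in \<open>auto simp: matrix_mult_scale_left matrix_mult_scale_right
          mat_scale.scale_right_distrib mat_scale.scale_sum_right intro: max_pow_mat_scale[of r b _ a]\<close>)
qed

text \<open>The factor \<mm> in front of the derivatives is the order \<open>Suc 0\<close> demanded
  of \<open>d\<close>, while \<open>u\<close> and \<open>v\<close> are unrestricted at level
  0.\<close>

lemma tangent_image_subset_level: "tangent_image G A \<subseteq> tangent_level G A 0"
proof
  fix X assume "X \<in> tangent_image G A"
  then obtain L D where X: "X = L + D" and L: "L \<in> linear_part G A"
    and D: "D \<in> ideal_smult mat_scale max_ideal (deriv_module A)"
    by (auto simp: tangent_image_def elim: set_plus_elim)
  obtain u v where uv: "L = u ** A + A ** v" "\<not> left_active G \<longrightarrow> u = 0" "\<not> right_active G \<longrightarrow> v = 0"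
    using linear_part_cases[OF L] by blast
  have "L \<in> tangent_level G A 0"
    unfolding tangent_level_def
    by (rule CollectI, rule exI[of _ u], rule exI[of _ v], rule exI[of _ "\<lambda>_. 0"]) (use uv in simp)
  moreover have "ideal_smult mat_scale max_ideal (deriv_module A) \<subseteq> tangent_level G A 0"
    unfolding ideal_smult_def
  proof (rule mat_scale.span_minimal)
    show "mat_scale.subspace (tangent_level G A 0)"
      using tangent_level_scale[of _ 0 _ G A 0]
      by (auto intro!: mat_scale.subspaceI tangent_level_zero tangent_level_add)
    show "{mat_scale a x |a x. a \<in> max_ideal \<and> x \<in> deriv_module A} \<subseteq> tangent_level G A 0"
    proof clarify
      fix a :: "('a, 'b) mfps" and x
      assume a: "a \<in> max_ideal" and "x \<in> deriv_module A"
      then obtain d where d: "x = (\<Sum>w\<in>UNIV. mat_scale (d w) (map_matrix (mderiv w) A))"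
        using deriv_module_cases by blast
      show "mat_scale a x \<in> tangent_level G A 0"
        unfolding tangent_level_def
        by (rule CollectI, rule exI[of _ 0], rule exI[of _ 0], rule exI[of _ "\<lambda>w. a * d w"])
           (use a in \<open>auto simp: d mat_scale.scale_sum_right matrix_mult_zero_left matrix_mult_zero_right
              max_pow_mult_right simp flip: max_pow_Suc_0\<close>)
    qed
  qed
  ultimately show "X \<in> tangent_level G A 0"
    using D unfolding X by (blast intro: tangent_level_add)
qed

lemma max_pow_mat_subset_level:
  assumes "max_pow_mat l \<subseteq> tangent_level G A 0"
  shows "max_pow_mat (a + l) \<subseteq> tangent_level G A a"
proof (induction a)
  case (Suc a)
  show ?case
  proof
    fix X :: "('a, 'b) mfps^'c^'d" assume "X \<in> max_pow_mat (Suc a + l)"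
    then obtain Y where "\<And>v. Y v \<in> max_pow_mat (a + l)" "X = (\<Sum>v\<in>UNIV. mat_scale (mvar v) (Y v))"
      using max_pow_mat_Suc_decomp[of X "a + l"] by auto
    moreover have "mat_scale (mvar v) (Y v) \<in> tangent_level G A (Suc 0 + a)" for v
      by (rule tangent_level_scale[OF var_in_max_pow]) (use Suc calculation in blast)
    ultimately show "X \<in> tangent_level G A (Suc a)"
      by (simp add: tangent_level_sum)
  qed
qed (use assms in simp)

text \<open>Differentiation loses one order, which \<open>d\<close> of order at least 1 restores.
  This bounds the order of \<open>A\<close> by the exponent \<open>l + 1\<close> of the
  hypothesis.\<close>

lemma tangent_level_subset_max_pow_mat:
  assumes "A \<in> max_pow_mat e"
  shows "tangent_level G A 0 \<subseteq> max_pow_mat e"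
proof -
  have "map_matrix (mderiv w) A \<in> max_pow_mat (e - 1)" for w
    using assms mderiv_max_pow[of _ e w] by (auto simp: mem_max_pow_mat_iff)
  then show ?thesis
    using assms unfolding tangent_level_def
    by (auto intro!: max_pow_mat_add max_pow_mat_sum max_pow_mat_mult_left[of A] max_pow_mat_mult_right[of A]
        max_pow_mat_scale[of _ 1 _ "e - 1"])
qed

lemma max_pow_mat_subset_imp_le:
  assumes "max_pow_mat i \<subseteq> (max_pow_mat j :: (('k::field, 's::finite) mfps^'n::finite^'m::finite) set)"
  shows "j \<le> i"
proof (rule ccontr)
  assume "\<not> j \<le> i"
  \<comment> \<open>Any variable will do; \<open>undefined\<close> names one, since the index type
    is nonempty. A monomial of degree exactly \<open>i\<close> separates the two powers.\<close>
  define b :: "'s \<Rightarrow> nat" where "b = (\<lambda>_. 0)(undefined := i)"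
  have b: "mdeg b = i"
    by (simp add: b_def mdeg_single)
  have "((\<chi> p q. mmonom b) :: ('k, 's) mfps^'n^'m) \<in> max_pow_mat i"
    using monom_in_max_pow[of b] b by (simp add: mem_max_pow_mat_iff)
  then have "((\<chi> p q. mmonom b) :: ('k, 's) mfps^'n^'m) \<in> max_pow_mat j"
    using assms by blast
  then have "(mmonom b :: ('k, 's) mfps) \<in> max_pow j"
    by (simp add: mem_max_pow_mat_iff)
  then show False
    using \<open>\<not> j \<le> i\<close> b by (auto simp: mem_max_pow_iff dest!: spec[of _ b])
qed


section \<open>Finite determinacy\<close>

text \<open>The group element built from \<open>u\<close>, \<open>v\<close> and \<open>d\<close>
  differs from \<open>C\<close> only by the Taylor remainder and by products of two corrections:
  orders \<open>q\<close> and \<open>e + q\<close> multiply to order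
  \<open>2 * q + e\<close>.\<close>

lemma infinitesimal_step:
  assumes C: "C - A \<in> tangent_level G A q" and q: "q \<ge> 1"
    and A: "A \<in> max_pow_mat e" and e: "e \<ge> 1"
  shows "\<exists>u \<phi> v. tangent_to_id \<phi> \<and> (\<forall>f. \<phi> f - f \<in> max_pow q) \<and>
    u - mat 1 \<in> max_pow_mat q \<and> v - mat 1 \<in> max_pow_mat q \<and>
    (\<not> left_active G \<longrightarrow> u = mat 1) \<and> (\<not> right_active G \<longrightarrow> v = mat 1) \<and>
    C - u ** map_matrix \<phi> A ** v \<in> max_pow_mat (2 * q + e)"
proof -
  obtain u v d where CA: "C - A = u ** A + A ** v + (\<Sum>w\<in>UNIV. mat_scale (d w) (map_matrix (mderiv w) A))"
    and uv: "u \<in> max_pow_mat q" "v \<in> max_pow_mat q" and d: "\<And>w. d w \<in> max_pow (Suc q)"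
    and G: "\<not> left_active G \<longrightarrow> u = 0" "\<not> right_active G \<longrightarrow> v = 0"
    using C unfolding tangent_level_def by blast
  define \<delta> where "\<delta> = (\<Sum>w\<in>UNIV. mat_scale (d w) (map_matrix (mderiv w) A))"
  obtain \<phi> where \<phi>: "tangent_to_id \<phi>"
    and first: "\<And>j f. f \<in> max_pow j \<Longrightarrow> \<phi> f - f \<in> max_pow (j + q)"
    and second: "\<And>j f. f \<in> max_pow j \<Longrightarrow>
      \<phi> f - f - (\<Sum>v\<in>UNIV. d v * mderiv v f) \<in> max_pow (j + 2 * q)"
    using exists_tangent_to_id[of d "Suc q"] d q by auto
  define E where "E = map_matrix \<phi> A - A"
  have E: "E \<in> max_pow_mat (e + q)"
    using A first by (auto simp: E_def mem_max_pow_mat_iff)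
  have E\<delta>: "E - \<delta> \<in> max_pow_mat (2 * q + e)"
    using A second by (auto simp: E_def \<delta>_def mem_max_pow_mat_iff add.commute)
  have Av: "A ** v \<in> max_pow_mat (e + q)"
    using max_pow_mat_mult[OF A uv(2)] by simp
  have Ev: "E ** v \<in> max_pow_mat (e + q)"
    by (rule max_pow_mat_mult_right[OF E])
  \<comment> \<open>The terms \<open>u ** A\<close>, \<open>A ** v\<close> and
    \<open>\<delta>\<close> cancel; in \<open>E\<close>, the part beyond \<open>\<delta>\<close> is
    the Taylor remainder.\<close>
  have "C - (mat 1 + u) ** map_matrix \<phi> A ** (mat 1 + v) =
      0 - (E - \<delta>) - u ** E - E ** v - u ** (A ** v) - u ** (E ** v)"
  proof -
    have "C = A + u ** A + A ** v + \<delta>"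
      using CA by (simp add: \<delta>_def algebra_simps)
    moreover have "map_matrix \<phi> A = A + E"
      by (simp add: E_def)
    ultimately show ?thesis
      by (simp add: matrix_mult_add_left matrix_mult_add_right algebra_simps flip: matrix_mul_assoc)
  qed
  also have "\<dots> \<in> max_pow_mat (2 * q + e)"
    by (intro max_pow_mat_diff max_pow_mat_zero E\<delta> max_pow_mat_mult[OF uv(1) E]
        max_pow_mat_mult[OF E uv(2)] max_pow_mat_mult[OF uv(1) Av] max_pow_mat_mult[OF uv(1) Ev]) auto
  finally show ?thesis
    using uv G \<phi> first[of _ 0]
    by (intro exI[of _ "mat 1 + u"] exI[of _ \<phi>] exI[of _ "mat 1 + v"]) auto
qed

text \<open>Pulling \<open>B\<close> back along the group element found so far reduces the improvement of the
  approximation to the infinitesimal step at \<open>A\<close> itself.\<close>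

lemma improve_approximation:
  fixes A B :: "('k::field, 's::finite) mfps^'n::finite^'m::finite"
  assumes level: "max_pow_mat (q + Suc l) \<subseteq> tangent_level G A q" and q: "q \<ge> 1"
    and A: "A \<in> max_pow_mat e" and e: "e \<ge> 1" "l + 2 \<le> q + e"
    and \<phi>: "tangent_to_id \<phi>" and UV: "U - mat 1 \<in> max_pow_mat 1" "V - mat 1 \<in> max_pow_mat 1"
    and G: "\<not> left_active G \<longrightarrow> U = mat 1" "\<not> right_active G \<longrightarrow> V = mat 1"
    and B: "B - U ** map_matrix \<phi> A ** V \<in> max_pow_mat (q + Suc l)"
  shows "\<exists>U' \<phi>' V'. tangent_to_id \<phi>' \<and> U' - mat 1 \<in> max_pow_mat 1 \<and> V' - mat 1 \<in> max_pow_mat 1 \<and>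
    (\<not> left_active G \<longrightarrow> U' = mat 1) \<and> (\<not> right_active G \<longrightarrow> V' = mat 1) \<and>
    B - U' ** map_matrix \<phi>' A ** V' \<in> max_pow_mat (Suc q + Suc l) \<and>
    U' - U \<in> max_pow_mat q \<and> V' - V \<in> max_pow_mat q \<and> (\<forall>f. \<phi>' f - \<phi> f \<in> max_pow q)"
proof -
  note endo = tangent_to_id_alg_endo[OF \<phi>]
  obtain Ui where Ui: "U ** Ui = mat 1" "Ui ** U = mat 1"
    using UV(1) invertible_if_one_mod_max_ideal[of U] unfolding invertible_def One_nat_def by blast
  obtain Vi where Vi: "V ** Vi = mat 1" "Vi ** V = mat 1"
    using UV(2) invertible_if_one_mod_max_ideal[of V] unfolding invertible_def One_nat_def by blast
  have surj: "surj \<phi>"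
    using tangent_to_id_Aut[OF \<phi>] by (simp add: Aut_mfps_def bij_def)
  \<comment> \<open>The preimage of \<open>B\<close> under the current group element; it is as close
    to \<open>A\<close> as \<open>B\<close> is to the current approximant.\<close>
  define C where "C = map_matrix (inv \<phi>) (Ui ** B ** Vi)"
  have \<phi>C: "map_matrix \<phi> C = Ui ** B ** Vi"
    using surj by (simp add: C_def vec_eq_iff surj_f_inv_f)
  have "U ** (Ui ** B ** Vi) ** V = (U ** Ui) ** B ** (Vi ** V)"
    by (simp only: matrix_mul_assoc)
  then have C: "U ** map_matrix \<phi> C ** V = B"
    by (simp add: \<phi>C Ui Vi)
  have transport: "U ** map_matrix \<phi> (C - X) ** V = B - U ** map_matrix \<phi> X ** V" for X
    by (simp add: map_matrix_diff[OF endo] matrix_mult_diff_left matrix_mult_diff_right C)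
  have "Ui ** (U ** map_matrix \<phi> (C - A) ** V) ** Vi \<in> max_pow_mat (q + Suc l)"
    unfolding transport by (intro max_pow_mat_mult_left max_pow_mat_mult_right B)
  moreover have "Ui ** (U ** map_matrix \<phi> (C - A) ** V) ** Vi =
      (Ui ** U) ** map_matrix \<phi> (C - A) ** (V ** Vi)"
    by (simp only: matrix_mul_assoc)
  ultimately have "map_matrix \<phi> (C - A) \<in> max_pow_mat (q + Suc l)"
    by (simp add: Ui Vi)
  then have "C - A \<in> tangent_level G A q"
    using level map_matrix_max_pow_iff[OF \<phi>] by blast
  from infinitesimal_step[OF this q A e(1)]
  obtain u \<psi> v where \<psi>: "tangent_to_id \<psi>" "\<And>f. \<psi> f - f \<in> max_pow q"
    and uv: "u - mat 1 \<in> max_pow_mat q" "v - mat 1 \<in> max_pow_mat q"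
    and G': "\<not> left_active G \<longrightarrow> u = mat 1" "\<not> right_active G \<longrightarrow> v = mat 1"
    and Cuv: "C - u ** map_matrix \<psi> A ** v \<in> max_pow_mat (2 * q + e)"
    by blast
  \<comment> \<open>Composition in the semidirect product: \<open>\<phi>\<close> acts on the new
    factors \<open>u\<close> and \<open>v\<close> before they meet \<open>U\<close> and
    \<open>V\<close>.\<close>
  define U' V' where "U' = U ** map_matrix \<phi> u" and "V' = map_matrix \<phi> v ** V"
  have eq: "U' - U = U ** map_matrix \<phi> (u - mat 1)" "V' - V = map_matrix \<phi> (v - mat 1) ** V"
    by (simp_all add: U'_def V'_def map_matrix_diff[OF endo] map_matrix_one[OF endo]
        matrix_mult_diff_left matrix_mult_diff_right)
  have U'U: "U' - U \<in> max_pow_mat q"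
    unfolding eq by (rule max_pow_mat_mult_left) (simp add: map_matrix_max_pow_iff[OF \<phi>] uv)
  have V'V: "V' - V \<in> max_pow_mat q"
    unfolding eq by (rule max_pow_mat_mult_right) (simp add: map_matrix_max_pow_iff[OF \<phi>] uv)
  have U'1: "U' - mat 1 \<in> max_pow_mat 1"
    using max_pow_mat_add[OF max_pow_matD[OF U'U q] UV(1)] by simp
  have V'1: "V' - mat 1 \<in> max_pow_mat 1"
    using max_pow_mat_add[OF max_pow_matD[OF V'V q] UV(2)] by simp
  \<comment> \<open>Here \<open>l + 2 \<le> q + e\<close> turns the order \<open>2 * q + e\<close>
    into at least \<open>Suc q + Suc l\<close>.\<close>
  have "U ** map_matrix \<phi> (C - u ** map_matrix \<psi> A ** v) ** V \<in> max_pow_mat (Suc q + Suc l)"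
    by (intro max_pow_mat_mult_left max_pow_mat_mult_right)
       (use max_pow_matD[OF Cuv] e in \<open>simp add: map_matrix_max_pow_iff[OF \<phi>]\<close>)
  moreover have "map_matrix \<phi> (map_matrix \<psi> A) = map_matrix (\<phi> \<circ> \<psi>) A"
    by (simp add: vec_eq_iff)
  ultimately have "B - U' ** map_matrix (\<phi> \<circ> \<psi>) A ** V' \<in> max_pow_mat (Suc q + Suc l)"
    unfolding transport by (simp add: U'_def V'_def map_matrix_mult[OF endo] matrix_mul_assoc)
  moreover have "(\<phi> \<circ> \<psi>) f - \<phi> f \<in> max_pow q" for f
    using tangent_to_id_max_pow[OF \<phi> \<psi>(2)] by (simp add: alg_endo_diff[OF endo])
  ultimately show ?thesis
    using tangent_to_id_comp[OF \<phi> \<psi>(1)] U'U V'V U'1 V'1 G G'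
    by (intro exI[of _ U'] exI[of _ "\<phi> \<circ> \<psi>"] exI[of _ V'])
       (auto simp: U'_def V'_def map_matrix_one[OF endo])
qed

text \<open>\<open>e\<close> is any positive lower bound for the order of \<open>A\<close>, and the
  equation for \<open>N\<close> replaces a truncated subtraction. The group elements of the
  iteration form a Cauchy sequence whose limit carries \<open>A\<close> to \<open>B\<close>.\<close>

theorem determined_if_max_pow_mat_subset:
  fixes A :: "('k::field, 's::finite) mfps^'n::finite^'m::finite"
  assumes sub: "max_pow_mat (Suc l) \<subseteq> tangent_image G A"
    and A: "A \<in> max_pow_mat e" and e: "e \<ge> 1" and N: "N + e = 2 * l + 2"
  shows "determined G N A"
  unfolding determined_def
proof (intro allI impI)
  fix B assume B: "B - A \<in> max_pow_mat (N + 1)"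
  have level0: "max_pow_mat (Suc l) \<subseteq> tangent_level G A 0"
    using sub tangent_image_subset_level by blast
  have "e \<le> Suc l"
    using level0 tangent_level_subset_max_pow_mat[OF A] by (blast intro: max_pow_mat_subset_imp_le)
  \<comment> \<open>\<open>l + 2 - e\<close> is the least level at which the quadratic error is an
    improvement; with it the initial error has order \<open>N + 1\<close>.\<close>
  define q where "q n = n + (l + 2 - e)" for n
  have q: "q n \<ge> 1" "l + 2 \<le> q n + e" "q (Suc n) = Suc (q n)" "n \<le> q n" for n
    using \<open>e \<le> Suc l\<close> by (auto simp: q_def)
  have q0: "q 0 + Suc l = N + 1"
    using N \<open>e \<le> Suc l\<close> by (simp add: q_def)
  \<comment> \<open>\<open>P\<close> is the invariant of the current group element, \<open>Q\<close>
    the closeness of consecutive ones that makes all three components converge.\<close>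
  define P where "P n s = (case s of (U, \<phi>, V) \<Rightarrow> tangent_to_id \<phi> \<and>
    U - mat 1 \<in> max_pow_mat 1 \<and> V - mat 1 \<in> max_pow_mat 1 \<and>
    (\<not> left_active G \<longrightarrow> U = mat 1) \<and> (\<not> right_active G \<longrightarrow> V = mat 1) \<and>
    B - U ** map_matrix \<phi> A ** V \<in> max_pow_mat (q n + Suc l))"
    for n and s :: "(('k, 's) mfps^'m^'m) \<times> (('k, 's) mfps \<Rightarrow> ('k, 's) mfps) \<times> (('k, 's) mfps^'n^'n)"
  define Q where "Q n s s' = (case (s, s') of ((U, \<phi>, V), (U', \<phi>', V')) \<Rightarrow>
    U' - U \<in> max_pow_mat n \<and> V' - V \<in> max_pow_mat n \<and> (\<forall>f. \<phi>' f - \<phi> f \<in> max_pow n))"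
    for n and s s' :: "(('k, 's) mfps^'m^'m) \<times> (('k, 's) mfps \<Rightarrow> ('k, 's) mfps) \<times> (('k, 's) mfps^'n^'n)"
  have "map_matrix id A = A"
    by (simp add: vec_eq_iff)
  then have base: "P 0 (mat 1, id, mat 1)"
    using B q0 by (simp add: P_def tangent_to_id_id)
  have step: "\<exists>s'. P (Suc n) s' \<and> Q n s s'" if s: "P n s" for n s
  proof -
    obtain U \<phi> V where [simp]: "s = (U, \<phi>, V)"
      by (cases s)
    have "tangent_to_id \<phi>" "U - mat 1 \<in> max_pow_mat 1" "V - mat 1 \<in> max_pow_mat 1"
      "\<not> left_active G \<longrightarrow> U = mat 1" "\<not> right_active G \<longrightarrow> V = mat 1"
      "B - U ** map_matrix \<phi> A ** V \<in> max_pow_mat (q n + Suc l)"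
      using s by (auto simp: P_def)
    from improve_approximation[OF max_pow_mat_subset_level[OF level0] q(1) A e q(2) this]
    obtain U' \<phi>' V' where new: "tangent_to_id \<phi>'" "U' - mat 1 \<in> max_pow_mat 1"
      "V' - mat 1 \<in> max_pow_mat 1"
      "\<not> left_active G \<longrightarrow> U' = mat 1" "\<not> right_active G \<longrightarrow> V' = mat 1"
      "B - U' ** map_matrix \<phi>' A ** V' \<in> max_pow_mat (Suc (q n) + Suc l)"
      "U' - U \<in> max_pow_mat (q n)" "V' - V \<in> max_pow_mat (q n)" "\<And>f. \<phi>' f - \<phi> f \<in> max_pow (q n)"
      by blast
    then have "P (Suc n) (U', \<phi>', V')" "Q n s (U', \<phi>', V')"
      using max_pow_matD[OF new(7) q(4)] max_pow_matD[OF new(8) q(4)] max_powD[OF new(9) q(4)]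
      by (simp_all add: P_def Q_def q(3))
    then show ?thesis
      by blast
  qed
  obtain s where s: "\<And>n. P n (s n)" "\<And>n. Q n (s n) (s (Suc n))"
    using dependent_nat_choice[of P Q] base step by blast
  define U \<phi> V where "U n = fst (s n)" and "\<phi> n = fst (snd (s n))" and "V n = snd (snd (s n))" for n
  have P: "tangent_to_id (\<phi> n)" "U n - mat 1 \<in> max_pow_mat 1" "V n - mat 1 \<in> max_pow_mat 1"
    "\<not> left_active G \<Longrightarrow> U n = mat 1" "\<not> right_active G \<Longrightarrow> V n = mat 1"
    "B - U n ** map_matrix (\<phi> n) A ** V n \<in> max_pow_mat n" for n
    using s(1)[of n] q(4)[of n] by (auto simp: P_def U_def \<phi>_def V_def split: prod.splits intro: max_pow_matD)
  have Q: "U (Suc n) - U n \<in> max_pow_mat n" "V (Suc n) - V n \<in> max_pow_mat n"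
    "\<phi> (Suc n) f - \<phi> n f \<in> max_pow n" for n f
    using s(2)[of n] by (auto simp: Q_def U_def \<phi>_def V_def split: prod.splits)
  obtain U' where U': "\<And>n. U' - U n \<in> max_pow_mat n"
    using max_pow_mat_complete[of U] Q by blast
  obtain V' where V': "\<And>n. V' - V n \<in> max_pow_mat n"
    using max_pow_mat_complete[of V] Q by blast
  obtain \<psi> where \<psi>: "tangent_to_id \<psi>" "\<And>n f. \<psi> f - \<phi> n f \<in> max_pow n"
    using tangent_to_id_limit[of \<phi>] P Q by blast
  have "B = U' ** map_matrix \<psi> A ** V'"
  proof (rule max_pow_mat_Inter_eq)
    fix n
    let ?A = "map_matrix \<psi> A" and ?An = "map_matrix (\<phi> n) A"
    have \<psi>A: "?A - ?An \<in> max_pow_mat n"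
      using \<psi>(2) by (simp add: mem_max_pow_mat_iff)
    \<comment> \<open>The three factors are exchanged for their limits one at a time.\<close>
    have "B - U' ** ?A ** V' = (B - U n ** ?An ** V n)
        - ((U' - U n) ** ?An ** V n + U' ** (?A - ?An) ** V n + U' ** ?A ** (V' - V n))"
      by (simp add: matrix_mult_diff_left matrix_mult_diff_right)
    also have "\<dots> \<in> max_pow_mat n"
      by (intro max_pow_mat_diff max_pow_mat_add P(6) max_pow_mat_mult_left[OF V']
          max_pow_mat_mult_right[OF max_pow_mat_mult_right[OF U']]
          max_pow_mat_mult_right[OF max_pow_mat_mult_left[OF \<psi>A]])
    finally show "B - U' ** ?A ** V' \<in> max_pow_mat n" .
  qed
  moreover have "invertible U'" "invertible V'"
    using max_pow_mat_add[OF U'[of 1] P(2)[of 1]] max_pow_mat_add[OF V'[of 1] P(3)[of 1]]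
    by (auto intro!: invertible_if_one_mod_max_ideal)
  moreover have "U' = mat 1" if "\<not> left_active G"
    by (rule max_pow_mat_Inter_eq) (use U' P(4)[OF that] in simp)
  moreover have "V' = mat 1" if "\<not> right_active G"
    by (rule max_pow_mat_Inter_eq) (use V' P(5)[OF that] in simp)
  ultimately show "B \<in> group_orbit G A"
    using group_orbitI[OF tangent_to_id_Aut[OF \<psi>(1)]] by blast
qed


section \<open>Finite-dimensional quotients\<close>

text \<open>Products of the variables with generators of one power generate the next. This provides
  the finite generation that Nakayama's lemma requires.\<close>

lemma max_pow_mat_finitely_generated:
  "\<exists>S :: (('k::field, 's::finite) mfps^'n::finite^'m::finite) set.
     finite S \<and> max_pow_mat k = mat_scale.span S"
proof (induction k)
  case 0
  define S :: "(('k, 's) mfps^'n^'m) set" where "S = range (\<lambda>(p, q). entry_unit p q)"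
  have "X \<in> mat_scale.span S" for X
    by (subst matrix_entry_decomp[of X], intro mat_scale.span_sum mat_scale.span_scale mat_scale.span_base)
       (auto simp: S_def)
  moreover have "finite S"
    by (simp add: S_def)
  ultimately show ?case
    by (intro exI[of _ S]) auto
next
  case (Suc k)
  then obtain S :: "(('k, 's) mfps^'n^'m) set" where S: "finite S" "max_pow_mat k = mat_scale.span S"
    by blast
  define S' where "S' = (\<lambda>(v :: 's, t). mat_scale (mvar v) t) ` (UNIV \<times> S)"
  have "S' \<subseteq> max_pow_mat (Suc k)"
    using S(2) mat_scale.span_superset[of S] by (auto simp: S'_def intro!: max_pow_mat_scale[of _ 1 _ k])
  then have "mat_scale.span S' \<subseteq> max_pow_mat (Suc k)"
    by (rule mat_scale.span_minimal[OF _ subspace_max_pow_mat])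
  moreover have "max_pow_mat (Suc k) \<subseteq> mat_scale.span S'"
  proof
    fix X :: "('k, 's) mfps^'n^'m" assume "X \<in> max_pow_mat (Suc k)"
    then obtain Y where Y: "\<And>v. Y v \<in> mat_scale.span S" "X = (\<Sum>v\<in>UNIV. mat_scale (mvar v) (Y v))"
      using max_pow_mat_Suc_decomp[of X k] unfolding S(2) by blast
    have "mat_scale (mvar v) y \<in> mat_scale.span S'" if "y \<in> mat_scale.span S" for v y
      using that
    proof (induction rule: mat_scale.span_induct_alt)
      case (step c x y)
      have "mat_scale c (mat_scale (mvar v) x) \<in> mat_scale.span S'"
        by (intro mat_scale.span_scale mat_scale.span_base) (use step in \<open>auto simp: S'_def\<close>)
      from mat_scale.span_add[OF this step(2)] show ?case
        by (simp add: mat_scale.scale_right_distrib mult.commute)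
    qed (simp add: mat_scale.span_zero)
    then show "X \<in> mat_scale.span S'"
      unfolding Y(2) using Y(1) by (intro mat_scale.span_sum) blast
  qed
  moreover have "finite S'"
    using S by (simp add: S'_def)
  ultimately show ?case
    by blast
qed

text \<open>Elimination of one generator at a time: in the relation for \<open>w\<close> the
  coefficient \<open>1 - c w\<close> is a unit, so modulo \<open>N\<close> the element
  \<open>w\<close> is a combination of the others and can be substituted into their
  relations.\<close>

lemma nakayama:
  fixes S N :: "(('k::field, 's::finite) mfps^'n::finite^'m::finite) set"
  assumes "finite S" "mat_scale.subspace N"
    and "\<forall>s\<in>S. \<exists>c. (\<forall>t\<in>S. c t \<in> max_pow (Suc 0)) \<and> s - (\<Sum>t\<in>S. mat_scale (c t) t) \<in> N"
  shows "S \<subseteq> N"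
  using assms
proof (induction S rule: finite_induct)
  case (insert w S)
  note N = insert.prems(1)
  obtain c where c: "\<forall>t\<in>insert w S. c t \<in> max_pow (Suc 0)"
    "w - (\<Sum>t\<in>insert w S. mat_scale (c t) t) \<in> N"
    using insert.prems(2) by blast
  have "mcoeff (1 - c w) (\<lambda>_. 0) \<noteq> 0"
    using c(1) by (simp add: max_pow_Suc_0_iff)
  then obtain g where g: "(1 - c w) * g = 1"
    using mfps_unit by blast
  have "mat_scale g (w - (\<Sum>t\<in>insert w S. mat_scale (c t) t)) =
      mat_scale ((1 - c w) * g) w - (\<Sum>t\<in>S. mat_scale (g * c t) t)"
    using insert.hyps by (simp add: mat_scale.scale_right_diff_distrib mat_scale.scale_left_diff_distrib
        mat_scale.scale_right_distrib mat_scale.scale_sum_right algebra_simps)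
  then have w: "w - (\<Sum>t\<in>S. mat_scale (g * c t) t) \<in> N"
    using mat_scale.subspace_scale[OF N c(2), of g] by (simp add: g)
  have "\<exists>d. (\<forall>t\<in>S. d t \<in> max_pow (Suc 0)) \<and> s - (\<Sum>t\<in>S. mat_scale (d t) t) \<in> N" if "s \<in> S" for s
  proof -
    obtain d where d: "\<forall>t\<in>insert w S. d t \<in> max_pow (Suc 0)"
      "s - (\<Sum>t\<in>insert w S. mat_scale (d t) t) \<in> N"
      using insert.prems(2) \<open>s \<in> S\<close> by blast
    have "s - (\<Sum>t\<in>insert w S. mat_scale (d t) t) + mat_scale (d w) (w - (\<Sum>t\<in>S. mat_scale (g * c t) t))
        = s - (\<Sum>t\<in>S. mat_scale (d t + d w * (g * c t)) t)"
      using insert.hyps by (simp add: mat_scale.scale_right_diff_distrib mat_scale.scale_left_distrib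
          mat_scale.scale_sum_right sum.distrib algebra_simps)
    moreover have "s - (\<Sum>t\<in>insert w S. mat_scale (d t) t)
        + mat_scale (d w) (w - (\<Sum>t\<in>S. mat_scale (g * c t) t)) \<in> N"
      by (intro mat_scale.subspace_add[OF N] mat_scale.subspace_scale[OF N] d w)
    ultimately have "s - (\<Sum>t\<in>S. mat_scale (d t + d w * (g * c t)) t) \<in> N"
      by (simp only:)
    \<comment> \<open>The substitution keeps the coefficients in \<mm>, which the induction
      hypothesis demands.\<close>
    moreover have "\<forall>t\<in>S. d t + d w * (g * c t) \<in> max_pow (Suc 0)"
      using c(1) d(1) by (auto intro!: max_pow_add max_pow_mult_left)
    ultimately show ?thesis
      by (intro exI[of _ "\<lambda>t. d t + d w * (g * c t)"] conjI)
  qed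
  then have "S \<subseteq> N"
    using insert.IH N by blast
  then have "(\<Sum>t\<in>S. mat_scale (g * c t) t) \<in> N"
    by (intro mat_scale.subspace_sum[OF N] mat_scale.subspace_scale[OF N]) blast
  from mat_scale.subspace_add[OF N w this] have "w \<in> N"
    by simp
  with \<open>S \<subseteq> N\<close> show ?case
    by simp
qed simp

lemma max_pow_mat_Suc_span:
  fixes S :: "(('k::field, 's::finite) mfps^'n::finite^'m::finite) set"
  assumes "finite S" "max_pow_mat k = mat_scale.span S" "X \<in> max_pow_mat (Suc k)"
  shows "\<exists>c. (\<forall>t\<in>S. c t \<in> max_pow (Suc 0)) \<and> X = (\<Sum>t\<in>S. mat_scale (c t) t)"
proof -
  obtain Y where Y: "\<And>v. Y v \<in> mat_scale.span S" "X = (\<Sum>v\<in>UNIV. mat_scale (mvar v) (Y v))"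
    using max_pow_mat_Suc_decomp[OF assms(3)] unfolding assms(2) by blast
  have "\<exists>u. Y v = (\<Sum>t\<in>S. mat_scale (u t) t)" for v
    using Y(1)[of v] unfolding mat_scale.span_finite[OF assms(1)] by (rule rangeE) (rule exI)
  then have "\<exists>u. \<forall>v. Y v = (\<Sum>t\<in>S. mat_scale (u v t) t)"
    by (intro choice allI)
  then obtain u where u: "\<And>v. Y v = (\<Sum>t\<in>S. mat_scale (u v t) t)"
    by (elim exE) (rule that, simp)
  have "X = (\<Sum>v\<in>UNIV. \<Sum>t\<in>S. mat_scale (mvar v * u v t) t)"
    by (simp add: Y(2) u mat_scale.scale_sum_right)
  also have "\<dots> = (\<Sum>t\<in>S. mat_scale (\<Sum>v\<in>UNIV. mvar v * u v t) t)"
    by (subst sum.swap) (simp add: mat_scale.scale_sum_left)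
  finally show ?thesis
    by (intro exI[of _ "\<lambda>t. \<Sum>v\<in>UNIV. mvar v * u v t"])
       (auto intro!: max_pow_sum max_pow_mult_right)
qed

text \<open>The hypothesis says that \<mm>^k M is contained in N + \<mm> (\<mm>^k M), so Nakayama's
  lemma applies to generators of \<mm>^k M.\<close>

lemma max_pow_mat_subset_if_stationary:
  fixes N :: "(('k::field, 's::finite) mfps^'n::finite^'m::finite) set"
  assumes N: "mat_scale.subspace N"
    and stat: "\<And>X. X \<in> max_pow_mat k \<Longrightarrow> \<exists>n\<in>N. X - n \<in> max_pow_mat (Suc k)"
  shows "max_pow_mat k \<subseteq> N"
proof -
  obtain S :: "(('k, 's) mfps^'n^'m) set" where S: "finite S" "max_pow_mat k = mat_scale.span S"
    using max_pow_mat_finitely_generated by blast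
  have "\<exists>c. (\<forall>t\<in>S. c t \<in> max_pow (Suc 0)) \<and> s - (\<Sum>t\<in>S. mat_scale (c t) t) \<in> N" if "s \<in> S" for s
  proof -
    have "s \<in> max_pow_mat k"
      using that S(2) mat_scale.span_superset by blast
    then obtain n where n: "n \<in> N" "s - n \<in> max_pow_mat (Suc k)"
      using stat by blast
    obtain c where "\<forall>t\<in>S. c t \<in> max_pow (Suc 0)" "s - n = (\<Sum>t\<in>S. mat_scale (c t) t)"
      using max_pow_mat_Suc_span[OF S n(2)] by blast
    then have "s - (\<Sum>t\<in>S. mat_scale (c t) t) = n"
      by (simp add: algebra_simps)
    then show ?thesis
      using n(1) \<open>\<forall>t\<in>S. c t \<in> max_pow (Suc 0)\<close> by blast
  qed
  then have "S \<subseteq> N"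
    using nakayama[OF S(1) N] by blast
  then show ?thesis
    unfolding S(2) by (rule mat_scale.span_minimal[OF _ N])
qed

text \<open>Gaussian elimination by induction on the equations: a pivot \<open>p\<close> eliminates
  one unknown together with equation \<open>j\<close>.\<close>

lemma homogeneous_system_nontrivial_solution:
  fixes \<gamma> :: "'i \<Rightarrow> 'j \<Rightarrow> 'k::field"
  assumes "finite J" "finite I" "card J < card I"
  shows "\<exists>e. (\<exists>k\<in>I. e k \<noteq> 0) \<and> (\<forall>j\<in>J. (\<Sum>k\<in>I. e k * \<gamma> k j) = 0)"
  using assms
proof (induction J arbitrary: I \<gamma> rule: finite_induct)
  case empty
  then have "I \<noteq> {}"
    by auto
  then show ?case
    by (intro exI[of _ "\<lambda>_. 1"]) auto
next
  case (insert j J)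
  show ?case
  proof (cases "\<forall>k\<in>I. \<gamma> k j = 0")
    case True
    obtain e where "\<exists>k\<in>I. e k \<noteq> 0" "\<forall>j\<in>J. (\<Sum>k\<in>I. e k * \<gamma> k j) = 0"
      using insert.IH[of I \<gamma>] insert.prems insert.hyps by auto
    with True show ?thesis
      by (intro exI[of _ e]) auto
  next
    case False
    then obtain p where p: "p \<in> I" "\<gamma> p j \<noteq> 0"
      by blast
    define \<gamma>' where "\<gamma>' k i = \<gamma> k i - \<gamma> k j / \<gamma> p j * \<gamma> p i" for k i
    have "card J < card (I - {p})"
      using insert.prems insert.hyps p by simp
    then obtain e where e: "\<exists>k\<in>I - {p}. e k \<noteq> 0" "\<forall>i\<in>J. (\<Sum>k\<in>I - {p}. e k * \<gamma>' k i) = 0"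
      using insert.IH[of "I - {p}" \<gamma>'] insert.prems by auto
    \<comment> \<open>The value at the pivot is the one that solves equation
      \<open>j\<close>.\<close>
    define e' where "e' = e(p := - (\<Sum>k\<in>I - {p}. e k * \<gamma> k j) / \<gamma> p j)"
    have "(\<Sum>k\<in>I. e' k * \<gamma> k i) = (\<Sum>k\<in>I - {p}. e k * \<gamma>' k i)" for i
    proof -
      have "(\<Sum>k\<in>I. e' k * \<gamma> k i) = e' p * \<gamma> p i + (\<Sum>k\<in>I - {p}. e k * \<gamma> k i)"
        using p insert.prems(1) by (simp add: sum.remove[of I p] e'_def)
      then show ?thesis
        by (simp add: \<gamma>'_def e'_def algebra_simps sum_subtractf sum_distrib_left sum_divide_distrib)
    qed
    moreover have "(\<Sum>k\<in>I - {p}. e k * \<gamma>' k j) = 0"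
      using p by (simp add: \<gamma>'_def)
    ultimately show ?thesis
      using e by (intro exI[of _ e']) (auto simp: e'_def)
  qed
qed

section \<open>Dimension over the coefficient field\<close>

interpretation mat_scale_K: vector_space "mat_scale_K :: 'k::field \<Rightarrow> ('k, 's::finite) mfps^'n^'m \<Rightarrow> _"
  by unfold_locales
     (simp_all add: mat_scale_K_def mconst_add mconst_mult mat_scale.scale_right_distrib
       mat_scale.scale_left_distrib)

lemma subspace_mat_scale_K: "mat_scale.subspace N \<Longrightarrow> mat_scale_K.subspace N"
  by (simp add: mat_scale.subspace_def mat_scale_K.subspace_def mat_scale_K_def)

lemma coset_eq_iff:
  fixes N :: "('r::comm_ring_1^'n^'m) set"
  assumes "mat_scale.subspace N"
  shows "X +o N = Y +o N \<longleftrightarrow> X - Y \<in> N"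
proof
  assume "X +o N = Y +o N"
  moreover have "X \<in> X +o N"
    using mat_scale.subspace_0[OF assms] by (auto simp: elt_set_plus_def)
  ultimately show "X - Y \<in> N"
    by (auto simp: elt_set_plus_def)
next
  assume XY: "X - Y \<in> N"
  show "X +o N = Y +o N"
  proof (intro equalityI subsetI)
    fix Z assume "Z \<in> X +o N"
    then show "Z \<in> Y +o N"
      using mat_scale.subspace_add[OF assms XY, of "Z - X"] by (auto simp: elt_set_plus_def intro!: bexI[of _ "Z - Y"])
  next
    fix Z assume "Z \<in> Y +o N"
    then show "Z \<in> X +o N"
      using mat_scale.subspace_diff[OF assms _ XY, of "Z - Y"] by (auto simp: elt_set_plus_def intro!: bexI[of _ "Z - X"])
  qed
qed

text \<open>If \<open>\<mm>\<^sup>i V + N\<close> did not become stationary within \<open>d\<close> steps, representatives of the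
  \<open>d + 1\<close> strict inclusions would be linearly independent modulo \<open>N\<close>.\<close>

lemma has_quotient_dim_imp_max_pow_mat_subset:
  fixes N :: "(('k::field, 's::finite) mfps^'n::finite^'m::finite) set"
  assumes N: "mat_scale.subspace N" and dim: "has_quotient_dim mat_scale_K (max_pow_mat j) N d"
  shows "max_pow_mat (j + d) \<subseteq> N"
proof (rule ccontr)
  assume not_sub: "\<not> max_pow_mat (j + d) \<subseteq> N"
  note NK = subspace_mat_scale_K[OF N]
  have "\<exists>W. W \<in> max_pow_mat (j + k) \<and> (\<forall>n\<in>N. W - n \<notin> max_pow_mat (Suc (j + k)))" if "k \<le> d" for k
  proof (rule ccontr)
    assume "\<not> ?thesis"
    then have "max_pow_mat (j + k) \<subseteq> N"
      by (intro max_pow_mat_subset_if_stationary[OF N]) blast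
    then show False
      using not_sub max_pow_matD[of _ "j + d" "j + k"] that by auto
  qed
  then obtain W where W: "\<And>k. k \<le> d \<Longrightarrow> W k \<in> max_pow_mat (j + k)"
    "\<And>k n. k \<le> d \<Longrightarrow> n \<in> N \<Longrightarrow> W k - n \<notin> max_pow_mat (Suc (j + k))"
    by metis
  obtain b where "\<forall>C\<in>quotient_module (max_pow_mat j) N.
      \<exists>!c. (\<forall>i\<ge>d. c i = 0) \<and> C = (\<Sum>i<d. mat_scale_K (c i) (b i)) +o N"
    using dim unfolding has_quotient_dim_def by (elim exE conjE)
  then have b: "\<exists>c. X +o N = (\<Sum>i<d. mat_scale_K (c i) (b i)) +o N" if "X \<in> max_pow_mat j" for X
    using that unfolding quotient_module_def by (meson imageI)
  have "\<exists>c. W k - (\<Sum>i<d. mat_scale_K (c i) (b i)) \<in> N" if "k \<le> d" for k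
    using b[of "W k"] max_pow_matD[OF W(1)[OF that], of j] unfolding coset_eq_iff[OF N] by simp
  then obtain \<gamma> where \<gamma>: "\<And>k. k \<le> d \<Longrightarrow> W k - (\<Sum>i<d. mat_scale_K (\<gamma> k i) (b i)) \<in> N"
    by metis
  \<comment> \<open>\<open>d + 1\<close> coefficient vectors of length \<open>d\<close> admit a
    linear relation.\<close>
  obtain e where e: "\<exists>k\<in>{..d}. e k \<noteq> 0" "\<forall>i\<in>{..<d}. (\<Sum>k\<le>d. e k * \<gamma> k i) = 0"
    using homogeneous_system_nontrivial_solution[of "{..<d}" "{..d}" \<gamma>] by auto
  have "(\<Sum>k\<le>d. mat_scale_K (e k) (W k - (\<Sum>i<d. mat_scale_K (\<gamma> k i) (b i)))) \<in> N"
    by (intro mat_scale_K.subspace_sum[OF NK] mat_scale_K.subspace_scale[OF NK] \<gamma>) auto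
  also have "(\<Sum>k\<le>d. mat_scale_K (e k) (W k - (\<Sum>i<d. mat_scale_K (\<gamma> k i) (b i)))) =
      (\<Sum>k\<le>d. mat_scale_K (e k) (W k)) - (\<Sum>k\<le>d. \<Sum>i<d. mat_scale_K (e k * \<gamma> k i) (b i))"
    by (simp add: mat_scale_K.scale_right_diff_distrib mat_scale_K.scale_sum_right sum_subtractf)
  also have "(\<Sum>k\<le>d. \<Sum>i<d. mat_scale_K (e k * \<gamma> k i) (b i)) =
      (\<Sum>i<d. mat_scale_K (\<Sum>k\<le>d. e k * \<gamma> k i) (b i))"
    by (subst sum.swap) (simp add: mat_scale_K.scale_sum_left)
  also have "\<dots> = 0"
    using e(2) by simp
  finally have sum_N: "(\<Sum>k\<le>d. mat_scale_K (e k) (W k)) \<in> N"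
    by simp
  \<comment> \<open>In the relation, the term of lowest index is congruent modulo \<open>N\<close>
    to a combination of the later ones, which all lie in the next power of \<mm>; this contradicts
    the choice of \<open>W k0\<close>.\<close>
  define k0 where "k0 = (LEAST k. e k \<noteq> 0)"
  obtain k1 where k1: "k1 \<le> d" "e k1 \<noteq> 0"
    using e(1) by auto
  have k0: "e k0 \<noteq> 0" "k0 \<le> d"
    using LeastI[of "\<lambda>k. e k \<noteq> 0", OF k1(2)] Least_le[of "\<lambda>k. e k \<noteq> 0", OF k1(2)] k1(1)
    unfolding k0_def by auto
  have k0_min: "e k = 0" if "k < k0" for k
    using not_less_Least[of k "\<lambda>k. e k \<noteq> 0"] that unfolding k0_def by blast
  define n where "n = mat_scale_K (1 / e k0) (\<Sum>k\<le>d. mat_scale_K (e k) (W k))"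
  have "n \<in> N"
    unfolding n_def by (rule mat_scale_K.subspace_scale[OF NK sum_N])
  have "n = (\<Sum>k\<le>d. mat_scale_K (e k / e k0) (W k))"
    by (simp add: n_def mat_scale_K.scale_sum_right)
  also have "\<dots> = W k0 + (\<Sum>k\<in>{..d} - {k0}. mat_scale_K (e k / e k0) (W k))"
    using k0 by (simp add: sum.remove[of "{..d}" k0])
  finally have "W k0 - n = 0 - (\<Sum>k\<in>{..d} - {k0}. mat_scale_K (e k / e k0) (W k))"
    by simp
  also have "\<dots> \<in> max_pow_mat (Suc (j + k0))"
  proof (intro max_pow_mat_diff max_pow_mat_zero max_pow_mat_sum)
    fix k assume k: "k \<in> {..d} - {k0}"
    show "mat_scale_K (e k / e k0) (W k) \<in> max_pow_mat (Suc (j + k0))"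
    proof (cases "k < k0")
      case False
      with k have "W k \<in> max_pow_mat (Suc (j + k0))"
        by (intro max_pow_matD[OF W(1)]) auto
      then show ?thesis
        unfolding mat_scale_K_def by (intro max_pow_mat_scale[of _ 0]) auto
    qed (simp add: k0_min)
  qed
  finally show False
    using W(2)[OF k0(2) \<open>n \<in> N\<close>] by blast
qed

text \<open>Each layer \<mm>^i M / \<mm>^(i+1) M is spanned over the field by module generators of
  \<mm>^i M, because a coefficient matters there only through its constant term. Finitely many
  layers are collected.\<close>

lemma max_pow_mat_finite_span:
  "\<exists>S :: (('k::field, 's::finite) mfps^'n::finite^'m::finite) set. finite S \<and> S \<subseteq> max_pow_mat j \<and>
     (\<forall>X\<in>max_pow_mat j. \<exists>y\<in>mat_scale_K.span S. X - y \<in> max_pow_mat (j + h))"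
proof (induction h)
  case 0
  show ?case
    by (rule exI[of _ "{}"]) simp
next
  case (Suc h)
  then obtain S :: "(('k, 's) mfps^'n^'m) set" where S: "finite S" "S \<subseteq> max_pow_mat j"
    "\<And>X. X \<in> max_pow_mat j \<Longrightarrow> \<exists>y\<in>mat_scale_K.span S. X - y \<in> max_pow_mat (j + h)"
    by blast
  obtain T :: "(('k, 's) mfps^'n^'m) set" where T: "finite T" "max_pow_mat (j + h) = mat_scale.span T"
    using max_pow_mat_finitely_generated by blast
  have T_sub: "T \<subseteq> max_pow_mat (j + h)"
    unfolding T(2) by (rule mat_scale.span_superset)
  have "\<exists>y\<in>mat_scale_K.span (S \<union> T). X - y \<in> max_pow_mat (j + Suc h)" if "X \<in> max_pow_mat j" for X
  proof -
    obtain y where y: "y \<in> mat_scale_K.span S" "X - y \<in> max_pow_mat (j + h)"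
      using S(3) \<open>X \<in> max_pow_mat j\<close> by blast
    obtain u where u: "X - y = (\<Sum>t\<in>T. mat_scale (u t) t)"
      using y(2) unfolding T(2) mat_scale.span_finite[OF T(1)] by blast
    define z where "z = (\<Sum>t\<in>T. mat_scale_K (mcoeff (u t) (\<lambda>_. 0)) t)"
    have z: "z \<in> mat_scale_K.span (S \<union> T)"
      unfolding z_def by (intro mat_scale_K.span_sum mat_scale_K.span_scale mat_scale_K.span_base) simp
    have y': "y \<in> mat_scale_K.span (S \<union> T)"
      using y(1) mat_scale_K.span_mono[of S "S \<union> T"] by blast
    have "X - (y + z) = (\<Sum>t\<in>T. mat_scale (u t - mconst (mcoeff (u t) (\<lambda>_. 0))) t)"
      using u by (simp add: z_def mat_scale_K_def mat_scale.scale_left_diff_distrib sum_subtractf algebra_simps)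
    also have "\<dots> \<in> max_pow_mat (j + Suc h)"
      by (intro max_pow_mat_sum max_pow_mat_scale[OF minus_mconst_in_max_pow]) (use T_sub in auto)
    finally show ?thesis
      using mat_scale_K.span_add[OF y' z] by blast
  qed
  moreover have "S \<union> T \<subseteq> max_pow_mat j"
    using S(2) T_sub max_pow_matD[of _ "j + h" j] by auto
  ultimately show ?case
    using S(1) T(1) by (intro exI[of _ "S \<union> T"]) auto
qed

text \<open>A spanning set of least cardinality is linearly independent modulo \<open>N\<close>, and
  this gives the uniqueness of coefficients that \<open>has_quotient_dim\<close> asks for.\<close>

lemma has_quotient_dim_if_finite_span:
  fixes N V :: "(('k::field, 's::finite) mfps^'n::finite^'m::finite) set"
  assumes N: "mat_scale.subspace N"
    and span: "\<exists>S. finite S \<and> S \<subseteq> V \<and> (\<forall>X\<in>V. \<exists>y\<in>mat_scale_K.span S. X - y \<in> N)"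
  shows "\<exists>d. has_quotient_dim mat_scale_K V N d"
proof -
  note NK = subspace_mat_scale_K[OF N]
  define spans where "spans S \<longleftrightarrow> finite S \<and> S \<subseteq> V \<and> (\<forall>X\<in>V. \<exists>y\<in>mat_scale_K.span S. X - y \<in> N)" for S
  have "\<exists>S. spans S"
    using span by (simp add: spans_def)
  then obtain S where S: "spans S" "\<And>S'. spans S' \<Longrightarrow> card S \<le> card S'"
    using arg_min_natI[of spans] arg_min_nat_le[of spans] by metis
  have fin: "finite S" "S \<subseteq> V" and spanS: "\<And>X. X \<in> V \<Longrightarrow> \<exists>y\<in>mat_scale_K.span S. X - y \<in> N"
    using S(1) by (auto simp: spans_def)
  have indep: "c t = 0" if c: "(\<Sum>s\<in>S. mat_scale_K (c s) s) \<in> N" and t: "t \<in> S" for c t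
  proof (rule ccontr)
    assume ct: "c t \<noteq> 0"
    \<comment> \<open>Modulo \<open>N\<close> the element \<open>t\<close> equals
      \<open>- r\<close>, so \<open>S - {t}\<close> still spans.\<close>
    define r where "r = (\<Sum>s\<in>S - {t}. mat_scale_K (c s / c t) s)"
    have r: "r \<in> mat_scale_K.span (S - {t})"
      unfolding r_def by (intro mat_scale_K.span_sum mat_scale_K.span_scale mat_scale_K.span_base)
    have "mat_scale_K (1 / c t) (\<Sum>s\<in>S. mat_scale_K (c s) s) = t + r"
      using fin t ct by (simp add: r_def mat_scale_K.scale_right_distrib mat_scale_K.scale_sum_right sum.remove[of S t])
    then have tr: "t + r \<in> N"
      using mat_scale_K.subspace_scale[OF NK c, of "1 / c t"] by simp
    have "\<exists>y\<in>mat_scale_K.span (S - {t}). X - y \<in> N" if "X \<in> V" for X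
    proof -
      obtain y where y: "y \<in> mat_scale_K.span S" "X - y \<in> N"
        using spanS[OF \<open>X \<in> V\<close>] by blast
      then obtain k where k: "y - mat_scale_K k t \<in> mat_scale_K.span (S - {t})"
        using mat_scale_K.span_breakdown[OF t] by blast
      have "(X - y) + mat_scale_K k (t + r) \<in> N"
        by (intro mat_scale_K.subspace_add[OF NK] mat_scale_K.subspace_scale[OF NK] y tr)
      moreover have "(X - y) + mat_scale_K k (t + r) = X - ((y - mat_scale_K k t) - mat_scale_K k r)"
        by (simp add: mat_scale_K.scale_right_distrib algebra_simps)
      moreover have "(y - mat_scale_K k t) - mat_scale_K k r \<in> mat_scale_K.span (S - {t})"
        by (intro mat_scale_K.span_diff mat_scale_K.span_scale k r)
      ultimately show ?thesis
        by metis
    qed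
    then have "spans (S - {t})"
      using fin by (auto simp: spans_def)
    from S(2)[OF this] show False
      using card_Diff1_less[OF fin(1) t] by simp
  qed
  obtain b where b: "bij_betw b {..<card S} S"
    using ex_bij_betw_nat_finite[OF fin(1)] by (auto simp: atLeast0LessThan)
  have "has_quotient_dim mat_scale_K V N (card S)"
    unfolding has_quotient_dim_def quotient_module_def
  proof (intro exI[of _ b] conjI allI impI ballI)
    fix i assume "i < card S"
    then show "b i \<in> V"
      using b fin(2) bij_betwE by fastforce
  next
    fix C assume "C \<in> (\<lambda>v. v +o N) ` V"
    then obtain X where X: "X \<in> V" "C = X +o N"
      by blast
    show "\<exists>!c. (\<forall>i\<ge>card S. c i = 0) \<and> C = (\<Sum>i<card S. mat_scale_K (c i) (b i)) +o N"
      unfolding X(2) coset_eq_iff[OF N]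
    proof (rule ex_ex1I)
      obtain y where y: "y \<in> mat_scale_K.span S" "X - y \<in> N"
        using spanS[OF X(1)] by blast
      then obtain u where u: "y = (\<Sum>s\<in>S. mat_scale_K (u s) s)"
        unfolding mat_scale_K.span_finite[OF fin(1)] by blast
      have "y = (\<Sum>i<card S. mat_scale_K (u (b i)) (b i))"
        unfolding u by (rule sum.reindex_bij_betw[OF b, symmetric])
      also have "\<dots> = (\<Sum>i<card S. mat_scale_K (if i < card S then u (b i) else 0) (b i))"
        by (rule sum.cong) auto
      finally show "\<exists>c. (\<forall>i\<ge>card S. c i = 0) \<and> X - (\<Sum>i<card S. mat_scale_K (c i) (b i)) \<in> N"
        using y(2) by (intro exI[of _ "\<lambda>i. if i < card S then u (b i) else 0"]) auto
    next
      fix c c'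
      assume c: "(\<forall>i\<ge>card S. c i = 0) \<and> X - (\<Sum>i<card S. mat_scale_K (c i) (b i)) \<in> N"
        and c': "(\<forall>i\<ge>card S. c' i = 0) \<and> X - (\<Sum>i<card S. mat_scale_K (c' i) (b i)) \<in> N"
      \<comment> \<open>The inverse of the enumeration turns coefficients indexed by numbers into
        coefficients indexed by \<open>S\<close>, the form in which independence is stated.\<close>
      define g where "g = the_inv_into {..<card S} b"
      have g: "g (b i) = i" if "i < card S" for i
        using b that by (simp add: g_def the_inv_into_f_f bij_betw_def)
      have "(X - (\<Sum>i<card S. mat_scale_K (c' i) (b i))) - (X - (\<Sum>i<card S. mat_scale_K (c i) (b i))) \<in> N"
        by (rule mat_scale_K.subspace_diff[OF NK]) (use c c' in auto)
      also have "(X - (\<Sum>i<card S. mat_scale_K (c' i) (b i))) - (X - (\<Sum>i<card S. mat_scale_K (c i) (b i)))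
          = (\<Sum>i<card S. mat_scale_K (c (g (b i)) - c' (g (b i))) (b i))"
        by (simp add: g mat_scale_K.scale_left_diff_distrib sum_subtractf)
      also have "\<dots> = (\<Sum>s\<in>S. mat_scale_K (c (g s) - c' (g s)) s)"
        by (rule sum.reindex_bij_betw[OF b])
      finally have eq: "c (g s) = c' (g s)" if "s \<in> S" for s
        using indep[of "\<lambda>s. c (g s) - c' (g s)"] that by auto
      have "c i = c' i" for i
      proof (cases "i < card S")
        case True
        then show ?thesis
          using eq[of "b i"] g b bij_betwE by fastforce
      next
        case False
        then show ?thesis
          using c c' by auto
      qed
      then show "c = c'"
        by blast
    qed
  qed
  then show ?thesis
    by blast
qed

lemma has_quotient_dim_if_max_pow_mat_subset:
  fixes N :: "(('k::field, 's::finite) mfps^'n::finite^'m::finite) set"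
  assumes N: "mat_scale.subspace N" and sub: "max_pow_mat h \<subseteq> N"
  shows "\<exists>d. has_quotient_dim mat_scale_K (max_pow_mat j) N d"
proof (rule has_quotient_dim_if_finite_span[OF N])
  have sub': "X \<in> N" if "X \<in> max_pow_mat (j + h)" for X
    using sub max_pow_matD[OF that, of h] by auto
  obtain S :: "(('k, 's) mfps^'n^'m) set" where "finite S" "S \<subseteq> max_pow_mat j"
    "\<forall>X\<in>max_pow_mat j. \<exists>y\<in>mat_scale_K.span S. X - y \<in> max_pow_mat (j + h)"
    using max_pow_mat_finite_span[of j h] by (elim exE conjE) (rule that)
  then show "\<exists>S. finite S \<and> S \<subseteq> max_pow_mat j \<and> (\<forall>X\<in>max_pow_mat j. \<exists>y\<in>mat_scale_K.span S. X - y \<in> N)"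
    by (intro exI[of _ S] conjI) (auto dest!: sub' bspec)
qed


section \<open>Maximal minors\<close>

lemma presents_quotientD:
  assumes "presents_quotient t \<Theta> N"
  shows "\<And>r. (\<Sum>j<t. mat_scale (r j) (\<Theta> j)) \<in> N"
    and "X \<in> N \<Longrightarrow> \<exists>r. X = (\<Sum>j<t. mat_scale (r j) (\<Theta> j))"
  using assms unfolding presents_quotient_def by blast+

text \<open>Cramer's rule: the product of the chosen columns with their adjugate expresses
  \<open>det ?D\<close> times each basis matrix as a combination of columns, all of which lie in
  \<open>N\<close>.\<close>

lemma minors_ideal_annihilates:
  fixes \<Theta> :: "nat \<Rightarrow> 'r::comm_ring_1^'n::finite^'m::finite"
  assumes \<Theta>: "presents_quotient t \<Theta> N" and N: "mat_scale.subspace N"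
    and r: "r \<in> minors_ideal t \<Theta>"
  shows "mat_scale r X \<in> N"
proof -
  have "minors_ideal t \<Theta> \<subseteq> {r. \<forall>X. mat_scale r X \<in> N}"
    unfolding minors_ideal_def
  proof (rule module.span_minimal[OF module_mult])
    show "module.subspace (*) {r. \<forall>X. mat_scale r X \<in> N}"
    proof (rule module.subspaceI[OF module_mult])
      show "0 \<in> {r. \<forall>X. mat_scale r X \<in> N}"
        by (simp add: mat_scale.subspace_0[OF N])
    next
      fix x y assume "x \<in> {r. \<forall>X. mat_scale r X \<in> N}" "y \<in> {r. \<forall>X. mat_scale r X \<in> N}"
      then show "x + y \<in> {r. \<forall>X. mat_scale r X \<in> N}"
        by (simp add: mat_scale.scale_left_distrib mat_scale.subspace_add[OF N])
    next
      fix c x assume "x \<in> {r. \<forall>X. mat_scale r X \<in> N}"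
      then show "c * x \<in> {r. \<forall>X. mat_scale r X \<in> N}"
        by (simp add: mat_scale.subspace_scale[OF N] flip: mat_scale.scale_scale)
    qed
    show "{det (\<chi> p q. \<Theta> (\<sigma> q) $ fst p $ snd p) |\<sigma> :: 'm \<times> 'n \<Rightarrow> nat. inj \<sigma> \<and> range \<sigma> \<subseteq> {..<t}}
        \<subseteq> {r. \<forall>X. mat_scale r X \<in> N}"
    proof clarify
      fix \<sigma> :: "'m \<times> 'n \<Rightarrow> nat" and X :: "'r^'n^'m"
      assume \<sigma>: "range \<sigma> \<subseteq> {..<t}"
      let ?D = "\<chi> p q. \<Theta> (\<sigma> q) $ fst p $ snd p"
      obtain C where C: "?D ** C = mat_scale (det ?D) (mat 1)"
        using matrix_mult_adjugate by blast
      have "\<Theta> j \<in> N" if "j < t" for j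
      proof -
        have "\<Theta> j = (\<Sum>i<t. mat_scale (if i = j then 1 else 0) (\<Theta> i))"
          using that by (simp add: if_distrib[of "\<lambda>c. mat_scale c _"] cong: if_cong)
        then show ?thesis
          using presents_quotientD(1)[OF \<Theta>] by metis
      qed
      then have \<Theta>N: "\<Theta> (\<sigma> q) \<in> N" for q
        using \<sigma> by auto
      have "mat_scale (det ?D) (entry_unit i j) = (\<Sum>q\<in>UNIV. mat_scale (C $ q $ (i, j)) (\<Theta> (\<sigma> q)))"
        for i j
      proof -
        have "(\<Sum>q\<in>UNIV. mat_scale (C $ q $ (i, j)) (\<Theta> (\<sigma> q))) $ k $ l
            = mat_scale (det ?D) (entry_unit i j) $ k $ l" for k l
        proof -
          have "(\<Sum>q\<in>UNIV. mat_scale (C $ q $ (i, j)) (\<Theta> (\<sigma> q))) $ k $ l = (?D ** C) $ (k, l) $ (i, j)"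
            by (simp add: matrix_matrix_mult_def mult.commute)
          then show ?thesis
            by (simp add: C mat_def entry_unit_def)
        qed
        then show ?thesis
          by (simp add: vec_eq_iff)
      qed
      then have "mat_scale (det ?D) (entry_unit i j) \<in> N" for i j
        by (simp add: mat_scale.subspace_sum[OF N] mat_scale.subspace_scale[OF N] \<Theta>N)
      note entry = mat_scale.subspace_scale[OF N this]
      have "(\<Sum>i\<in>UNIV. \<Sum>j\<in>UNIV. mat_scale (X $ i $ j) (mat_scale (det ?D) (entry_unit i j))) \<in> N"
        by (intro mat_scale.subspace_sum[OF N] entry)
      also have "(\<Sum>i\<in>UNIV. \<Sum>j\<in>UNIV. mat_scale (X $ i $ j) (mat_scale (det ?D) (entry_unit i j)))
          = mat_scale (det ?D) (\<Sum>i\<in>UNIV. \<Sum>j\<in>UNIV. mat_scale (X $ i $ j) (entry_unit i j))"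
        by (simp add: mat_scale.scale_sum_right mult.commute)
      finally show "mat_scale (det ?D) X \<in> N"
        by (simp flip: matrix_entry_decomp)
    qed
  qed
  with r show ?thesis
    by blast
qed

text \<open>Multilinearity, expanding one row at a time. The choices \<open>f\<close> may repeat, so
  repeated rows are left to the hypothesis.\<close>

lemma det_rows_in_span:
  fixes \<theta> :: "nat \<Rightarrow> 'r::comm_ring_1^'p::finite"
  assumes I: "module.subspace (*) I" and J: "finite J"
    and minors: "\<And>f. range f \<subseteq> J \<Longrightarrow> det (\<chi> p. \<theta> (f p)) \<in> I"
  shows "det (\<chi> p. \<Sum>j\<in>J. r p j *s \<theta> j) \<in> I"
proof -
  \<comment> \<open>\<open>T\<close> is the set of rows still to be expanded; the other rows have
    already been chosen through \<open>f\<close>.\<close>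
  have "det (\<chi> p. if p \<in> T then \<Sum>j\<in>J. r p j *s \<theta> j else \<theta> (f p)) \<in> I"
    if "finite T" "\<And>p. p \<notin> T \<Longrightarrow> f p \<in> J" for T f
    using that
  proof (induction T arbitrary: f rule: finite_induct)
    case empty
    then show ?case
      using minors[of f] by auto
  next
    case (insert k T)
    have "det (\<chi> p. if p \<in> insert k T then \<Sum>j\<in>J. r p j *s \<theta> j else \<theta> (f p)) =
        det (\<chi> p. if p = k then \<Sum>j\<in>J. r k j *s \<theta> j
          else if p \<in> T then \<Sum>j\<in>J. r p j *s \<theta> j else \<theta> (f p))"
      by (rule arg_cong[of _ _ det]) (auto simp: vec_eq_iff)
    also have "\<dots> = (\<Sum>j\<in>J. det (\<chi> p. if p = k then r k j *s \<theta> j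
          else if p \<in> T then \<Sum>j\<in>J. r p j *s \<theta> j else \<theta> (f p)))"
      by (rule det_linear_row_sum[OF J])
    also have "\<dots> = (\<Sum>j\<in>J. r k j * det (\<chi> p. if p = k then \<theta> j
          else if p \<in> T then \<Sum>j\<in>J. r p j *s \<theta> j else \<theta> (f p)))"
      by (simp add: det_row_mul)
    also have "\<dots> = (\<Sum>j\<in>J. r k j * det (\<chi> p. if p \<in> T then \<Sum>j\<in>J. r p j *s \<theta> j
          else \<theta> ((f(k := j)) p)))"
    proof (rule sum.cong[OF refl])
      fix j
      have "(\<chi> p. if p = k then \<theta> j else if p \<in> T then \<Sum>j\<in>J. r p j *s \<theta> j else \<theta> (f p)) =
          (\<chi> p. if p \<in> T then \<Sum>j\<in>J. r p j *s \<theta> j else \<theta> ((f(k := j)) p))"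
        using insert.hyps by (auto simp: vec_eq_iff)
      then show "r k j * det (\<chi> p. if p = k then \<theta> j
            else if p \<in> T then \<Sum>j\<in>J. r p j *s \<theta> j else \<theta> (f p)) =
          r k j * det (\<chi> p. if p \<in> T then \<Sum>j\<in>J. r p j *s \<theta> j else \<theta> ((f(k := j)) p))"
        by simp
    qed
    also have "\<dots> \<in> I"
      by (intro module.subspace_sum[OF module_mult I] module.subspace_scale[OF module_mult I] insert.IH)
         (use insert.prems in auto)
    finally show ?case .
  qed
  \<comment> \<open>For \<open>T = UNIV\<close> no row has been chosen, and
    \<open>\<lambda>_. 0\<close> is a mere placeholder.\<close>
  from this[of UNIV "\<lambda>_. 0"] show ?thesis
    by simp
qed

text \<open>The scalar matrix \<open>x\<close> has rows in the span of the transposed columns of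
  \<open>\<Theta>\<close>. Expanding its determinant gives maximal minors for injective choices of
  columns and zero for all others.\<close>

lemma power_in_minors_ideal:
  fixes \<Theta> :: "nat \<Rightarrow> 'r::comm_ring_1^'n::finite^'m::finite"
  assumes \<Theta>: "presents_quotient t \<Theta> N" and x: "\<And>i j. mat_scale x (entry_unit i j) \<in> N"
  shows "x ^ CARD('m \<times> 'n) \<in> minors_ideal t \<Theta>"
proof -
  define \<theta> :: "nat \<Rightarrow> 'r^('m \<times> 'n)" where "\<theta> j = (\<chi> q. \<Theta> j $ fst q $ snd q)" for j
  have "\<exists>r. mat_scale x (entry_unit (fst p) (snd p)) = (\<Sum>j<t. mat_scale (r j) (\<Theta> j))" for p
    by (rule presents_quotientD(2)[OF \<Theta> x])
  then obtain r where r: "\<And>p. mat_scale x (entry_unit (fst p) (snd p)) = (\<Sum>j<t. mat_scale (r p j) (\<Theta> j))"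
    by metis
  have I: "module.subspace (*) (minors_ideal t \<Theta>)"
    unfolding minors_ideal_def by (rule module.subspace_span[OF module_mult])
  have minors: "det (\<chi> p. \<theta> (f p)) \<in> minors_ideal t \<Theta>" if "range f \<subseteq> {..<t}" for f
  proof (cases "inj f")
    case True
    have "det (\<chi> p. \<theta> (f p)) = det (transpose (\<chi> p. \<theta> (f p)))"
      by (simp add: det_transpose)
    also have "transpose (\<chi> p. \<theta> (f p)) = (\<chi> p q. \<Theta> (f q) $ fst p $ snd p)"
      by (simp add: transpose_def \<theta>_def vec_eq_iff)
    finally show ?thesis
      unfolding minors_ideal_def using True that by (auto intro!: module.span_base[OF module_mult])
  next
    case False
    then obtain p q where "p \<noteq> q" "f p = f q"
      by (auto simp: inj_def)
    then have "det (\<chi> p. \<theta> (f p)) = 0"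
      by (intro det_identical_rows[of p q]) (auto simp: row_def)
    then show ?thesis
      by (simp add: module.subspace_0[OF module_mult I])
  qed
  have "mat_scale x (mat 1) = (\<chi> p. \<Sum>j<t. r p j *s \<theta> j)"
  proof -
    have "mat_scale x (mat 1) $ p $ q = (\<chi> p. \<Sum>j<t. r p j *s \<theta> j) $ p $ q" for p q
    proof -
      have "mat_scale x (mat 1) $ p $ q = mat_scale x (entry_unit (fst p) (snd p)) $ fst q $ snd q"
        by (auto simp: mat_def entry_unit_def prod_eq_iff)
      then show ?thesis
        unfolding r by (simp add: \<theta>_def)
    qed
    then show ?thesis
      by (simp add: vec_eq_iff)
  qed
  moreover have "det (mat_scale x (mat 1) :: 'r^('m \<times> 'n)^('m \<times> 'n)) = x ^ CARD('m \<times> 'n)"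
    by (subst det_diagonal) (simp_all add: mat_def)
  moreover have "det (\<chi> p. \<Sum>j<t. r p j *s \<theta> j) \<in> minors_ideal t \<Theta>"
    by (rule det_rows_in_span[OF I finite_lessThan minors])
  ultimately show ?thesis
    by simp
qed


section \<open>Prime ideals\<close>

lemma prime_idealD:
  assumes "prime_ideal P"
  shows "module.subspace (*) P" "1 \<notin> P" "a \<notin> P \<Longrightarrow> b \<notin> P \<Longrightarrow> a * b \<notin> P"
proof -
  show sub: "module.subspace (*) P"
    using assms by (simp add: prime_ideal_def)
  show "1 \<notin> P"
    using assms module.subspace_scale[OF module_mult sub, of 1] by (auto simp: prime_ideal_def)
  show "a \<notin> P \<Longrightarrow> b \<notin> P \<Longrightarrow> a * b \<notin> P"
    using assms by (auto simp: prime_ideal_def)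
qed

lemma prime_ideal_power: "prime_ideal P \<Longrightarrow> a \<notin> P \<Longrightarrow> a ^ n \<notin> P"
  by (induction n) (auto simp: prime_idealD)

lemma prime_ideal_prod: "prime_ideal P \<Longrightarrow> (\<And>i. i \<in> I \<Longrightarrow> f i \<notin> P) \<Longrightarrow> prod f I \<notin> P"
  by (induction I rule: infinite_finite_induct) (auto simp: prime_idealD)

text \<open>An ideal that is maximal among those containing \<open>I\<close> and avoiding all powers
  of \<open>x\<close> is prime; Zorn's lemma provides one.\<close>

lemma exists_prime_ideal_avoiding_powers:
  fixes I :: "'r::comm_ring_1 set"
  assumes I: "module.subspace (*) I" and x: "\<And>n. x ^ n \<notin> I"
  shows "\<exists>P. prime_ideal P \<and> I \<subseteq> P \<and> x \<notin> P"
proof -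
  define \<A> where "\<A> = {J. module.subspace (*) J \<and> I \<subseteq> J \<and> (\<forall>n. x ^ n \<notin> J)}"
  have "\<exists>M\<in>\<A>. \<forall>X\<in>\<A>. M \<subseteq> X \<longrightarrow> X = M"
  proof (rule subset_Zorn_nonempty)
    show "\<A> \<noteq> {}"
      using I x by (auto simp: \<A>_def)
    fix \<C> assume "\<C> \<noteq> {}" and chain: "subset.chain \<A> \<C>"
    then obtain J0 where J0: "J0 \<in> \<C>"
      by blast
    have \<C>: "J \<in> \<C> \<Longrightarrow> J \<in> \<A>" for J
      using chain by (auto simp: subset.chain_def)
    have "module.subspace (*) (\<Union>\<C>)"
    proof (rule module.subspaceI[OF module_mult])
      show "0 \<in> \<Union>\<C>"
        using J0 \<C> module.subspace_0[OF module_mult] by (fastforce simp: \<A>_def)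
    next
      fix a b assume "a \<in> \<Union>\<C>" "b \<in> \<Union>\<C>"
      then obtain J K where "J \<in> \<C>" "K \<in> \<C>" "a \<in> J" "b \<in> K"
        by blast
      then obtain L where "L \<in> \<C>" "a \<in> L" "b \<in> L"
        using chain unfolding subset.chain_def by blast
      then show "a + b \<in> \<Union>\<C>"
        using \<C>[of L] module.subspace_add[OF module_mult] by (auto simp: \<A>_def)
    next
      fix c a assume "a \<in> \<Union>\<C>"
      then show "c * a \<in> \<Union>\<C>"
        using \<C> module.subspace_scale[OF module_mult] by (fastforce simp: \<A>_def)
    qed
    then show "\<Union>\<C> \<in> \<A>"
      using J0 \<C> by (fastforce simp: \<A>_def)
  qed
  then obtain P where P: "P \<in> \<A>" and max: "\<And>X. X \<in> \<A> \<Longrightarrow> P \<subseteq> X \<Longrightarrow> X = P"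
    by blast
  have sub: "module.subspace (*) P" and "I \<subseteq> P" and xP: "\<And>n. x ^ n \<notin> P"
    using P by (auto simp: \<A>_def)
  \<comment> \<open>By maximality, enlarging \<open>P\<close> by an element outside it captures a
    power of \<open>x\<close>.\<close>
  have power: "\<exists>n p r. p \<in> P \<and> x ^ n = p + r * a" if "a \<notin> P" for a
  proof (rule ccontr)
    assume none: "\<not> ?thesis"
    define J where "J = {p + r * a |p r. p \<in> P}"
    have "module.subspace (*) J"
    proof (rule module.subspaceI[OF module_mult])
      show "0 \<in> J"
        using module.subspace_0[OF module_mult sub] unfolding J_def by (force intro: exI[of _ 0])
    next
      fix y z assume "y \<in> J" "z \<in> J"
      then obtain p r p' r' where "y = p + r * a" "z = p' + r' * a" "p \<in> P" "p' \<in> P"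
        by (auto simp: J_def)
      then show "y + z \<in> J"
        unfolding J_def using module.subspace_add[OF module_mult sub]
        by - (rule CollectI, rule exI[of _ "p + p'"], rule exI[of _ "r + r'"],
            simp add: algebra_simps)
    next
      fix c y assume "y \<in> J"
      then obtain p r where "y = p + r * a" "p \<in> P"
        by (auto simp: J_def)
      then show "c * y \<in> J"
        unfolding J_def using module.subspace_scale[OF module_mult sub \<open>p \<in> P\<close>, of c]
        by - (rule CollectI, rule exI[of _ "c * p"], rule exI[of _ "c * r"],
            simp add: algebra_simps)
    qed
    moreover have "P \<subseteq> J"
      unfolding J_def by (force intro: exI[of _ 0])
    ultimately have "J = P"
      using none \<open>I \<subseteq> P\<close> by (intro max) (auto simp: \<A>_def J_def)
    moreover have "a \<in> J"
      unfolding J_def using module.subspace_0[OF module_mult sub] by (force intro: exI[of _ 0] exI[of _ 1])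
    ultimately show False
      using that by blast
  qed
  have "a \<in> P \<or> b \<in> P" if "a * b \<in> P" for a b
  proof (rule ccontr)
    assume "\<not> (a \<in> P \<or> b \<in> P)"
    then obtain n p r n' p' r' where "p \<in> P" "p' \<in> P" "x ^ n = p + r * a" "x ^ n' = p' + r' * b"
      using power by metis
    \<comment> \<open>Multiplying the two captured powers leaves only multiples of \<open>p\<close>,
      \<open>p'\<close> and \<open>a * b\<close>.\<close>
    then have "x ^ (n + n') = (p' + r' * b) * p + (r * a * p' + r * r' * (a * b))"
      by (simp add: power_add algebra_simps)
    also have "\<dots> \<in> P"
      by (intro module.subspace_add[OF module_mult sub]
          module.subspace_scale[OF module_mult sub \<open>p \<in> P\<close>]
          module.subspace_scale[OF module_mult sub \<open>p' \<in> P\<close>]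
          module.subspace_scale[OF module_mult sub \<open>a * b \<in> P\<close>])
    finally show False
      using xP by blast
  qed
  moreover have "P \<noteq> UNIV"
    using xP by blast
  ultimately have "prime_ideal P"
    using sub by (simp add: prime_ideal_def)
  then show ?thesis
    using \<open>I \<subseteq> P\<close> xP[of 1] by auto
qed

text \<open>The variables generate \<mm>, and every series outside \<mm> is a unit, which a prime
  ideal cannot contain.\<close>

lemma prime_ideal_eq_max_ideal:
  fixes P :: "('k::field, 's::finite) mfps set"
  assumes "prime_ideal P" "\<And>v. mvar v \<in> P"
  shows "P = max_ideal"
proof
  note sub = prime_idealD(1)[OF assms(1)]
  show "max_ideal \<subseteq> P"
  proof
    fix f :: "('k, 's) mfps" assume "f \<in> max_ideal"
    then obtain g where "f = (\<Sum>v\<in>UNIV. mvar v * g v)"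
      using max_pow_Suc_decomp[of f 0] by (auto simp: max_pow_Suc_0)
    then show "f \<in> P"
      using assms(2) by (auto intro!: module.subspace_sum[OF module_mult sub]
          module.subspace_scale[OF module_mult sub] simp: mult.commute[of "mvar _"])
  qed
  show "P \<subseteq> max_ideal"
  proof
    fix f assume f: "f \<in> P"
    show "f \<in> max_ideal"
    proof (rule ccontr)
      assume "f \<notin> max_ideal"
      then obtain g where "f * g = 1"
        using mfps_unit_iff[of f] by (auto simp: max_pow_Suc_0)
      then have "1 \<in> P"
        using module.subspace_scale[OF module_mult sub f, of g] by (simp add: mult.commute)
      then show False
        using prime_idealD(2)[OF assms(1)] by blast
    qed
  qed
qed

section \<open>Recovering powers of the maximal ideal from powers of variables\<close>

lemma max_pow_subset_span_monom: "max_pow k \<subseteq> module.span (*) {mmonom b |b. mdeg b = k}"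
proof (induction k)
  case 0
  have "mmonom (\<lambda>_. 0) = (1 :: ('a, 'b) mfps)"
    by (rule mfps_eqI) simp
  then have "f * 1 \<in> module.span (*) {mmonom b |b. mdeg b = 0}" for f :: "('a, 'b) mfps"
    by (intro module.span_scale[OF module_mult] module.span_base[OF module_mult]) (auto simp: mdeg_eq_0_iff)
  then show ?case
    by auto
next
  case (Suc k)
  show ?case
  proof
    fix f :: "('a, 'b) mfps" assume "f \<in> max_pow (Suc k)"
    then obtain g where g: "\<And>v. g v \<in> max_pow k" "f = (\<Sum>v\<in>UNIV. mvar v * g v)"
      using max_pow_Suc_decomp by blast
    let ?S = "module.span (*) {mmonom b |b. mdeg b = Suc k} :: ('a, 'b) mfps set"
    have "module.span (*) {mmonom b |b. mdeg b = k} \<subseteq> {h. mvar v * h \<in> ?S}" for v :: 'b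
    proof (rule module.span_minimal[OF module_mult])
      show "{mmonom b |b. mdeg b = k} \<subseteq> {h. mvar v * h \<in> ?S}"
      proof clarify
        fix b :: "'b \<Rightarrow> nat" assume b: "k = mdeg b"
        have "mdeg (\<lambda>i. ((\<lambda>_. 0)(v := 1)) i + b i) = Suc (mdeg b)"
          using mdeg_single[of v 1] by (simp add: mdeg_def sum.distrib)
        then show "mvar v * mmonom b \<in> module.span (*) {mmonom c |c. mdeg c = Suc (mdeg b)}"
          unfolding mvar_def monom_mult by (intro module.span_base[OF module_mult]) blast
      qed
      have scale: "c * h \<in> ?S" if "h \<in> ?S" for c h
        using that by (rule module.span_scale[OF module_mult])
      have "mvar v * (c * h) \<in> ?S" if "mvar v * h \<in> ?S" for c h
        using scale[OF that, of c] by (simp add: mult.left_commute)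
      then show "module.subspace (*) {h. mvar v * h \<in> ?S}"
        by (intro module.subspaceI[OF module_mult])
           (auto simp: distrib_left module.span_zero[OF module_mult] module.span_add[OF module_mult])
    qed
    then show "f \<in> module.span (*) {mmonom b |b. mdeg b = Suc k}"
      unfolding g(2) using g(1) Suc by (intro module.span_sum[OF module_mult]) blast
  qed
qed

lemma var_power: "mvar v ^ n = mmonom ((\<lambda>_. 0)(v := n))"
proof (induction n)
  case 0
  show ?case
    by (rule mfps_eqI) (auto simp: fun_eq_iff)
next
  case (Suc n)
  have "(\<lambda>i. ((\<lambda>_. 0)(v := 1)) i + ((\<lambda>_. 0)(v := n)) i) = (\<lambda>_. 0)(v := Suc n)"
    by auto
  then show ?case
    unfolding power_Suc Suc.IH unfolding mvar_def monom_mult by (rule arg_cong)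
qed

text \<open>Pigeonhole: a monomial whose degree exceeds the sum of the exponents \<open>n v\<close>
  is divisible by some \<open>mvar v ^ n v\<close>.\<close>

lemma max_pow_subset_if_var_powers:
  fixes I :: "('k::field, 's::finite) mfps set"
  assumes I: "module.subspace (*) I" and pow: "\<And>v. \<exists>n. mvar v ^ n \<in> I"
  shows "\<exists>k>0. max_pow k \<subseteq> I"
proof -
  obtain n where n: "\<And>v. mvar v ^ n v \<in> I"
    using pow by metis
  define k where "k = Suc (\<Sum>v\<in>UNIV. n v)"
  have "mmonom b \<in> I" if "mdeg b = k" for b
  proof -
    have "\<exists>v. n v \<le> b v"
    proof (rule ccontr)
      assume "\<nexists>v. n v \<le> b v"
      then have "mdeg b \<le> (\<Sum>v\<in>UNIV. n v)"
        unfolding mdeg_def by (intro sum_mono) (simp add: not_le less_imp_le)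
      then show False
        using that by (simp add: k_def)
    qed
    then obtain v where v: "n v \<le> b v"
      by blast
    have "(\<lambda>i. (b(v := b v - n v)) i + ((\<lambda>_. 0)(v := n v)) i) = b"
      using v by auto
    then have eq: "mmonom b = mmonom (b(v := b v - n v)) * mvar v ^ n v"
      unfolding var_power monom_mult by simp
    show ?thesis
      by (subst eq) (rule module.subspace_scale[OF module_mult I n])
  qed
  then have "module.span (*) {mmonom b |b. mdeg b = k} \<subseteq> I"
    by (intro module.span_minimal[OF module_mult _ I]) auto
  then show ?thesis
    using max_pow_subset_span_monom[of k] by (intro exI[of _ k]) (auto simp: k_def)
qed

lemma max_pow_subset_if_V_ideal_subset:
  fixes I :: "('k::field, 's::finite) mfps set"
  assumes I: "module.subspace (*) I" and V: "V_ideal I \<subseteq> {max_ideal}"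
  shows "\<exists>k>0. max_pow k \<subseteq> I"
proof (rule max_pow_subset_if_var_powers[OF I], rule ccontr)
  fix v assume "\<nexists>n. mvar v ^ n \<in> I"
  then obtain P where "prime_ideal P" "I \<subseteq> P" "mvar v \<notin> P"
    using exists_prime_ideal_avoiding_powers[OF I] by blast
  then show False
    using V var_in_max_pow[of v] by (auto simp: V_ideal_def max_pow_Suc_0)
qed


section \<open>Localization\<close>

text \<open>For a quotient the carrier consists of cosets inside the type of all sets, where the
  module laws hold on cosets only. Hence associativity is assumed just on \<open>Q\<close>.\<close>

lemma equiv_fraction_rel:
  assumes P: "prime_ideal P"
    and scale: "\<And>a b x. x \<in> Q \<Longrightarrow> smul a (smul b x) = smul (a * b) x"
  shows "equiv (Q \<times> - P) (fraction_rel smul Q P)"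
proof (rule equivI)
  show "fraction_rel smul Q P \<subseteq> (Q \<times> - P) \<times> (Q \<times> - P)"
    by (auto simp: fraction_rel_def)
  show "refl_on (Q \<times> - P) (fraction_rel smul Q P)"
    using prime_idealD(2)[OF P] by (auto simp: refl_on_def fraction_rel_def)
  show "sym (fraction_rel smul Q P)"
    unfolding sym_def fraction_rel_def by fastforce
  show "trans (fraction_rel smul Q P)"
  proof (rule transI)
    fix s1 s2 s3
    assume "(s1, s2) \<in> fraction_rel smul Q P" "(s2, s3) \<in> fraction_rel smul Q P"
    then obtain x u y v z t w w' where s: "s1 = (x, u)" "s2 = (y, v)" "s3 = (z, t)"
      and Q: "x \<in> Q" "y \<in> Q" "z \<in> Q" and nP: "u \<notin> P" "v \<notin> P" "t \<notin> P" "w \<notin> P" "w' \<notin> P"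
      and eq: "smul w (smul v x) = smul w (smul u y)" "smul w' (smul t y) = smul w' (smul v z)"
      unfolding fraction_rel_def by auto
    have eq1: "smul (w * v) x = smul (w * u) y" and eq2: "smul (w' * t) y = smul (w' * v) z"
      using eq by (simp_all add: scale Q)
    \<comment> \<open>The multiplier contains \<open>v\<close> as well, because the middle fraction
      has to be cleared of its denominator.\<close>
    have "smul (w * w' * v) (smul t x) = smul (w' * t) (smul (w * v) x)"
      by (simp add: scale Q mult_ac)
    also have "\<dots> = smul (w * u) (smul (w' * t) y)"
      unfolding eq1 by (simp add: scale Q mult_ac)
    also have "\<dots> = smul (w * w' * v) (smul u z)"
      unfolding eq2 by (simp add: scale Q mult_ac)
    finally have "smul (w * w' * v) (smul t x) = smul (w * w' * v) (smul u z)" .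
    moreover have "w * w' * v \<notin> P"
      by (intro prime_idealD(3)[OF P] nP)
    ultimately show "(s1, s3) \<in> fraction_rel smul Q P"
      using Q nP unfolding s fraction_rel_def by (auto intro!: exI[of _ "w * w' * v"])
  qed
qed

lemma fraction_eq_iff:
  assumes "prime_ideal P" "\<And>a b x. x \<in> Q \<Longrightarrow> smul a (smul b x) = smul (a * b) x"
    and "x \<in> Q" "y \<in> Q" "u \<notin> P" "v \<notin> P"
  shows "fraction smul Q P x u = fraction smul Q P y v \<longleftrightarrow>
    (\<exists>w. w \<notin> P \<and> smul w (smul v x) = smul w (smul u y))"
proof -
  have "fraction smul Q P x u = fraction smul Q P y v \<longleftrightarrow> ((x, u), (y, v)) \<in> fraction_rel smul Q P"
    unfolding fraction_def using assms(3-6)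
    by (intro eq_equiv_class_iff[OF equiv_fraction_rel[OF assms(1,2)]]) auto
  then show ?thesis
    using assms(3-6) by (auto simp: fraction_rel_def)
qed

text \<open>The vanishing of the localized quotient, phrased on representatives. Both localization
  conditions are reduced to it, so no isomorphism between the two localizations is
  constructed.\<close>

definition torsion_mod_at ::
  "('r::comm_ring_1^'n^'m) set \<Rightarrow> 'r set \<Rightarrow> bool" where
  "torsion_mod_at N P \<longleftrightarrow> (\<forall>X. \<exists>w. w \<notin> P \<and> mat_scale w X \<in> N)"

text \<open>An equality of fractions \<open>X/1 = Y/u\<close> puts a multiple of \<open>X\<close>
  into \<open>N\<close>; conversely \<open>X/u = (wX)/(uw)\<close> as soon as \<open>wX\<close> lies
  in \<open>N\<close>.\<close>

lemma localization_eq_sub_localization_iff: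
  fixes N :: "('r::comm_ring_1^'n^'m) set"
  assumes P: "prime_ideal P" and N: "mat_scale.subspace N"
  shows "localization mat_scale UNIV P = sub_localization mat_scale UNIV N P \<longleftrightarrow> torsion_mod_at N P"
proof
  note frac = fraction_eq_iff[OF P, of UNIV "mat_scale :: 'r \<Rightarrow> 'r^'n^'m \<Rightarrow> _", simplified]
  note nP = prime_idealD(2,3)[OF P]
  {
    assume eq: "localization mat_scale UNIV P = sub_localization mat_scale UNIV N P"
    show "torsion_mod_at N P"
      unfolding torsion_mod_at_def
    proof
      fix X :: "'r^'n^'m"
      have "fraction mat_scale UNIV P X 1 \<in> sub_localization mat_scale UNIV N P"
        unfolding eq[symmetric] localization_def using nP(1) by blast
      then obtain Y u where Y: "Y \<in> N" "u \<notin> P"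
        "fraction mat_scale UNIV P X 1 = fraction mat_scale UNIV P Y u"
        unfolding sub_localization_def by blast
      then obtain w where w: "w \<notin> P" "mat_scale (w * u) X = mat_scale w Y"
        using frac[of 1 u X Y] nP(1) by auto
      have "mat_scale (w * u) X \<in> N"
        unfolding w(2) by (rule mat_scale.subspace_scale[OF N Y(1)])
      then show "\<exists>w. w \<notin> P \<and> mat_scale w X \<in> N"
        using nP(2)[OF w(1) Y(2)] by blast
    qed
  }
  {
    assume tors: "torsion_mod_at N P"
    show "localization mat_scale UNIV P = sub_localization mat_scale UNIV N P"
    proof
      show "sub_localization mat_scale UNIV N P \<subseteq> localization mat_scale UNIV P"
        unfolding localization_def sub_localization_def by blast
      show "localization mat_scale UNIV P \<subseteq> sub_localization mat_scale UNIV N P"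
      proof
        fix F assume "F \<in> localization (mat_scale :: 'r \<Rightarrow> 'r^'n^'m \<Rightarrow> _) UNIV P"
        then obtain X u where F: "F = fraction mat_scale UNIV P X u" "u \<notin> P"
          unfolding localization_def by blast
        obtain w where w: "w \<notin> P" "mat_scale w X \<in> N"
          using tors unfolding torsion_mod_at_def by blast
        have "F = fraction mat_scale UNIV P (mat_scale w X) (u * w)"
          unfolding F(1) using F(2) w(1) nP by (subst frac) (auto simp: mult_ac)
        then show "F \<in> sub_localization mat_scale UNIV N P"
          unfolding sub_localization_def using F(2) w nP(2) by blast
      qed
    qed
  }
qed

lemma quotient_scale_coset:
  fixes N :: "('r::comm_ring_1^'n^'m) set"
  assumes N: "mat_scale.subspace N"
  shows "quotient_scale mat_scale N r (X +o N) = mat_scale r X +o N"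
proof (intro equalityI subsetI)
  fix Z assume "Z \<in> quotient_scale mat_scale N r (X +o N)"
  then obtain n n' where "n \<in> N" "n' \<in> N" "Z = mat_scale r (X + n) + n'"
    by (auto simp: quotient_scale_def elt_set_plus_def elim!: set_plus_elim)
  then show "Z \<in> mat_scale r X +o N"
    by (auto simp: elt_set_plus_def mat_scale.scale_right_distrib add.assoc
        intro!: bexI[of _ "mat_scale r n + n'"] mat_scale.subspace_add[OF N] mat_scale.subspace_scale[OF N])
next
  fix Z assume "Z \<in> mat_scale r X +o N"
  then obtain n where "n \<in> N" "Z = mat_scale r X + n"
    by (auto simp: elt_set_plus_def)
  moreover have "X \<in> X +o N"
    using mat_scale.subspace_0[OF N] by (auto simp: elt_set_plus_def)
  ultimately show "Z \<in> quotient_scale mat_scale N r (X +o N)"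
    unfolding quotient_scale_def by (auto intro!: set_plus_intro)
qed

text \<open>A fraction of a coset is zero iff an element outside \<open>P\<close> kills the coset,
  whatever the denominator.\<close>

lemma localization_quotient_trivial_iff:
  fixes N :: "('r::comm_ring_1^'n^'m) set"
  assumes P: "prime_ideal P" and N: "mat_scale.subspace N"
  shows "localization (quotient_scale mat_scale N) (quotient_module UNIV N) P =
      {fraction (quotient_scale mat_scale N) (quotient_module UNIV N) P N 1} \<longleftrightarrow> torsion_mod_at N P"
proof -
  let ?s = "quotient_scale mat_scale N" and ?Q = "quotient_module UNIV N"
  note nP = prime_idealD(2,3)[OF P]
  have coset: "X +o N \<in> ?Q" for X
    by (simp add: quotient_module_def)
  have zero: "N = 0 +o N"
    by (simp add: elt_set_plus_def)
  have assoc: "?s a (?s b C) = ?s (a * b) C" if "C \<in> ?Q" for a b C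
    using that by (auto simp: quotient_module_def quotient_scale_coset[OF N])
  have frac: "fraction ?s ?Q P C u = fraction ?s ?Q P D v \<longleftrightarrow>
      (\<exists>w. w \<notin> P \<and> ?s w (?s v C) = ?s w (?s u D))"
    if "C \<in> ?Q" "D \<in> ?Q" "u \<notin> P" "v \<notin> P" for C D u v
    by (rule fraction_eq_iff[OF P assoc that])
  have "fraction ?s ?Q P (X +o N) u = fraction ?s ?Q P N 1 \<longleftrightarrow> (\<exists>w. w \<notin> P \<and> mat_scale w X \<in> N)"
    if "u \<notin> P" for X u
  proof -
    have "fraction ?s ?Q P (X +o N) u = fraction ?s ?Q P (0 +o N) 1 \<longleftrightarrow>
        (\<exists>w. w \<notin> P \<and> mat_scale w X \<in> N)"
      using frac[OF coset[of X] coset[of 0] that nP(1)]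
      unfolding quotient_scale_coset[OF N] coset_eq_iff[OF N] by simp
    then show ?thesis
      by (simp flip: zero)
  qed
  note triv = this
  have "N \<in> ?Q"
    using coset[of 0] by (simp flip: zero)
  then have "fraction ?s ?Q P N 1 \<in> localization ?s ?Q P"
    unfolding localization_def using nP(1) by blast
  then have "localization ?s ?Q P = {fraction ?s ?Q P N 1} \<longleftrightarrow>
      (\<forall>F\<in>localization ?s ?Q P. F = fraction ?s ?Q P N 1)"
    by blast
  also have "\<dots> \<longleftrightarrow> (\<forall>X u. u \<notin> P \<longrightarrow> fraction ?s ?Q P (X +o N) u = fraction ?s ?Q P N 1)"
  proof (intro iffI allI impI ballI)
    fix X u assume "\<forall>F\<in>localization ?s ?Q P. F = fraction ?s ?Q P N 1" "u \<notin> P"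
    then show "fraction ?s ?Q P (X +o N) u = fraction ?s ?Q P N 1"
      using coset[of X] unfolding localization_def by blast
  next
    fix F assume "\<forall>X u. u \<notin> P \<longrightarrow> fraction ?s ?Q P (X +o N) u = fraction ?s ?Q P N 1"
      and "F \<in> localization ?s ?Q P"
    then show "F = fraction ?s ?Q P N 1"
      unfolding localization_def quotient_module_def by blast
  qed
  also have "\<dots> \<longleftrightarrow> torsion_mod_at N P"
    unfolding torsion_mod_at_def using triv nP(1) by blast
  finally show ?thesis .
qed

lemma quotient_support_subset_iff:
  fixes N :: "('r::comm_ring_1^'n^'m) set"
  assumes "mat_scale.subspace N"
  shows "quotient_support mat_scale UNIV N \<subseteq> {Q} \<longleftrightarrow> (\<forall>P. prime_ideal P \<and> P \<noteq> Q \<longrightarrow> torsion_mod_at N P)"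
  unfolding quotient_support_def using localization_quotient_trivial_iff[OF _ assms] by auto

text \<open>A prime other than \<mm> misses some variable, and the \<open>h\<close>-th power of that
  variable carries every matrix into \<open>N\<close>.\<close>

lemma torsion_mod_at_if_max_pow_mat_subset:
  fixes N :: "(('k::field, 's::finite) mfps^'n::finite^'m::finite) set"
  assumes sub: "max_pow_mat h \<subseteq> N" and P: "prime_ideal P" "P \<noteq> max_ideal"
  shows "torsion_mod_at N P"
proof -
  obtain v where "mvar v \<notin> P"
    using prime_ideal_eq_max_ideal P by blast
  then have "mvar v ^ h \<notin> P"
    by (rule prime_ideal_power[OF P(1)])
  moreover have "mat_scale (mvar v ^ h) X \<in> N" for X
    using sub max_pow_mat_scale[OF max_pow_power[OF var_in_max_pow], of X 0 h h v] by auto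
  ultimately show ?thesis
    unfolding torsion_mod_at_def by blast
qed

text \<open>\<open>J\<close> is the annihilator of the quotient, tested on basis matrices. The
  quotient being finitely generated, one product of multipliers works for all entries, so no prime
  other than \<mm> contains \<open>J\<close>.\<close>

lemma max_pow_mat_subset_if_torsion_mod_at:
  fixes N :: "(('k::field, 's::finite) mfps^'n::finite^'m::finite) set"
  assumes N: "mat_scale.subspace N"
    and tors: "\<And>P. prime_ideal P \<Longrightarrow> P \<noteq> max_ideal \<Longrightarrow> torsion_mod_at N P"
  shows "\<exists>h>0. max_pow_mat h \<subseteq> N"
proof -
  define J where "J = {r. \<forall>i j. mat_scale r (entry_unit i j :: ('k, 's) mfps^'n^'m) \<in> N}"
  have J: "module.subspace (*) J"
    unfolding J_def
    by (rule module.subspaceI[OF module_mult])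
       (auto simp: mat_scale.scale_left_distrib mat_scale.subspace_0[OF N] mat_scale.subspace_add[OF N]
         mat_scale.subspace_scale[OF N] simp flip: mat_scale.scale_scale)
  have "V_ideal J \<subseteq> {max_ideal}"
  proof (rule ccontr)
    assume "\<not> V_ideal J \<subseteq> {max_ideal}"
    then obtain P where P: "prime_ideal P" "J \<subseteq> P" "P \<noteq> max_ideal"
      by (auto simp: V_ideal_def)
    have "\<exists>w. w \<notin> P \<and> mat_scale w (entry_unit (fst p) (snd p)) \<in> N" for p :: "'m \<times> 'n"
      using tors[OF P(1,3)] by (simp add: torsion_mod_at_def)
    then obtain w where w: "\<And>p :: 'm \<times> 'n. w p \<notin> P"
      "\<And>p :: 'm \<times> 'n. mat_scale (w p) (entry_unit (fst p) (snd p)) \<in> N"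
      by metis
    have "mat_scale (\<Prod>p\<in>UNIV. w p) (entry_unit i j) \<in> N" for i j
    proof -
      have "(\<Prod>p\<in>UNIV. w p) = (\<Prod>p\<in>UNIV - {(i, j)}. w p) * w (i, j)"
        by (simp add: prod.remove[of UNIV "(i, j)"] mult.commute)
      then show ?thesis
        using mat_scale.subspace_scale[OF N w(2)[of "(i, j)"]] by simp
    qed
    then have "(\<Prod>p\<in>UNIV. w p) \<in> P"
      using P(2) by (auto simp: J_def)
    then show False
      using prime_ideal_prod[OF P(1), of UNIV w] w(1) by blast
  qed
  then obtain h where h: "h > 0" "max_pow h \<subseteq> J"
    using max_pow_subset_if_V_ideal_subset[OF J] by blast
  have "X \<in> N" if "X \<in> max_pow_mat h" for X
  proof -
    have "X $ i $ j \<in> J" for i j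
      using that h(2) by (auto simp: mem_max_pow_mat_iff)
    then have "(\<Sum>i\<in>UNIV. \<Sum>j\<in>UNIV. mat_scale (X $ i $ j) (entry_unit i j)) \<in> N"
      by (intro mat_scale.subspace_sum[OF N]) (simp add: J_def)
    then show ?thesis
      by (simp flip: matrix_entry_decomp)
  qed
  with h(1) show ?thesis
    by blast
qed


section \<open>The equivalences\<close>

text \<open>\<open>GREATEST\<close> is meaningful only for a bounded set of exponents; separatedness
  provides the bound for a nonzero series.\<close>

lemma max_pow_iff_ord: "f \<in> max_pow k \<longleftrightarrow> enat k \<le> ord_mfps f"
proof (cases "f = 0")
  case False
  then obtain b where b: "f \<notin> max_pow b"
    using max_pow_Inter by blast
  define g where "g = (GREATEST l. f \<in> max_pow l)"
  have bound: "l \<le> b" if "f \<in> max_pow l" for l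
    using b max_powD[OF that] nat_le_linear by blast
  have "f \<in> max_pow g"
    unfolding g_def by (rule GreatestI_nat[where P = "\<lambda>l. f \<in> max_pow l" and k = 0 and b = b]) (simp_all add: bound)
  moreover have "l \<le> g" if "f \<in> max_pow l" for l
    unfolding g_def using that by (rule Greatest_le_nat[where P = "\<lambda>l. f \<in> max_pow l"]) (rule bound)
  ultimately show ?thesis
    using False max_powD by (auto simp: ord_mfps_def g_def)
qed (simp add: ord_mfps_def)

lemma max_pow_mat_iff_ord: "A \<in> max_pow_mat k \<longleftrightarrow> enat k \<le> ord_mat A"
  unfolding ord_mat_def by (subst Min_ge_iff) (auto simp: mem_max_pow_mat_iff max_pow_iff_ord)

text \<open>The inclusion forces the order of \<open>A\<close> to be finite and at most
  \<open>l + 1\<close>. Hence \<open>N = 2 * l + 2 - e\<close> exceeds \<open>l\<close>, in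
  particular is positive as finite determinacy requires.\<close>

lemma determined_bound:
  fixes A :: "('k::field, 's::finite) mfps^'n::finite^'m::finite"
  assumes A: "A \<in> max_pow_mat 1" and sub: "max_pow_mat (Suc l) \<subseteq> tangent_image G A"
  shows "\<exists>N. enat N + ord_mat A = enat (2 * l + 2) \<and> l < N \<and> determined G N A"
proof -
  have le: "e \<le> Suc l" if "A \<in> max_pow_mat e" for e
    using sub tangent_image_subset_level tangent_level_subset_max_pow_mat[OF that]
    by (blast intro: max_pow_mat_subset_imp_le)
  have "ord_mat A \<noteq> \<infinity>"
  proof
    assume "ord_mat A = \<infinity>"
    then have "A \<in> max_pow_mat (Suc (Suc l))"
      by (simp add: max_pow_mat_iff_ord)
    then show False
      using le by fastforce
  qed
  then obtain e where e: "ord_mat A = enat e"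
    by auto
  have Ae: "A \<in> max_pow_mat e" and "e \<ge> 1"
    using max_pow_mat_iff_ord[of A] A e by auto
  moreover have "e \<le> Suc l"
    using le[OF Ae] .
  moreover have "determined G (2 * l + 2 - e) A"
    using determined_if_max_pow_mat_subset[OF sub Ae] \<open>e \<ge> 1\<close> \<open>e \<le> Suc l\<close> by simp
  ultimately show ?thesis
    by (intro exI[of _ "2 * l + 2 - e"]) (auto simp: e)
qed

text \<open>Each condition is compared with \<open>cond1\<close>. The additive equation for
  \<open>N\<close> avoids subtraction in \<open>enat\<close> and contains the finiteness of the
  order. The variants \<open>cond5'\<close> and \<open>cond6'\<close> are the two reformulations
  following "i.e.".\<close>

theorem proposition4p2:
  fixes G :: group_kind
    and A :: "('k::field, 's::finite) mfps^'n::finite^'m::finite"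
  assumes "A \<in> max_pow_mat 1"
  shows
    "let T = tangent_image G A;
         Te = ext_tangent_image G A;
         cond1 = (\<lambda>l. l > 0 \<and> max_pow_mat (l + 1) \<subseteq> T);
         cond2 = (\<lambda>d. has_quotient_dim mat_scale_K (max_pow_mat 1) T d);
         cond3 = (\<lambda>de. has_quotient_dim mat_scale_K UNIV Te de);
         cond4 = (\<lambda>h. h > 0 \<and> max_pow_mat h \<subseteq> Te);
         cond5 = (\<lambda>t \<Theta> k. k > 0 \<and> max_pow k \<subseteq> minors_ideal t \<Theta>);
         cond5' = (\<lambda>t \<Theta>. V_ideal (minors_ideal t \<Theta>) \<subseteq> {max_ideal});
         cond6 = (quotient_support mat_scale UNIV Te \<subseteq> {max_ideal});
         cond6' = (\<forall>P. prime_ideal P \<and> P \<noteq> max_ideal \<longrightarrow>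
                     localization mat_scale UNIV P = sub_localization mat_scale UNIV Te P);
         bound_determined = (\<lambda>c. \<exists>N. enat N + ord_mat A = enat (2 * c + 2) \<and> determined G N A)
     in ((\<exists>l. cond1 l) \<longleftrightarrow> (\<exists>d. cond2 d)) \<and>
        ((\<exists>l. cond1 l) \<longleftrightarrow> (\<exists>de. cond3 de)) \<and>
        ((\<exists>l. cond1 l) \<longleftrightarrow> (\<exists>h. cond4 h)) \<and>
        (\<forall>t \<Theta>. presents_quotient t \<Theta> Te \<longrightarrow>
           ((\<exists>l. cond1 l) \<longleftrightarrow> (\<exists>k. cond5 t \<Theta> k)) \<and> ((\<exists>l. cond1 l) \<longleftrightarrow> cond5' t \<Theta>)) \<and>
        ((\<exists>l. cond1 l) \<longleftrightarrow> cond6) \<and>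
        ((\<exists>l. cond1 l) \<longleftrightarrow> cond6') \<and>
        ((\<exists>l. cond1 l) \<longrightarrow> finitely_determined G A) \<and>
        (\<forall>l. cond1 l \<longrightarrow> bound_determined l) \<and>
        (\<forall>d. cond2 d \<longrightarrow> bound_determined d) \<and>
        (\<forall>de. cond3 de \<longrightarrow> bound_determined de) \<and>
        (\<forall>h. cond4 h \<longrightarrow> bound_determined h) \<and>
        (\<forall>t \<Theta> k. presents_quotient t \<Theta> Te \<and> cond5 t \<Theta> k \<longrightarrow> bound_determined k)"
proof -
  define T Te where "T = tangent_image G A" and "Te = ext_tangent_image G A"
  define C where "C \<longleftrightarrow> (\<exists>l. l > 0 \<and> max_pow_mat (l + 1) \<subseteq> T)"
  define bound where "bound c \<longleftrightarrow> (\<exists>N. enat N + ord_mat A = enat (2 * c + 2) \<and> determined G N A)" for c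
  note subT = subspace_tangent_image[of G A, folded T_def]
  note subTe = subspace_ext_tangent_image[of G A, folded Te_def]
  \<comment> \<open>The case \<open>l = 0\<close> is included, since a quotient dimension may be
    0.\<close>
  have T_bound: "bound l" if "max_pow_mat (Suc l) \<subseteq> T" for l
    using determined_bound[OF assms, of l G] that unfolding bound_def T_def by blast
  have Te_T: "max_pow_mat (Suc h) \<subseteq> T" if "max_pow_mat h \<subseteq> Te" for h
    using max_pow_mat_subset_tangent_image that unfolding T_def Te_def by blast
  \<comment> \<open>\<open>cond1\<close> asks for a positive exponent, which is obtained by passing
    to the next power of \<mm>.\<close>
  have C_if_T: C if "max_pow_mat (Suc l) \<subseteq> T" for l
  proof -
    have "max_pow_mat (Suc l + 1) \<subseteq> T"
      using that max_pow_matD[of _ "Suc l + 1" "Suc l"] by auto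
    then show ?thesis
      unfolding C_def by blast
  qed
  have Te_if_C: "\<exists>h>0. max_pow_mat h \<subseteq> Te" if C
    using that tangent_image_subset_ext[of G A] unfolding C_def T_def Te_def by fastforce

  \<comment> \<open>Starting from \<mm> M a quotient dimension \<open>d\<close> yields the exponent
    \<open>1 + d\<close>, starting from M it yields \<open>d\<close>; the extended image then loses
    one order, so both dimensions take the place of \<open>l\<close>.\<close>
  have dim_T: "max_pow_mat (Suc d) \<subseteq> T" if "has_quotient_dim mat_scale_K (max_pow_mat 1) T d" for d
    using has_quotient_dim_imp_max_pow_mat_subset[OF subT that] by simp
  have dim_Te: "max_pow_mat d \<subseteq> Te" if "has_quotient_dim mat_scale_K UNIV Te d" for d
    using has_quotient_dim_imp_max_pow_mat_subset[OF subTe, of 0 d] that by simp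
  have cond2: "C \<longleftrightarrow> (\<exists>d. has_quotient_dim mat_scale_K (max_pow_mat 1) T d)"
    using has_quotient_dim_if_max_pow_mat_subset[OF subT, of _ 1] C_if_T dim_T unfolding C_def by blast
  have cond3: "C \<longleftrightarrow> (\<exists>d. has_quotient_dim mat_scale_K UNIV Te d)"
  proof
    assume C
    then obtain h where "max_pow_mat h \<subseteq> Te"
      using Te_if_C by blast
    from has_quotient_dim_if_max_pow_mat_subset[OF subTe this, of 0]
    show "\<exists>d. has_quotient_dim mat_scale_K UNIV Te d"
      by simp
  qed (use C_if_T Te_T dim_Te in blast)
  have cond4: "C \<longleftrightarrow> (\<exists>h. h > 0 \<and> max_pow_mat h \<subseteq> Te)"
    using Te_if_C C_if_T Te_T by blast

  have minors_Te: "max_pow_mat k \<subseteq> Te"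
    if \<Theta>: "presents_quotient t \<Theta> Te" and k: "max_pow k \<subseteq> minors_ideal t \<Theta>" for t \<Theta> k
  proof
    fix X :: "('k, 's) mfps^'n^'m" assume "X \<in> max_pow_mat k"
    then have "X $ i $ j \<in> minors_ideal t \<Theta>" for i j
      using k by (auto simp: mem_max_pow_mat_iff)
    note minors_ideal_annihilates[OF \<Theta> subTe this]
    then have "(\<Sum>i\<in>UNIV. \<Sum>j\<in>UNIV. mat_scale (X $ i $ j) (entry_unit i j)) \<in> Te"
      by (intro mat_scale.subspace_sum[OF subTe])
    then show "X \<in> Te"
      by (simp flip: matrix_entry_decomp)
  qed
  have minors_power: "\<exists>k>0. max_pow k \<subseteq> minors_ideal t \<Theta>"
    if \<Theta>: "presents_quotient t \<Theta> Te" and C for t \<Theta>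
  proof (rule max_pow_subset_if_var_powers)
    show "module.subspace (*) (minors_ideal t \<Theta>)"
      unfolding minors_ideal_def by (rule module.subspace_span[OF module_mult])
    obtain h where h: "max_pow_mat h \<subseteq> Te"
      using Te_if_C[OF \<open>C\<close>] by blast
    fix v :: 's
    \<comment> \<open>The determinant of this multiplication is
      \<open>(mvar v ^ h) ^ CARD('m \<times> 'n)\<close>, again a power of the variable.\<close>
    have "mat_scale (mvar v ^ h) (entry_unit i j) \<in> Te" for i j
      using h max_pow_mat_scale[OF max_pow_power[OF var_in_max_pow], of "entry_unit i j" 0 h h v] by auto
    from power_in_minors_ideal[OF \<Theta> this]
    show "\<exists>n. mvar v ^ n \<in> minors_ideal t \<Theta>"
      by (metis power_mult)
  qed
  have minors_V: "V_ideal (minors_ideal t \<Theta>) \<subseteq> {max_ideal}"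
    if k: "max_pow k \<subseteq> minors_ideal t \<Theta>" for t \<Theta> k
  proof
    fix P assume "P \<in> V_ideal (minors_ideal t \<Theta>)"
    then have P: "prime_ideal P" "max_pow k \<subseteq> P"
      using k by (auto simp: V_ideal_def)
    have "mvar v \<in> P" for v
      using prime_ideal_power[OF P(1), of "mvar v" k] max_pow_power[OF var_in_max_pow, of v k] P(2) by blast
    then show "P \<in> {max_ideal}"
      using prime_ideal_eq_max_ideal[OF P(1)] by blast
  qed
  have cond5: "C \<longleftrightarrow> (\<exists>k. k > 0 \<and> max_pow k \<subseteq> minors_ideal t \<Theta>)"
    and cond5': "C \<longleftrightarrow> V_ideal (minors_ideal t \<Theta>) \<subseteq> {max_ideal}"
    if \<Theta>: "presents_quotient t \<Theta> Te" for t \<Theta>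
  proof -
    have "module.subspace (*) (minors_ideal t \<Theta>)"
      unfolding minors_ideal_def by (rule module.subspace_span[OF module_mult])
    note V_power = max_pow_subset_if_V_ideal_subset[OF this]
    show eq: "C \<longleftrightarrow> (\<exists>k. k > 0 \<and> max_pow k \<subseteq> minors_ideal t \<Theta>)"
      using minors_power[OF \<Theta>] minors_Te[OF \<Theta>] Te_T C_if_T by blast
    show "C \<longleftrightarrow> V_ideal (minors_ideal t \<Theta>) \<subseteq> {max_ideal}"
      unfolding eq using V_power minors_V by blast
  qed

  have torsion: "C \<longleftrightarrow> (\<forall>P. prime_ideal P \<and> P \<noteq> max_ideal \<longrightarrow> torsion_mod_at Te P)"
  proof
    assume C
    then obtain h where "max_pow_mat h \<subseteq> Te"
      using Te_if_C by blast
    then show "\<forall>P. prime_ideal P \<and> P \<noteq> max_ideal \<longrightarrow> torsion_mod_at Te P"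
      using torsion_mod_at_if_max_pow_mat_subset by blast
  next
    assume "\<forall>P. prime_ideal P \<and> P \<noteq> max_ideal \<longrightarrow> torsion_mod_at Te P"
    then obtain h where "max_pow_mat h \<subseteq> Te"
      using max_pow_mat_subset_if_torsion_mod_at[OF subTe] by blast
    then show C
      using Te_T C_if_T by blast
  qed
  have cond6: "C \<longleftrightarrow> quotient_support mat_scale UNIV Te \<subseteq> {max_ideal}"
    unfolding torsion quotient_support_subset_iff[OF subTe] ..
  have cond6': "C \<longleftrightarrow> (\<forall>P. prime_ideal P \<and> P \<noteq> max_ideal \<longrightarrow>
      localization mat_scale UNIV P = sub_localization mat_scale UNIV Te P)"
    unfolding torsion using localization_eq_sub_localization_iff[OF _ subTe] by auto
  have finite: "finitely_determined G A" if C
  proof -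
    obtain l where "max_pow_mat (Suc l) \<subseteq> T"
      using \<open>C\<close> unfolding C_def by auto
    then show ?thesis
      using determined_bound[OF assms, of l G] unfolding finitely_determined_def T_def
      by (metis gr_implies_not_zero not_gr_zero)
  qed
  show ?thesis
    unfolding Let_def T_def[symmetric] Te_def[symmetric] C_def[symmetric] bound_def[symmetric]
    using cond2 cond3 cond4 cond5 cond5' cond6 cond6' finite T_bound Te_T dim_T dim_Te minors_Te
    by (intro conjI allI impI) (auto simp del: split_paired_Ex)
qed

end
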